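(* Under the standing assumptions on $\Omega,p,\Psi,f$ listed in the context, the problem $$-\operatorname{div}\mathbf a(x,\nabla U(x))=f(x,U(x))\ \text{in }\Omega,\qquad \frac{\partial U}{\partial\nu}=0\ \text{on }\partial\Omega,\qquad 0\le U\le 1\ \text{in }\Omega$$ admits two weak solutions $\underline U,\overline U\in W^{1,p(x)}(\Omega)$ (which are allowed to be equal) such that, if $\underline U=\overline U$ a.e. on $\Omega$, then the problem has no other weak solution.
   Context: Variable exponent spaces: for a measurable bounded $q:\Omega\to[1,\infty)$, $L^{q(x)}(\Omega)$ is the space of measurable $u:\Omega\to\mathbb R$ with $\int_\Omega|u(x)|^{q(x)}dx<\infty$, with the Luxemburg norm $\inf\{t>0:\int_\Omega|u(x)/t|^{q(x)}dx\le1\}$; $W^{1,q(x)}(\Omega)=\{u\in L^{q(x)}(\Omega): |\nabla u|\in L^{q(x)}(\Omega)\}$ (weak gradient) with norm $\|u\|_{L^{q(x)}(\Omega)}+\||\nabla u|\|_{L^{q(x)}(\Omega)}$. Standing assumptions. - $\Omega\subset\mathbb R^N$, $N\ge2$, is an open, bounded, connected Lipschitz domain. - $p:\overline\Omega\to(1,\infty)$ is either log-Hölder continuous (there is $C>0$ with $|p(x)-p(y)|\le C/(-\log|x-y|)$ whenever $0<|x-y|<1/2$) with $p^-:=\min_{\overline\Omega}p\ge\frac{2N}{N+2}$, or continuous with $p^->\frac{2N}{N+2}$. Put $p'(x)=\frac{p(x)}{p(x)-1}$. - $\Psi:\overline\Omega\times(0,\infty)\to(0,\infty)$; $\Psi(\cdot,s)$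 is measurable for each $s>0$; $\Psi(x,\cdot)$ is locally absolutely continuous on $(0,\infty)$ for a.a. $x\in\Omega$; $\lim_{s\to0^+}\Psi(x,s)s=0$ for each $x\in\Omega$; for a.a. $x\in\Omega$ the function $(0,\infty)\ni s\mapsto\Psi(x,s)s$ is strictly increasing. - $\mathbf a:\overline\Omega\times\mathbb R^N\to\mathbb R^N$ is $\mathbf a(x,\xi)=\Psi(x,|\xi|)\xi$ for $\xi\ne0$, $\mathbf a(x,0)=0$; $\Phi:\overline\Omega\times\mathbb R\to[0,\infty)$ is $\Phi(x,s)=\Psi(x,|s|)|s|$ for $s\neq0$, $\Phi(x,0)=0$; $A(x,\xi)=\int_0^{|\xi|}\Phi(x,s)\,ds$. - For every $v\in L^{p(x)}(\Omega)$ one has $\Phi(\cdot,v(\cdot))\in L^{p'(x)}(\Omega)$. - There are constants $\delta>0$, $\tilde\delta\ge0$ with $\int_\Omega A(x,\nabla v)\,dx\ge\delta\int_\Omega|\nabla v|^{p(x)}dx-\tilde\delta$ for all $v\in W^{1,p(x)}(\Omega)$. - $f:\overline\Omega\times[0,1]\to\mathbb R$ is measurable; $f(\cdot,0)\in L^\infty(\Omega)$; $f(x,0)\ge0$ and $f(x,1)\le0$ for a.a. $x\in\Omega$; there are constants $\lambda_0,\gamma>0$ such that for a.a. $x\in\Omega$ the function $[0,1]\ni s\mapsto f(x,s)+\lambda_0s$ is strictly increasing and $[0,1]\ni s\mapsto f(x,s)$ is $\gamma$-Lipschitz. A weak solution of the problem is a function $U\in W^{1,p(x)}(\Omega)$ with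 $0\le U\le1$ a.e. on $\Omega$ and $$\int_\Omega\mathbf a(x,\nabla U)\cdot\nabla\phi\,dx=\int_\Omega f(x,U)\phi\,dx\qquad\text{for all }\phi\in W^{1,p(x)}(\Omega).$$ *)

theory Defs
  imports "HOL-Analysis.Analysis"
begin

text \<open>
  Elements of the function spaces are functions rather than equivalence classes.  Everything is
  with respect to the Lebesgue measure on \<open>\<Omega>\<close>, and equality of elements is equality almost
  everywhere.  Only the values on \<open>\<Omega>\<close> matter.
\<close>


subsection \<open>Lipschitz domains\<close>

text \<open>
  Near every boundary point, \<open>\<Omega>\<close> is the strict subgraph, in some direction \<open>e\<close>, of a Lipschitz
  function \<open>h\<close> on the hyperplane orthogonal to \<open>e\<close>; \<open>y - (y \<bullet> e) *\<^sub>R e\<close> is the projection of \<open>y\<close>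
  to that hyperplane.
\<close>

definition lipschitz_boundary :: "'a::euclidean_space set \<Rightarrow> bool" where
  "lipschitz_boundary \<Omega> \<longleftrightarrow>
     (\<forall>x\<in>frontier \<Omega>. \<exists>V e h L. open V \<and> x \<in> V \<and> norm e = 1 \<and>
        L-lipschitz_on {z. z \<bullet> e = 0} (h :: 'a \<Rightarrow> real) \<and>
        \<Omega> \<inter> V = {y \<in> V. y \<bullet> e < h (y - (y \<bullet> e) *\<^sub>R e)})"

definition bounded_lipschitz_domain :: "'a::euclidean_space set \<Rightarrow> bool" where
  "bounded_lipschitz_domain \<Omega> \<longleftrightarrow>
     open \<Omega> \<and> bounded \<Omega> \<and> connected \<Omega> \<and> \<Omega> \<noteq> {} \<and> lipschitz_boundary \<Omega>"


subsection \<open>Test functions and weak gradients\<close>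

primrec Ck :: "nat \<Rightarrow> ('a::euclidean_space \<Rightarrow> real) \<Rightarrow> bool" where
  "Ck 0 u \<longleftrightarrow> continuous_on UNIV u"
| "Ck (Suc k) u \<longleftrightarrow> (\<forall>x. u differentiable (at x)) \<and>
     (\<forall>b\<in>Basis. Ck k (\<lambda>x. frechet_derivative u (at x) b))"

definition test_function :: "'a::euclidean_space set \<Rightarrow> ('a \<Rightarrow> real) \<Rightarrow> bool" where
  "test_function \<Omega> \<phi> \<longleftrightarrow> (\<forall>k. Ck k \<phi>) \<and>
     compact (closure {x. \<phi> x \<noteq> 0}) \<and> closure {x. \<phi> x \<noteq> 0} \<subseteq> \<Omega>"

definition locally_integrable_on ::
    "('a::euclidean_space \<Rightarrow> 'b::euclidean_space) \<Rightarrow> 'a set \<Rightarrow> bool" where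
  "locally_integrable_on u \<Omega> \<longleftrightarrow> (\<forall>K. compact K \<and> K \<subseteq> \<Omega> \<longrightarrow> integrable (lebesgue_on K) u)"

definition has_weak_gradient ::
    "'a::euclidean_space set \<Rightarrow> ('a \<Rightarrow> real) \<Rightarrow> ('a \<Rightarrow> 'a) \<Rightarrow> bool" where
  "has_weak_gradient \<Omega> u g \<longleftrightarrow>
     locally_integrable_on u \<Omega> \<and> locally_integrable_on g \<Omega> \<and>
     (\<forall>\<phi> b. test_function \<Omega> \<phi> \<and> b \<in> Basis \<longrightarrow>
        (LINT x|lebesgue_on \<Omega>. u x * frechet_derivative \<phi> (at x) b) =
        - (LINT x|lebesgue_on \<Omega>. (g x \<bullet> b) * \<phi> x))"

text \<open>Weak gradients are unique up to null sets; this picks a representative.\<close>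

definition weak_grad :: "'a::euclidean_space set \<Rightarrow> ('a \<Rightarrow> real) \<Rightarrow> 'a \<Rightarrow> 'a" where
  "weak_grad \<Omega> u = (SOME g. has_weak_gradient \<Omega> u g)"


subsection \<open>Variable exponent spaces\<close>

definition Lvar ::
    "'a::euclidean_space set \<Rightarrow> ('a \<Rightarrow> real) \<Rightarrow> ('a \<Rightarrow> real) set" where
  "Lvar \<Omega> q = {u. u \<in> borel_measurable (lebesgue_on \<Omega>) \<and>
                  integrable (lebesgue_on \<Omega>) (\<lambda>x. \<bar>u x\<bar> powr q x)}"

definition W1var ::
    "'a::euclidean_space set \<Rightarrow> ('a \<Rightarrow> real) \<Rightarrow> ('a \<Rightarrow> real) set" where
  "W1var \<Omega> q = {u \<in> Lvar \<Omega> q. (\<exists>g. has_weak_gradient \<Omega> u g) \<and>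
                  (\<lambda>x. norm (weak_grad \<Omega> u x)) \<in> Lvar \<Omega> q}"

definition Linfty :: "'a::euclidean_space set \<Rightarrow> ('a \<Rightarrow> real) set" where
  "Linfty \<Omega> = {u. u \<in> borel_measurable (lebesgue_on \<Omega>) \<and>
                  (\<exists>M. AE x in lebesgue_on \<Omega>. \<bar>u x\<bar> \<le> M)}"

definition log_Hoelder_on :: "'a::euclidean_space set \<Rightarrow> ('a \<Rightarrow> real) \<Rightarrow> bool" where
  "log_Hoelder_on S p \<longleftrightarrow>
     (\<exists>C>0. \<forall>x\<in>S. \<forall>y\<in>S. 0 < norm (x - y) \<and> norm (x - y) < 1/2 \<longrightarrow>
        \<bar>p x - p y\<bar> \<le> C / (- ln (norm (x - y))))"

definition conj_exponent :: "('a \<Rightarrow> real) \<Rightarrow> 'a \<Rightarrow> real" where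
  "conj_exponent p x = p x / (p x - 1)"


subsection \<open>Local absolute continuity\<close>

definition abs_continuous_on :: "real set \<Rightarrow> (real \<Rightarrow> real) \<Rightarrow> bool" where
  "abs_continuous_on S h \<longleftrightarrow>
     (\<forall>\<epsilon>>0. \<exists>\<delta>>0. \<forall>(n::nat) a b.
        (\<forall>i<n. a i \<le> b i \<and> {a i..b i} \<subseteq> S) \<and>
        disjoint_family_on (\<lambda>i. {a i<..<b i}) {..<n} \<and>
        (\<Sum>i<n. b i - a i) < \<delta> \<longrightarrow>
        (\<Sum>i<n. \<bar>h (b i) - h (a i)\<bar>) < \<epsilon>)"

definition locally_abs_continuous_on :: "real set \<Rightarrow> (real \<Rightarrow> real) \<Rightarrow> bool" where
  "locally_abs_continuous_on S h \<longleftrightarrow> (\<forall>c d. {c..d} \<subseteq> S \<longrightarrow> abs_continuous_on {c..d} h)"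


subsection \<open>The flux and the weak formulation\<close>

definition flux :: "('a \<Rightarrow> real \<Rightarrow> real) \<Rightarrow> 'a::euclidean_space \<Rightarrow> 'a \<Rightarrow> 'a" where
  "flux \<Psi> x \<xi> = (if \<xi> = 0 then 0 else \<Psi> x (norm \<xi>) *\<^sub>R \<xi>)"

definition flux_modulus :: "('a \<Rightarrow> real \<Rightarrow> real) \<Rightarrow> 'a \<Rightarrow> real \<Rightarrow> real" where
  "flux_modulus \<Psi> x s = (if s = 0 then 0 else \<Psi> x \<bar>s\<bar> * \<bar>s\<bar>)"

definition flux_potential :: "('a \<Rightarrow> real \<Rightarrow> real) \<Rightarrow> 'a::euclidean_space \<Rightarrow> 'a \<Rightarrow> real" where
  "flux_potential \<Psi> x \<xi> = (LINT s:{0..norm \<xi>}|lborel. flux_modulus \<Psi> x s)"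

text \<open>
  The homogeneous Neumann condition is encoded by testing with all of \<open>W1var \<Omega> p\<close>, not only with
  functions that vanish on the boundary.
\<close>

definition weak_solution ::
    "'a::euclidean_space set \<Rightarrow> ('a \<Rightarrow> real) \<Rightarrow> ('a \<Rightarrow> real \<Rightarrow> real) \<Rightarrow> ('a \<Rightarrow> real \<Rightarrow> real) \<Rightarrow>
     ('a \<Rightarrow> real) \<Rightarrow> bool" where
  "weak_solution \<Omega> p \<Psi> f U \<longleftrightarrow>
     U \<in> W1var \<Omega> p \<and> (AE x in lebesgue_on \<Omega>. 0 \<le> U x \<and> U x \<le> 1) \<and>
     (\<forall>\<phi>\<in>W1var \<Omega> p.
        (LINT x|lebesgue_on \<Omega>. flux \<Psi> x (weak_grad \<Omega> U x) \<bullet> weak_grad \<Omega> \<phi> x) =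
        (LINT x|lebesgue_on \<Omega>. f x (U x) * \<phi> x))"

end

theory Submission
  imports Defs
begin

text \<open>
  If the problem has a single weak solution, take \<open>U\<^sub>1 = U\<^sub>2\<close> to be that solution; if it has
  two different ones, take these.  So the claim amounts to the existence of one weak solution.

  That solution is the limit of the decreasing iteration \<open>u\<^sub>0 = 1\<close>, \<open>u\<^sub>n\<^sub>+\<^sub>1 = T u\<^sub>n\<close>, where \<open>T v\<close> is
  the unique solution \<open>u\<close> of \<open>- div a(x, \<nabla>u) + \<mu> u = g\<close> with \<open>g = f(x, v) + \<mu> v\<close>.  Since
  \<open>0 \<le> g \<le> \<mu>\<close>, comparison with the solutions \<open>0\<close> (for \<open>g = 0\<close>) and \<open>1\<close> (for \<open>g = \<mu>\<close>) keeps the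
  iterates in \<open>[0, 1]\<close>, and \<open>T\<close> is monotone and continuous in \<open>L\<^sup>2\<close>.

  The equation is solved by minimising the convex functional
  \<open>\<integral> A(x, \<nabla>u) + (\<mu> u - g)\<^sup>2 / (2 \<mu>)\<close>.  No weak compactness is used: among almost minimisers choose
  those that almost minimise \<open>\<integral> (1 + |\<nabla>u|\<^sup>2)\<^sup>1\<^sup>/\<^sup>2\<close>.  The midpoint convexity gap of this second
  functional, together with the bound on \<open>\<integral> |\<nabla>u|\<^bsup>p(x)\<^esup>\<close> with \<open>p \<ge> q > 1\<close>, makes the gradients a
  Cauchy sequence in \<open>L\<^sup>1\<close>.  All truncations are \<open>C\<^sup>1\<close>, so only the \<open>C\<^sup>1\<close> chain rule for weak
  gradients is needed, which follows by mollification.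
\<close>

subsection \<open>Bump functions\<close>

text \<open>The growth hypothesis is qualitative: \<open>flux_modulus\<close> maps
  \<open>Lvar \<Omega> p\<close> into the space of exponent \<open>conj_exponent p\<close>, with no
  pointwise bound by a power. Measurability and integrability of the flux and of its potential are
  therefore won by applying it to suitable functions of the gradient.

  Convexity of the potential comes without a rate. Almost minimisers of the energy are close in
  \<open>L^2\<close> through the quadratic term, but nothing similar holds for their gradients. The
  second functional supplies the missing rate: its integrand is strictly convex with an explicit
  gap, yet of linear growth, so the gradient bound keeps it finite. Once the gradients converge
  almost everywhere along a subsequence, Fatou's lemma replaces weak lower semicontinuity.

  The constant \<open>\<mu>\<close> is \<open>lambda_0\<close>. It makes
  \<open>f x s + \<mu> * s\<close> increasing in \<open>s\<close>, and it is the coefficient of the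
  zero-order term that makes \<open>T\<close> single-valued and stable. Along the iteration no flux
  is passed to the limit: if \<open>w\<close> is the limit of the iterates, the equation is solved
  afresh with data from \<open>w\<close>, and the stability estimate shows
  \<open>T w = w\<close>.\<close>

lemma CkSucI:
  fixes u :: "'a::euclidean_space \<Rightarrow> real"
  assumes "\<And>x. (u has_derivative D x) (at x)" "\<And>b. b \<in> Basis \<Longrightarrow> Ck k (\<lambda>x. D x b)"
  shows "Ck (Suc k) u"
proof -
  have "frechet_derivative u (at x) = D x" for x
    using frechet_derivative_at[OF assms(1)] by simp
  then show ?thesis
    using assms by (auto simp: differentiable_def)
qed

lemma CkSucD:
  fixes u :: "'a::euclidean_space \<Rightarrow> real"
  assumes "Ck (Suc k) u"
  shows "(u has_derivative frechet_derivative u (at x)) (at x)"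
    "b \<in> Basis \<Longrightarrow> Ck k (\<lambda>x. frechet_derivative u (at x) b)"
  using assms by (auto simp: frechet_derivative_works)

lemma Ck_continuous:
  fixes u :: "'a::euclidean_space \<Rightarrow> real"
  shows "Ck k u \<Longrightarrow> continuous_on UNIV u"
  by (cases k) (auto intro!: differentiable_imp_continuous_on simp: differentiable_on_def)

lemma Ck_Suc_imp:
  fixes u :: "'a::euclidean_space \<Rightarrow> real"
  shows "Ck (Suc k) u \<Longrightarrow> Ck k u"
proof (induction k arbitrary: u)
  case 0
  then show ?case by (simp add: Ck_continuous[of "Suc 0"] del: Ck.simps(2))
next
  case (Suc k)
  show ?case
    by (rule CkSucI[OF CkSucD(1)[OF Suc.prems] Suc.IH[OF CkSucD(2)[OF Suc.prems]]])
qed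

lemma Ck_add:
  fixes u v :: "'a::euclidean_space \<Rightarrow> real"
  shows "Ck k u \<Longrightarrow> Ck k v \<Longrightarrow> Ck k (\<lambda>x. u x + v x)"
proof (induction k arbitrary: u v)
  case 0
  then show ?case by (auto intro: continuous_on_add)
next
  case (Suc k)
  show ?case
    by (rule CkSucI[OF has_derivative_add[OF CkSucD(1)[OF Suc.prems(1)] CkSucD(1)[OF Suc.prems(2)]]])
      (intro Suc.IH CkSucD(2)[OF Suc.prems(1)] CkSucD(2)[OF Suc.prems(2)])
qed

text \<open>The product rule produces the undifferentiated factors next to the derivatives, so the
  induction needs \<open>Ck_Suc_imp\<close> to lower their order.\<close>

lemma Ck_mult:
  fixes u v :: "'a::euclidean_space \<Rightarrow> real"
  shows "Ck k u \<Longrightarrow> Ck k v \<Longrightarrow> Ck k (\<lambda>x. u x * v x)"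
proof (induction k arbitrary: u v)
  case 0
  then show ?case by (auto intro: continuous_on_mult)
next
  case (Suc k)
  show ?case
    by (rule CkSucI[OF has_derivative_mult[OF CkSucD(1)[OF Suc.prems(1)] CkSucD(1)[OF Suc.prems(2)]]])
      (intro Ck_add Suc.IH CkSucD(2)[OF Suc.prems(1)] CkSucD(2)[OF Suc.prems(2)]
        Ck_Suc_imp[OF Suc.prems(1)] Ck_Suc_imp[OF Suc.prems(2)])
qed

lemma Ck_const: "Ck k (\<lambda>x::'a::euclidean_space. c :: real)"
proof (induction k arbitrary: c)
  case (Suc k)
  show ?case by (rule CkSucI[OF has_derivative_const Suc.IH])
qed simp

lemma Ck_inner_left: "Ck k (\<lambda>x::'a::euclidean_space. (x - a) \<bullet> b)"
proof (cases k)
  case 0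
  then show ?thesis by (auto intro!: continuous_intros)
next
  case (Suc n)
  have "((\<lambda>x. (x - a) \<bullet> b) has_derivative (\<lambda>h. h \<bullet> b)) (at x)" for x
    by (auto intro!: derivative_eq_intros)
  then show ?thesis unfolding Suc by (rule CkSucI) (rule Ck_const)
qed

text \<open>The function \<open>exp (- 1 / t) / t ^ m\<close>, extended by 0 to
  \<open>t \<le> 0\<close>. Differentiation stays inside the span of this family, so smoothness of
  all members is proved by a single induction.\<close>

definition flat :: "nat \<Rightarrow> real \<Rightarrow> real" where
  "flat m t = (if t \<le> 0 then 0 else exp (- inverse t) * inverse t ^ m)"

lemma flat_nonneg: "0 \<le> flat m t"
  by (simp add: flat_def)

lemma flat_le_1: "flat 0 t \<le> 1"
  by (simp add: flat_def)

lemma flat_eq_0_iff: "flat m t = 0 \<longleftrightarrow> t \<le> 0"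
  by (simp add: flat_def)

lemma flat_tendsto_0: "(flat m \<longlongrightarrow> 0) (at_right 0)"
proof -
  have "((\<lambda>t::real. inverse t ^ m / exp (inverse t)) \<longlongrightarrow> 0) (at_right 0)"
    by (rule filterlim_compose[OF tendsto_power_div_exp_0 filterlim_inverse_at_top_right])
  moreover have "\<forall>\<^sub>F t in at_right (0::real). inverse t ^ m / exp (inverse t) = flat m t"
    by (rule eventually_at_rightI[of 0 1]) (simp add: flat_def exp_minus divide_inverse mult.commute, simp)
  ultimately show ?thesis by (rule Lim_transform_eventually)
qed

text \<open>At 0 the difference quotient \<open>flat m h / h\<close> is
  \<open>flat (m + 1) h\<close> for \<open>h > 0\<close> and vanishes for \<open>h < 0\<close>. It
  therefore tends to 0, which is also the value of the right-hand side there.\<close>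

lemma flat_deriv: "(flat m has_real_derivative flat (m + 2) t - m * flat (m + 1) t) (at t)"
proof -
  consider "t < 0" | "t > 0" | "t = 0" by linarith
  then show ?thesis
  proof cases
    case 1
    have "((\<lambda>t. 0) has_real_derivative flat (m + 2) t - m * flat (m + 1) t) (at t)"
      using 1 by (simp add: flat_def)
    then show ?thesis
      by (rule has_field_derivative_transform_within_open[of _ _ _ "{..<0}"]) (use 1 in \<open>auto simp: flat_def\<close>)
  next
    case 2
    have i: "(inverse has_real_derivative - (inverse t)\<^sup>2) (at t)"
      using DERIV_inverse[of t UNIV] 2 by (simp add: power2_eq_square)
    have e: "((\<lambda>t. exp (- inverse t)) has_real_derivative exp (- inverse t) * (inverse t)\<^sup>2) (at t)"
      using DERIV_fun_exp[OF DERIV_minus[OF i]] by simp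
    have p: "((\<lambda>t. inverse t ^ m) has_real_derivative - (m * inverse t ^ (m + 1))) (at t)"
      using DERIV_power[OF i, of m] by (cases m) (auto simp: power2_eq_square mult_ac)
    have "exp (- inverse t) * (inverse t)\<^sup>2 * inverse t ^ m + - (m * inverse t ^ (m + 1)) * exp (- inverse t)
        = flat (m + 2) t - m * flat (m + 1) t"
      using 2 by (simp add: flat_def power_add power2_eq_square algebra_simps)
    with DERIV_mult[OF e p]
    have "((\<lambda>t. exp (- inverse t) * inverse t ^ m) has_real_derivative
        flat (m + 2) t - m * flat (m + 1) t) (at t)"
      by simp
    then show ?thesis
      by (rule has_field_derivative_transform_within_open[of _ _ _ "{0<..}"]) (use 2 in \<open>auto simp: flat_def\<close>)
  next
    case 3
    have r: "((\<lambda>h. flat m h / h) \<longlongrightarrow> 0) (at_right 0)"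
    proof (rule Lim_transform_eventually[OF flat_tendsto_0[of "Suc m"]])
      have "flat (Suc m) h = flat m h / h" if "h > 0" for h
        using that by (simp add: flat_def divide_inverse)
      then show "\<forall>\<^sub>F h in at_right 0. flat (Suc m) h = flat m h / h"
        by (rule eventually_mono[OF eventually_at_right_less])
    qed
    have l: "((\<lambda>h. flat m h / h) \<longlongrightarrow> 0) (at_left 0)"
    proof (rule Lim_transform_eventually[OF tendsto_const])
      have "0 = flat m h / h" if "h < 0" for h
        using that by (simp add: flat_def)
      then show "\<forall>\<^sub>F h in at_left 0. 0 = flat m h / h"
        by (auto intro!: eventually_at_leftI[of "-1"])
    qed
    have "((\<lambda>h. flat m h / h) \<longlongrightarrow> 0) (at 0)"
      using r l by (rule filterlim_split_at[rotated])
    then show ?thesis using 3 by (simp add: DERIV_def flat_def)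
  qed
qed

lemma measurable_flat [measurable]: "flat m \<in> borel_measurable borel"
  by (rule borel_measurable_continuous_onI, rule DERIV_continuous_on[of _ _ "\<lambda>t. flat (m + 2) t - m * flat (m + 1) t"])
    (rule DERIV_subset[OF flat_deriv], simp)

text \<open>The standard mollifier without normalisation. For \<open>r > 0\<close> the argument of
  \<open>flat\<close> is a polynomial in \<open>x\<close> that is positive exactly on the open ball
  of radius \<open>r\<close> about \<open>a\<close>.\<close>

definition bump :: "real \<Rightarrow> 'a::euclidean_space \<Rightarrow> 'a \<Rightarrow> real" where
  "bump r a x = flat 0 (r\<^sup>2 - (x - a) \<bullet> (x - a))"

text \<open>The derivative of \<open>bump r a\<close> at \<open>x\<close> in direction
  \<open>b\<close>; for \<open>m = 0\<close> the derivative of \<open>flat m\<close> is just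
  \<open>flat 2\<close>.\<close>

definition dbump :: "real \<Rightarrow> 'a::euclidean_space \<Rightarrow> 'a \<Rightarrow> 'a \<Rightarrow> real" where
  "dbump r b a x = flat 2 (r\<^sup>2 - (x - a) \<bullet> (x - a)) * (- 2 * ((x - a) \<bullet> b))"

lemma has_derivative_flat:
  "((\<lambda>x. flat m (r - (x - a) \<bullet> (x - a))) has_derivative
    (\<lambda>h. (flat (m + 2) (r - (x - a) \<bullet> (x - a)) + - real m * flat (m + 1) (r - (x - a) \<bullet> (x - a)))
       * (- 2 * ((x - a) \<bullet> h)))) (at (x::'a::euclidean_space))"
proof -
  have "((\<lambda>x. r - (x - a) \<bullet> (x - a)) has_derivative (\<lambda>h. - 2 * ((x - a) \<bullet> h))) (at x)"
    by (auto intro!: derivative_eq_intros simp: inner_commute)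
  from has_derivative_compose[OF this has_field_derivative_imp_has_derivative[OF flat_deriv]]
  show ?thesis by (simp add: mult_ac algebra_simps)
qed

text \<open>The derivative is a combination of \<open>flat (m + 2)\<close> and
  \<open>flat (m + 1)\<close> of the same argument times a linear function, so the induction on
  \<open>k\<close> runs over all \<open>m\<close> at once.\<close>

lemma Ck_flat: "Ck k (\<lambda>x::'a::euclidean_space. flat m (r - (x - a) \<bullet> (x - a)))"
proof (induction k arbitrary: m)
  case 0
  show ?case
    using has_derivative_flat
    by (auto intro!: differentiable_imp_continuous_on simp: differentiable_on_def differentiable_def) blast
next
  case (Suc k)
  show ?case
    by (rule CkSucI[OF has_derivative_flat])
      (intro Ck_mult Ck_add Suc Ck_const Ck_inner_left)
qed

lemma bump_has_derivative:
  "(bump r a has_derivative (\<lambda>b. dbump r b a x)) (at x)"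
  using has_derivative_flat[of 0 "r\<^sup>2" a x] unfolding bump_def[abs_def] dbump_def by (simp add: numeral_2_eq_2)

lemma frechet_derivative_bump: "frechet_derivative (bump r a) (at x) b = dbump r b a x"
  using fun_cong[OF frechet_derivative_at[OF bump_has_derivative, of r a x], of b] by simp

lemma bump_nonneg: "0 \<le> bump r a x" and bump_le_1: "bump r a x \<le> 1"
  by (simp_all add: bump_def flat_nonneg flat_le_1)

lemma inner_diff_self: "(x - a) \<bullet> (x - a) = (dist a x)\<^sup>2"
  using power2_norm_eq_inner[of "x - a"] by (metis dist_commute dist_norm)

lemma bump_eq_0_iff: "r > 0 \<Longrightarrow> bump r a x = 0 \<longleftrightarrow> x \<notin> ball a r"
  using abs_le_square_iff[of r "dist a x"] by (simp add: bump_def flat_eq_0_iff inner_diff_self not_less)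

lemma dbump_eq_0: "r > 0 \<Longrightarrow> x \<notin> ball a r \<Longrightarrow> dbump r b a x = 0"
  using abs_le_square_iff[of r "dist a x"] by (simp add: dbump_def flat_eq_0_iff inner_diff_self not_less)

lemma bump_commute: "bump r a x = bump r x a"
  by (simp add: bump_def inner_diff_self dist_commute)

text \<open>Differentiating the kernel in its centre is, up to sign, differentiating it in its
  variable. This turns the derivative of a mollification into an integral against the derivative of
  a test function.\<close>

lemma dbump_commute: "dbump r b a x = - dbump r b x a"
  unfolding dbump_def inner_diff_self by (simp add: dist_commute inner_diff_left algebra_simps)

lemma bump_translate: "bump r a x = bump r 0 (x - a)"
  and dbump_translate: "dbump r b a x = dbump r b 0 (x - a)"
  by (simp_all add: bump_def dbump_def)

lemma continuous_bump: "continuous_on UNIV (bump r a)"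
  using Ck_flat[of 0 0 "r\<^sup>2" a] by (simp add: bump_def[abs_def])

lemma continuous_dbump: "continuous_on UNIV (dbump r b a)"
  unfolding dbump_def[abs_def]
  by (intro continuous_intros) (use Ck_flat[of 0 2 "r\<^sup>2" a] in simp)

lemma measurable_bump [measurable]: "bump r a \<in> borel_measurable borel"
  and measurable_dbump [measurable]: "dbump r b a \<in> borel_measurable borel"
  by (rule borel_measurable_continuous_onI[OF continuous_bump], rule borel_measurable_continuous_onI[OF continuous_dbump])

lemma test_function_bump:
  assumes "r > 0" "cball a r \<subseteq> \<Omega>"
  shows "test_function \<Omega> (bump r a)"
proof -
  have "{x. bump r a x \<noteq> 0} = ball a r"
    using bump_eq_0_iff[OF assms(1), of a] by blast
  moreover have "Ck k (bump r a)" for k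
    using Ck_flat[of k 0 "r\<^sup>2" a] by (simp add: bump_def[abs_def])
  ultimately show ?thesis
    using assms by (simp add: test_function_def)
qed

text \<open>One constant serves all centres, because the kernel is translation invariant.\<close>

lemma dbump_bounded:
  assumes "r > 0"
  obtains C where "\<And>x a. \<bar>dbump r b (a::'a::euclidean_space) x\<bar> \<le> C"
proof -
  have "compact ((dbump r b 0) ` cball (0::'a) r)"
    by (intro compact_continuous_image continuous_on_subset[OF continuous_dbump]) auto
  then obtain C where C: "\<And>x. x \<in> cball (0::'a) r \<Longrightarrow> \<bar>dbump r b 0 x\<bar> \<le> C"
    using compact_imp_bounded bounded_iff by (metis image_eqI real_norm_def)
  have "\<bar>dbump r b 0 x\<bar> \<le> max C 0" for x :: 'a
    using C[of x] dbump_eq_0[OF assms, of x 0 b] by (cases "x \<in> cball 0 r") auto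
  then show thesis
    using that[of "max C 0"] dbump_translate[of r b] by metis
qed

lemma bump_integrable:
  assumes "r > 0"
  shows "integrable lborel (bump r (a::'a::euclidean_space))"
proof (rule Bochner_Integration.integrable_bound[of _ "indicator (ball a r) :: 'a \<Rightarrow> real"])
  show "integrable lborel (indicator (ball a r) :: 'a \<Rightarrow> real)"
    using emeasure_lborel_ball_finite[of a r] by (auto simp: integrable_indicator_iff)
  show "AE x in lborel. norm (bump r a x) \<le> norm (indicator (ball a r) x :: real)"
    using bump_nonneg[of r a] bump_le_1[of r a] iffD2[OF bump_eq_0_iff[OF assms, of a]]
    by (intro AE_I2) (auto simp: indicator_def)
qed auto

text \<open>The kernel is positive on the ball, so a vanishing integral would make the ball a null
  set. The integral is the normalising constant of the mollifier.\<close>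

lemma integral_bump_pos:
  assumes "r > 0"
  shows "0 < (LINT x|lborel. bump r (a::'a::euclidean_space) x)"
proof -
  have "(LINT x|lborel. bump r a x) \<noteq> 0"
  proof
    assume "(LINT x|lborel. bump r a x) = 0"
    then have "AE x in lborel. bump r a x = 0"
      using integral_nonneg_eq_0_iff_AE[OF bump_integrable[OF assms], of a] bump_nonneg[of r a] by simp
    then have "AE x in lborel. x \<notin> ball a r"
      by (simp only: bump_eq_0_iff[OF assms])
    then have "emeasure lborel (ball a r) = 0"
      using AE_iff_measurable[of "ball a r" lborel "\<lambda>x. x \<notin> ball a r"]
      by (simp add: ball_def)
    moreover have "measure lborel (ball a r) > 0" if "measure lebesgue (ball a r) > 0"
      using that by simp
    moreover have "0 < measure lebesgue (ball a r)"
      by (simp add: assms content_ball_pos)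
    ultimately show False by (simp add: measure_def)
  qed
  moreover have "0 \<le> (LINT x|lborel. bump r a x)"
    using bump_nonneg by (intro integral_nonneg_AE) auto
  ultimately show ?thesis by linarith
qed

subsection \<open>Mollification\<close>

lemma integrable_lborel_translate:
  fixes f :: "'a::euclidean_space \<Rightarrow> real"
  assumes "integrable lborel f"
  shows "integrable lborel (\<lambda>x. f (x + a))"
  using assms integrable_distr_eq[of "(+) a" lborel borel f] lborel_distr_plus[of a]
  by (simp add: add.commute)

lemma integral_lborel_translate:
  fixes f :: "'a::euclidean_space \<Rightarrow> real"
  assumes "f \<in> borel_measurable borel"
  shows "(LINT x|lborel. f (x + a)) = (LINT x|lborel. f x)"
  using assms integral_distr[of "(+) a" lborel borel f] lborel_distr_plus[of a]
  by (simp add: add.commute)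

text \<open>A three-term estimate shows that the property passes to \<open>L^1\<close> limits; by
  translation invariance the shifted error of \<open>g\<close> is as large as the unshifted
  one.\<close>

lemma translation_L1_approx:
  fixes f :: "'a::euclidean_space \<Rightarrow> real"
  assumes f: "integrable lborel f"
    and approx: "\<And>e. e > 0 \<Longrightarrow> \<exists>g. integrable lborel g \<and> (LINT x|lborel. \<bar>f x - g x\<bar>) \<le> e \<and>
      (\<lambda>n. LINT x|lborel. \<bar>g (x + h n) - g x\<bar>) \<longlonglongrightarrow> 0"
  shows "(\<lambda>n. LINT x|lborel. \<bar>f (x + h n) - f x\<bar>) \<longlonglongrightarrow> 0"
proof (rule LIMSEQ_I)
  fix e :: real assume "e > 0"
  then obtain g where g: "integrable lborel g" "(LINT x|lborel. \<bar>f x - g x\<bar>) \<le> e/3"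
    and lim: "(\<lambda>n. LINT x|lborel. \<bar>g (x + h n) - g x\<bar>) \<longlonglongrightarrow> 0"
    using approx[of "e/3"] by auto
  from LIMSEQ_D[OF lim, of "e/3"] \<open>e > 0\<close>
  obtain N where N: "\<And>n. n \<ge> N \<Longrightarrow> \<bar>LINT x|lborel. \<bar>g (x + h n) - g x\<bar>\<bar> < e/3"
    by auto
  have "norm ((LINT x|lborel. \<bar>f (x + h n) - f x\<bar>) - 0) < e" if "n \<ge> N" for n
  proof -
    note [measurable] = borel_measurable_integrable[OF f, simplified] borel_measurable_integrable[OF g(1), simplified]
    note T = integrable_lborel_translate[of _ "h n"]
    have i: "integrable lborel (\<lambda>x. \<bar>f x - g x\<bar>)"
      using f g by auto
    have eq: "(LINT x|lborel. \<bar>f (x + h n) - g (x + h n)\<bar>) = (LINT x|lborel. \<bar>f x - g x\<bar>)"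
      by (rule integral_lborel_translate[of "\<lambda>x. \<bar>f x - g x\<bar>"]) measurable
    have "(LINT x|lborel. \<bar>f (x + h n) - f x\<bar>) \<le>
        (LINT x|lborel. \<bar>f (x + h n) - g (x + h n)\<bar> + \<bar>g (x + h n) - g x\<bar> + \<bar>f x - g x\<bar>)"
      by (rule integral_mono) (use T f g in \<open>auto intro!: Bochner_Integration.integrable_add integrable_abs Bochner_Integration.integrable_diff\<close>)
    also have "\<dots> = (LINT x|lborel. \<bar>f (x + h n) - g (x + h n)\<bar>) +
        (LINT x|lborel. \<bar>g (x + h n) - g x\<bar>) + (LINT x|lborel. \<bar>f x - g x\<bar>)"
      using T f g by (subst Bochner_Integration.integral_add, (auto intro!: Bochner_Integration.integrable_add integrable_abs Bochner_Integration.integrable_diff)[2])+ simp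
    also have "\<dots> < e/3 + e/3 + e/3"
      using eq g(2) N[OF that] by linarith
    finally show ?thesis
      by (simp add: integral_nonneg_AE)
  qed
  then show "\<exists>N. \<forall>n\<ge>N. norm ((LINT x|lborel. \<bar>f (x + h n) - f x\<bar>) - 0) < e" by blast
qed

text \<open>A point of an open set stays in it under small shifts, so by dominated convergence the
  measure of the part of \<open>U\<close> that is shifted out of \<open>U\<close> tends to 0. By
  translation invariance the part that is shifted in has the same measure, hence a factor 2.\<close>

lemma translation_L1_open:
  fixes U :: "'a::euclidean_space set"
  assumes "open U" "emeasure lborel U < \<infinity>" and h: "h \<longlonglongrightarrow> 0"
  shows "(\<lambda>n. LINT x|lborel. \<bar>indicator U (x + h n) - indicator U x :: real\<bar>) \<longlonglongrightarrow> 0"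
proof -
  let ?u = "indicator U :: 'a \<Rightarrow> real"
  have [measurable]: "U \<in> sets borel" using assms by simp
  have u: "integrable lborel ?u"
    using assms by (simp add: integrable_indicator_iff)
  have "(\<lambda>n. LINT x|lborel. ?u x * (1 - ?u (x + h n))) \<longlonglongrightarrow> (LINT x|(lborel :: 'a measure). (0::real))"
  proof (rule integral_dominated_convergence[where w = ?u])
    have "(\<lambda>n. ?u x * (1 - ?u (x + h n))) \<longlonglongrightarrow> 0" for x
    proof (cases "x \<in> U")
      case True
      have "(\<lambda>n. x + h n) \<longlonglongrightarrow> x"
        using tendsto_add[OF tendsto_const h, of x] by simp
      then have "\<forall>\<^sub>F n in sequentially. x + h n \<in> U"
        using topological_tendstoD assms(1) True by blast
      then have "\<forall>\<^sub>F n in sequentially. 0 = ?u x * (1 - ?u (x + h n))"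
        by eventually_elim simp
      then show ?thesis
        by (rule Lim_transform_eventually[OF tendsto_const])
    qed simp
    then show "AE x in lborel. (\<lambda>n. ?u x * (1 - ?u (x + h n))) \<longlonglongrightarrow> 0" by simp
  qed (use u in \<open>auto simp: indicator_def\<close>)
  then have lim: "(\<lambda>n. 2 * (LINT x|lborel. ?u x * (1 - ?u (x + h n)))) \<longlonglongrightarrow> 0"
    using tendsto_mult_right_zero by force
  have "(LINT x|lborel. \<bar>?u (x + h n) - ?u x\<bar>) = 2 * (LINT x|lborel. ?u x * (1 - ?u (x + h n)))" for n
  proof -
    have i: "integrable lborel (\<lambda>x. ?u x * (1 - ?u (x + h n)))"
      by (rule Bochner_Integration.integrable_bound[OF u]) (auto simp: indicator_def)
    note t = integrable_lborel_translate[OF u, of "h n"]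
    \<comment> \<open>For indicator values \<open>a\<close> and \<open>b\<close>, \<bar>b - a\<bar>
      = 2 a (1 - b) + (b - a), and the last term integrates to 0.\<close>
    have "(LINT x|lborel. \<bar>?u (x + h n) - ?u x\<bar>) =
      (LINT x|lborel. 2 * (?u x * (1 - ?u (x + h n))) + (?u (x + h n) - ?u x))"
      by (rule Bochner_Integration.integral_cong) (auto simp: indicator_def)
    also have "\<dots> = 2 * (LINT x|lborel. ?u x * (1 - ?u (x + h n))) + ((LINT x|lborel. ?u (x + h n)) - (LINT x|lborel. ?u x))"
      using i t u by simp
    also have "(LINT x|lborel. ?u (x + h n)) = (LINT x|lborel. ?u x)"
      by (rule integral_lborel_translate) measurable
    finally show ?thesis by simp
  qed
  with lim show ?thesis by simp
qed

text \<open>Outer regularity approximates the set in \<open>L^1\<close> by an open superset.\<close>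

lemma translation_L1_indicator:
  fixes A :: "'a::euclidean_space set"
  assumes A: "A \<in> sets lborel" "emeasure lborel A < \<infinity>" and h: "h \<longlonglongrightarrow> 0"
  shows "(\<lambda>n. LINT x|lborel. \<bar>indicator A (x + h n) - indicator A x :: real\<bar>) \<longlonglongrightarrow> 0"
proof (rule translation_L1_approx)
  let ?a = "indicator A :: 'a \<Rightarrow> real"
  show a: "integrable lborel ?a"
    using A by (simp add: integrable_indicator_iff)
  fix e :: real assume "e > 0"
  then obtain U where U: "open U" "A \<subseteq> U" "emeasure lborel (U - A) < ennreal e"
    using outer_regular_lborel[of A e] A by auto
  have [measurable]: "U \<in> sets borel" "A \<in> sets borel" using U A by auto
  have fin: "emeasure lborel (U - A) < \<infinity>"
    using U(3) less_top_ennreal by (metis ennreal_less_top infinity_ennreal_def order_less_trans)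
  have "emeasure lborel U = emeasure lborel A + emeasure lborel (U - A)"
    using U(2) by (subst plus_emeasure) (auto simp: Un_absorb1)
  then have finU: "emeasure lborel U < \<infinity>"
    using fin A by (simp add: ennreal_add_eq_top less_top)
  have "(LINT x|lborel. \<bar>?a x - indicator U x\<bar>) = (LINT x|lborel. indicator (U - A) x)"
    using U(2) by (intro Bochner_Integration.integral_cong) (auto simp: indicator_def)
  also have "\<dots> = measure lborel (U - A)" by simp
  also have "\<dots> \<le> e"
    using U(3) \<open>e > 0\<close> by (simp add: measure_def enn2real_leI)
  finally have "(LINT x|lborel. \<bar>?a x - indicator U x\<bar>) \<le> e" .
  then show "\<exists>g. integrable lborel g \<and> (LINT x|lborel. \<bar>?a x - g x\<bar>) \<le> e \<and>
      (\<lambda>n. LINT x|lborel. \<bar>g (x + h n) - g x\<bar>) \<longlonglongrightarrow> 0"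
    using translation_L1_open[OF U(1) finU h] finU
    by (intro exI[of _ "indicator U"]) (auto simp: integrable_indicator_iff)
qed

text \<open>Induction over integrable functions: multiples of indicators, sums, and dominated
  pointwise limits.\<close>

lemma translation_L1_sequentially:
  fixes f :: "'a::euclidean_space \<Rightarrow> real"
  assumes "integrable lborel f" and h: "h \<longlonglongrightarrow> 0"
  shows "(\<lambda>n. LINT x|lborel. \<bar>f (x + h n) - f x\<bar>) \<longlonglongrightarrow> 0"
  using assms(1)
proof induct
  case (base A c)
  have "(LINT x|lborel. \<bar>indicator A (x + h n) *\<^sub>R c - indicator A x *\<^sub>R c\<bar>) =
      (LINT x|lborel. \<bar>indicator A (x + h n) - indicator A x :: real\<bar>) * \<bar>c\<bar>" for n
    unfolding integral_mult_left_zero[symmetric]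
    by (rule Bochner_Integration.integral_cong) (auto simp: indicator_def)
  then show ?case
    using tendsto_mult_left_zero[OF translation_L1_indicator[OF base h], of "\<bar>c\<bar>"] by simp
next
  case (add f g)
  note [measurable] = borel_measurable_integrable[OF add(1), simplified] borel_measurable_integrable[OF add(3), simplified]
  note T = integrable_lborel_translate
  show ?case
  proof (rule tendsto_sandwich[OF _ _ tendsto_const])
    show "(\<lambda>n. (LINT x|lborel. \<bar>f (x + h n) - f x\<bar>) + (LINT x|lborel. \<bar>g (x + h n) - g x\<bar>)) \<longlonglongrightarrow> 0"
      using tendsto_add[OF add(2,4)] by simp
    have "(LINT x|lborel. \<bar>f (x + h n) + g (x + h n) - (f x + g x)\<bar>) \<le>
        (LINT x|lborel. \<bar>f (x + h n) - f x\<bar> + \<bar>g (x + h n) - g x\<bar>)" for n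
      by (rule integral_mono)
        (use T[OF add(1)] T[OF add(3)] add(1,3) in \<open>auto intro!: Bochner_Integration.integrable_add integrable_abs Bochner_Integration.integrable_diff\<close>)
    also have "\<dots> n = (LINT x|lborel. \<bar>f (x + h n) - f x\<bar>) + (LINT x|lborel. \<bar>g (x + h n) - g x\<bar>)" for n
      using T[OF add(1), of "h n"] T[OF add(3), of "h n"] add(1,3) by (subst Bochner_Integration.integral_add) auto
    finally show "\<forall>\<^sub>F n in sequentially. (LINT x|lborel. \<bar>f (x + h n) + g (x + h n) - (f x + g x)\<bar>) \<le>
       (LINT x|lborel. \<bar>f (x + h n) - f x\<bar>) + (LINT x|lborel. \<bar>g (x + h n) - g x\<bar>)"
      by simp
  qed (auto intro!: integral_nonneg_AE)
next
  case (lim f s)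
  show ?case
  proof (rule translation_L1_approx[OF lim(5)])
    fix e :: real assume "e > 0"
    note [measurable] = borel_measurable_integrable[OF lim(5)] borel_measurable_integrable[OF lim(1)]
    have "(\<lambda>i. LINT x|lborel. \<bar>f x - s i x\<bar>) \<longlonglongrightarrow> (LINT x|(lborel :: 'a measure). (0::real))"
    proof (rule integral_dominated_convergence[where w = "\<lambda>x. 3 * \<bar>f x\<bar>"])
      have "(\<lambda>i. \<bar>f x - s i x\<bar>) \<longlonglongrightarrow> \<bar>f x - f x\<bar>" for x
        by (intro tendsto_intros lim(3)) simp
      then show "AE x in lborel. (\<lambda>i. \<bar>f x - s i x\<bar>) \<longlonglongrightarrow> 0" by simp
      \<comment> \<open>The induction rule gives \<bar>s i x\<bar> \<le> 2 \<bar>f x\<bar>, hence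
        the factor 3.\<close>
      have "\<bar>f x - s i x\<bar> \<le> 3 * \<bar>f x\<bar>" for i x
        using lim(4)[of x i] by simp
      then show "AE x in lborel. norm \<bar>f x - s i x\<bar> \<le> 3 * \<bar>f x\<bar>" for i by simp
    qed (use lim(5) in auto)
    then obtain i where "\<bar>LINT x|lborel. \<bar>f x - s i x\<bar>\<bar> < e"
      using LIMSEQ_D[of "\<lambda>i. LINT x|lborel. \<bar>f x - s i x\<bar>" 0 e] \<open>e > 0\<close> by auto
    then show "\<exists>g. integrable lborel g \<and> (LINT x|lborel. \<bar>f x - g x\<bar>) \<le> e \<and>
      (\<lambda>n. LINT x|lborel. \<bar>g (x + h n) - g x\<bar>) \<longlonglongrightarrow> 0"
      using lim(1,2) by (intro exI[of _ "s i"]) auto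
  qed
qed

lemma translation_L1:
  fixes f :: "'a::euclidean_space \<Rightarrow> real"
  assumes "integrable lborel f" "e > 0"
  obtains d where "d > 0" "\<And>z. norm z < d \<Longrightarrow> (LINT x|lborel. \<bar>f (x + z) - f x\<bar>) \<le> e"
proof (rule ccontr)
  assume *: "\<not> thesis"
  have "\<exists>z. norm z < inverse (Suc n) \<and> (LINT x|lborel. \<bar>f (x + z) - f x\<bar>) > e" for n
    using * that[of "inverse (real (Suc n))"] by (force simp: not_le)
  then obtain z where z: "\<And>n. norm (z n) < inverse (Suc n)"
      "\<And>n. (LINT x|lborel. \<bar>f (x + z n) - f x\<bar>) > e" by metis
  have "z \<longlonglongrightarrow> 0"
    by (rule tendsto_norm_zero_cancel,
      rule tendsto_sandwich[OF _ _ tendsto_const LIMSEQ_inverse_real_of_nat])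
      (use z(1) in \<open>auto intro!: always_eventually less_imp_le\<close>)
  from translation_L1_sequentially[OF assms(1) this] show False
    using LIMSEQ_le_const[of _ 0 e] z(2) assms(2) by (meson less_imp_le not_le)
qed

section \<open>Mollification by normalised bumps\<close>

definition moll :: "real \<Rightarrow> ('a::euclidean_space \<Rightarrow> real) \<Rightarrow> 'a \<Rightarrow> real" where
  "moll r v x = (LINT y|lborel. v y * bump r x y) / (LINT y|lborel. bump r 0 (y::'a))"

lemma integrable_mult_bump:
  assumes "integrable lborel (v :: 'a::euclidean_space \<Rightarrow> real)"
  shows "integrable lborel (\<lambda>y. v y * bump r x y)"
  by (rule Bochner_Integration.integrable_bound[OF assms])
    (use assms bump_nonneg[of r x] bump_le_1[of r x] in \<open>auto simp: abs_mult intro!: mult_left_le\<close>)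

lemma measurable_moll [measurable]:
  assumes [measurable]: "v \<in> borel_measurable borel"
  shows "moll r v \<in> borel_measurable (borel :: 'a::euclidean_space measure)"
  unfolding moll_def[abs_def] bump_def[abs_def] by measurable

text \<open>\<open>moll r v x - v x\<close> is the average of \<open>v (x + z) - v x\<close> against
  the normalised kernel, and exchanging the integrals reduces the claim to shifts shorter than
  \<open>r\<close>. The integral is taken in the nonnegative sense because integrability of
  \<open>moll r v\<close> is itself deduced from this bound.\<close>

lemma nn_integral_moll_diff:
  fixes v :: "'a::euclidean_space \<Rightarrow> real"
  assumes v: "integrable lborel v" and r: "r > 0" and e: "e \<ge> 0"
    and small: "\<And>z. norm z < r \<Longrightarrow> (LINT x|lborel. \<bar>v (x + z) - v x\<bar>) \<le> e"
  shows "(\<integral>\<^sup>+x. ennreal \<bar>moll r v x - v x\<bar> \<partial>lborel) \<le> ennreal e"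
proof -
  define c where "c = (LINT y|lborel. bump r 0 (y::'a))"
  have c: "c > 0" unfolding c_def by (rule integral_bump_pos[OF r])
  have [measurable]: "v \<in> borel_measurable borel"
    using borel_measurable_integrable[OF v] by simp
  let ?k = "\<lambda>x z. \<bar>v (x + z) - v x\<bar> * (bump r 0 z / c)"
  have [measurable]: "(\<lambda>(x, z). ?k x z) \<in> borel_measurable (borel \<Otimes>\<^sub>M borel)"
    unfolding bump_def by measurable
  have pt: "ennreal \<bar>moll r v x - v x\<bar> \<le> (\<integral>\<^sup>+z. ennreal (?k x z) \<partial>lborel)" for x
  proof -
    have "(LINT y|lborel. v y * bump r x y) = (LINT z|lborel. v (z + x) * bump r x (z + x))"
      by (rule integral_lborel_translate[symmetric]) measurable
    also have "\<dots> = (LINT z|lborel. v (x + z) * bump r 0 z)"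
      using bump_translate[of r x] by (simp add: add.commute)
    finally have *: "moll r v x = (LINT z|lborel. v (x + z) * bump r 0 z) / c"
      by (simp add: moll_def c_def)
    have i1: "integrable lborel (\<lambda>z. v (x + z) * bump r 0 z)"
      using integrable_mult_bump[OF integrable_lborel_translate[OF v, of x]] by (simp add: add.commute)
    have i2: "integrable lborel (\<lambda>z. v x * bump r 0 z)"
      by (rule integrable_mult_right[OF bump_integrable[OF r]])
    have "moll r v x - v x = (LINT z|lborel. v (x + z) * bump r 0 z - v x * bump r 0 z) / c"
      using c unfolding * Bochner_Integration.integral_diff[OF i1 i2]
      by (simp add: c_def[symmetric] diff_divide_distrib)
    also have "\<dots> = (LINT z|lborel. (v (x + z) - v x) * (bump r 0 z / c))"
      unfolding integral_divide_zero[symmetric]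
      by (rule Bochner_Integration.integral_cong[OF refl]) (simp add: left_diff_distrib diff_divide_distrib)
    finally have eq: "moll r v x - v x = (LINT z|lborel. (v (x + z) - v x) * (bump r 0 z / c))" .
    have "integrable lborel (\<lambda>z. (v (x + z) * bump r 0 z - v x * bump r 0 z) / c)"
      by (rule integrable_divide_zero) (rule Bochner_Integration.integrable_diff[OF i1 i2])
    then have "integrable lborel (\<lambda>z. (v (x + z) - v x) * (bump r 0 z / c))"
      by (rule back_subst[of "integrable lborel"]) (simp add: left_diff_distrib diff_divide_distrib fun_eq_iff)
    from integral_norm_bound_ennreal[OF this] show ?thesis
      using c by (simp add: eq abs_mult abs_of_nonneg[OF bump_nonneg])
  qed
  have "(\<integral>\<^sup>+x. ennreal \<bar>moll r v x - v x\<bar> \<partial>lborel) \<le> (\<integral>\<^sup>+x. (\<integral>\<^sup>+z. ennreal (?k x z) \<partial>lborel) \<partial>lborel)"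
    by (rule nn_integral_mono) (rule pt)
  also have "\<dots> = (\<integral>\<^sup>+z. (\<integral>\<^sup>+x. ennreal (?k x z) \<partial>lborel) \<partial>lborel)"
    by (rule lborel_pair.Fubini'[symmetric]) measurable
  also have "\<dots> \<le> (\<integral>\<^sup>+z. ennreal (e / c * bump r 0 z) \<partial>(lborel :: 'a measure))"
  proof (rule nn_integral_mono)
    fix z :: 'a
    have i: "integrable lborel (\<lambda>x. \<bar>v (x + z) - v x\<bar>)"
      using v integrable_lborel_translate[OF v, of z] by auto
    show "(\<integral>\<^sup>+x. ennreal (?k x z) \<partial>lborel) \<le> ennreal (e / c * bump r 0 z)"
    proof (cases "norm z < r")
      case True
      have "(\<integral>\<^sup>+x. ennreal (?k x z) \<partial>lborel) = ennreal (LINT x|lborel. ?k x z)"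
        using i c by (intro nn_integral_eq_integral AE_I2) (auto intro!: mult_nonneg_nonneg divide_nonneg_pos bump_nonneg)
      also have "\<dots> \<le> ennreal (e * (bump r 0 z / c))"
        using small[OF True] c bump_nonneg[of r 0 z]
        unfolding integral_mult_left_zero by (intro ennreal_leI mult_right_mono) auto
      finally show ?thesis by simp
    next
      case False
      then have "bump r 0 z = 0"
        using bump_eq_0_iff[OF r, of 0 z] by simp
      then show ?thesis by simp
    qed
  qed
  also have "\<dots> = ennreal (LINT z|lborel. e / c * bump r 0 (z::'a))"
    using bump_integrable[OF r, of "0::'a"] e c
    by (intro nn_integral_eq_integral AE_I2) (auto intro!: mult_nonneg_nonneg divide_nonneg_pos bump_nonneg)
  also have "\<dots> = ennreal e"
    using c by (simp add: c_def[symmetric])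
  finally show ?thesis .
qed

lemma moll_L1:
  fixes v :: "'a::euclidean_space \<Rightarrow> real"
  assumes v: "integrable lborel v" and e: "e > 0"
  obtains d where "d > 0" "\<And>r. 0 < r \<Longrightarrow> r \<le> d \<Longrightarrow> integrable lborel (moll r v)"
    "\<And>r. 0 < r \<Longrightarrow> r \<le> d \<Longrightarrow> (LINT x|lborel. \<bar>moll r v x - v x\<bar>) \<le> e"
proof -
  obtain d where d: "d > 0" "\<And>z. norm z < d \<Longrightarrow> (LINT x|lborel. \<bar>v (x + z) - v x\<bar>) \<le> e"
    using translation_L1[OF v e] by blast
  have [measurable]: "v \<in> borel_measurable borel"
    using borel_measurable_integrable[OF v] by simp
  show thesis
  proof (rule that[OF d(1)])
    fix r assume r: "0 < r" "r \<le> d"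
    have *: "(\<integral>\<^sup>+x. ennreal \<bar>moll r v x - v x\<bar> \<partial>lborel) \<le> ennreal e"
      by (rule nn_integral_moll_diff) (use v r d e in auto)
    then have i: "integrable lborel (\<lambda>x. moll r v x - v x)"
      by (intro integrableI_bounded) (auto simp: less_top[symmetric] top_unique)
    from Bochner_Integration.integrable_add[OF this v] show "integrable lborel (moll r v)" by simp
    have "ennreal (LINT x|lborel. \<bar>moll r v x - v x\<bar>) = (\<integral>\<^sup>+x. ennreal \<bar>moll r v x - v x\<bar> \<partial>lborel)"
      using i by (intro nn_integral_eq_integral[symmetric]) auto
    with * e show "(LINT x|lborel. \<bar>moll r v x - v x\<bar>) \<le> e"
      by (metis ennreal_le_iff less_imp_le)
  qed
qed

subsection \<open>Weak gradients\<close>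

lemma has_derivative_imp_line:
  assumes "(u has_derivative D) (at (x + s *\<^sub>R b))"
  shows "((\<lambda>t. u (x + t *\<^sub>R b) :: real) has_real_derivative D b) (at s)"
proof -
  have l: "((\<lambda>t. x + t *\<^sub>R b) has_derivative (\<lambda>t. t *\<^sub>R b)) (at s)"
    by (auto intro!: derivative_eq_intros)
  have "((\<lambda>t. u (x + t *\<^sub>R b)) has_derivative (\<lambda>t. D (t *\<^sub>R b))) (at s)"
    by (rule has_derivative_compose[OF l assms])
  moreover have "D (t *\<^sub>R b) = D b * t" for t
    using has_derivative_linear[OF assms] by (simp add: linear_scale)
  ultimately show ?thesis by (simp add: has_field_derivative_def)
qed

lemma DERIV_line_shift:
  fixes w :: "'a::real_vector \<Rightarrow> real"
  assumes "((\<lambda>t. w ((x + s *\<^sub>R b) + t *\<^sub>R b) :: real) has_real_derivative D) (at 0)"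
  shows "((\<lambda>t. w (x + t *\<^sub>R b)) has_real_derivative D) (at s)"
proof -
  have "((\<lambda>t. w (x + (s + t) *\<^sub>R b)) has_real_derivative D) (at 0)"
    using assms unfolding scaleR_add_left add.assoc .
  then show ?thesis
    using DERIV_shift[of "\<lambda>t. w (x + t *\<^sub>R b)" D 0 s] by (simp add: add.commute)
qed

lemma line_lipschitz:
  fixes w :: "'a::euclidean_space \<Rightarrow> real"
  assumes "\<And>x. ((\<lambda>t. w (x + t *\<^sub>R b)) has_real_derivative w' x) (at 0)" and "\<And>x. \<bar>w' x\<bar> \<le> C"
  shows "\<bar>w (x + h *\<^sub>R b) - w x\<bar> \<le> C * \<bar>h\<bar>"
proof -
  have d: "((\<lambda>t. w (x + t *\<^sub>R b)) has_real_derivative w' (x + t *\<^sub>R b)) (at t within UNIV)" for t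
    using DERIV_line_shift[OF assms(1)] by simp
  have "norm (w (x + h *\<^sub>R b) - w (x + 0 *\<^sub>R b)) \<le> C * norm (h - 0)"
    by (rule field_differentiable_bound[OF convex_UNIV d]) (use assms(2) in auto)
  then show ?thesis by simp
qed

text \<open>The difference quotients in direction \<open>b\<close> have integral 0 by translation
  invariance. The mean value bound \<open>C\<close> and the bounded support let the limit pass under
  the integral.\<close>

lemma integral_deriv_compact_support:
  fixes w w' :: "'a::euclidean_space \<Rightarrow> real"
  assumes [measurable]: "w \<in> borel_measurable borel" "w' \<in> borel_measurable borel"
    and d: "\<And>x. ((\<lambda>t. w (x + t *\<^sub>R b)) has_real_derivative w' x) (at 0)"
    and b: "norm b \<le> 1"
    and bd: "\<And>x. \<bar>w x\<bar> \<le> B" "\<And>x. \<bar>w' x\<bar> \<le> C"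
    and supp: "\<And>x. w x \<noteq> 0 \<Longrightarrow> norm x \<le> R"
  shows "(LINT x|lborel. w' x) = 0"
proof -
  let ?h = "\<lambda>n. inverse (real (Suc n))"
  let ?D = "\<lambda>n x. (w (x + ?h n *\<^sub>R b) - w x) / ?h n"
  have C: "0 \<le> C" using bd(2)[of 0] by linarith
  have fin: "emeasure lborel (cball (0::'a) \<rho>) < \<infinity>" for \<rho>
    using emeasure_lborel_cball_finite[of "0::'a" \<rho>] by simp
  have wi: "integrable lborel w"
  proof (rule Bochner_Integration.integrable_bound[of _ "\<lambda>x. B * indicator (cball 0 R) x"])
    show "integrable lborel (\<lambda>x. B * indicator (cball (0::'a) R) x)"
      using fin[of R] by (simp add: integrable_indicator_iff)
    show "AE x in lborel. norm (w x) \<le> norm (B * indicator (cball 0 R) x)"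
    proof (intro AE_I2)
      fix x show "norm (w x) \<le> norm (B * indicator (cball 0 R) x)"
        using bd(1)[of x] supp[of x] by (cases "w x = 0") (auto simp: indicator_def)
    qed
  qed measurable
  \<comment> \<open>The dominating ball has radius \<open>R + 1\<close> because the shift
    \<open>?h n *\<^sub>R b\<close> has norm at most 1.\<close>
  have "(\<lambda>n. LINT x|lborel. ?D n x) \<longlonglongrightarrow> (LINT x|lborel. w' x)"
  proof (rule integral_dominated_convergence[where w = "\<lambda>x. C * indicator (cball 0 (R + 1)) x"])
    show "integrable lborel (\<lambda>x. C * indicator (cball (0::'a) (R + 1)) x)"
      using fin[of "R + 1"] by (simp add: integrable_indicator_iff)
    have "(\<lambda>n. ?D n x) \<longlonglongrightarrow> w' x" for x
    proof -
      have "filterlim ?h (at 0) sequentially"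
        using LIMSEQ_inverse_real_of_nat by (auto simp: filterlim_at)
      moreover have "((\<lambda>h. (w (x + h *\<^sub>R b) - w x) / h) \<longlongrightarrow> w' x) (at 0)"
        using d[of x] by (simp add: DERIV_def)
      ultimately show ?thesis by (rule filterlim_compose[rotated])
    qed
    then show "AE x in lborel. (\<lambda>n. ?D n x) \<longlonglongrightarrow> w' x" by simp
    fix n
    have "\<bar>?D n x\<bar> \<le> C * indicator (cball 0 (R + 1)) x" for x
    proof (cases "x \<in> cball 0 (R + 1)")
      case True
      have "?h n > 0" by simp
      then have "\<bar>?D n x\<bar> \<le> C"
        using line_lipschitz[OF d bd(2), of x "?h n"] by (simp only: abs_divide abs_of_pos pos_divide_le_eq)
      then show ?thesis using True by simp
    next
      case False
      have "norm (?h n *\<^sub>R b) \<le> 1"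
        using b mult_mono[of "?h n" 1 "norm b" 1] by (simp add: field_simps)
      moreover have "norm x \<le> norm (x + ?h n *\<^sub>R b) + norm (?h n *\<^sub>R b)"
        using norm_triangle_ineq4[of "x + ?h n *\<^sub>R b" "?h n *\<^sub>R b"] by simp
      ultimately have "w (x + ?h n *\<^sub>R b) = 0" "w x = 0"
        using supp[of x] supp[of "x + ?h n *\<^sub>R b"] False by fastforce+
      then show ?thesis using C by (simp add: indicator_def)
    qed
    then show "AE x in lborel. norm (?D n x) \<le> C * indicator (cball 0 (R + 1)) x" by simp
  qed measurable
  moreover have "(LINT x|lborel. ?D n x) = 0" for n
    using wi integrable_lborel_translate[OF wi, of "?h n *\<^sub>R b"] integral_lborel_translate[of w "?h n *\<^sub>R b"]
    by simp
  ultimately show ?thesis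
    using LIMSEQ_unique[OF tendsto_const] by force
qed

text \<open>Differentiation under the integral sign; the difference quotients of the kernel obey the
  uniform bound on \<open>dbump\<close>. The minus sign comes from \<open>dbump_commute\<close>,
  since here the kernel is differentiated in its centre.\<close>

lemma moll_line_derivative:
  fixes U :: "'a::euclidean_space \<Rightarrow> real"
  assumes U: "integrable lborel U" and r: "r > 0"
  shows "((\<lambda>t. moll r U (x + t *\<^sub>R b)) has_real_derivative
    - (LINT y|lborel. U y * dbump r b x y) / (LINT y|lborel. bump r 0 (y::'a))) (at 0)"
proof -
  obtain C where C: "\<And>x a. \<bar>dbump r b (a::'a) x\<bar> \<le> C" using dbump_bounded[OF r] by blast
  have [measurable]: "U \<in> borel_measurable borel"
    using borel_measurable_integrable[OF U] by simp
  have line: "((\<lambda>t. bump r y (z + t *\<^sub>R b)) has_real_derivative dbump r b y z) (at 0)" for y z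
    using has_derivative_imp_line[of "bump r y" "\<lambda>b. dbump r b y z" z 0 b] bump_has_derivative[of r y z] by simp
  have lim: "(\<lambda>n. LINT y|lborel. U y * ((bump r (x + h n *\<^sub>R b) y - bump r x y) / h n)) \<longlonglongrightarrow>
      (LINT y|lborel. U y * (- dbump r b x y))"
    if h: "\<And>n. h n \<noteq> 0" "h \<longlonglongrightarrow> 0" for h :: "nat \<Rightarrow> real"
  proof (rule integral_dominated_convergence[where w = "\<lambda>y. \<bar>U y\<bar> * C"])
    show "integrable lborel (\<lambda>y. \<bar>U y\<bar> * C)" using U by simp
    have "(\<lambda>n. U y * ((bump r (x + h n *\<^sub>R b) y - bump r x y) / h n)) \<longlonglongrightarrow> U y * (- dbump r b x y)" for y
    proof (rule tendsto_mult_left)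
      have "((\<lambda>t. (bump r y (x + t *\<^sub>R b) - bump r y x) / t) \<longlongrightarrow> dbump r b y x) (at 0)"
        using line[of y x] by (simp add: DERIV_def)
      moreover have "filterlim h (at 0) sequentially"
        using h by (auto simp: filterlim_at)
      ultimately have "(\<lambda>n. (bump r y (x + h n *\<^sub>R b) - bump r y x) / h n) \<longlonglongrightarrow> dbump r b y x"
        by (rule filterlim_compose)
      then show "(\<lambda>n. (bump r (x + h n *\<^sub>R b) y - bump r x y) / h n) \<longlonglongrightarrow> - dbump r b x y"
        using dbump_commute[of r b y x] bump_commute[of r y] by simp
    qed
    then show "AE y in lborel. (\<lambda>n. U y * ((bump r (x + h n *\<^sub>R b) y - bump r x y) / h n)) \<longlonglongrightarrow> U y * (- dbump r b x y)"
      by simp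
    have "\<bar>(bump r (x + h n *\<^sub>R b) y - bump r x y) / h n\<bar> \<le> C" for n y
      using line_lipschitz[OF line C, of y x "h n"] h(1)[of n] bump_commute[of r y]
      by (simp add: field_simps)
    then show "AE y in lborel. norm (U y * ((bump r (x + h n *\<^sub>R b) y - bump r x y) / h n)) \<le> \<bar>U y\<bar> * C" for n
      unfolding real_norm_def abs_mult by (intro AE_I2 mult_left_mono) auto
  qed measurable
  define c where "c = (LINT y|lborel. bump r 0 (y::'a))"
  show ?thesis
    unfolding DERIV_def c_def[symmetric]
  proof (subst tendsto_at_iff_sequentially, intro allI impI)
    fix h :: "nat \<Rightarrow> real" assume h: "\<forall>i. h i \<in> UNIV - {0}" "h \<longlonglongrightarrow> 0"
    have "(\<lambda>n. (LINT y|lborel. U y * ((bump r (x + h n *\<^sub>R b) y - bump r x y) / h n)) / c) \<longlonglongrightarrow>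
      (LINT y|lborel. U y * (- dbump r b x y)) / c"
      using h integral_bump_pos[OF r, of "0::'a"]
      by (intro tendsto_divide[OF lim tendsto_const]) (auto simp: c_def)
    moreover have "(LINT y|lborel. U y * ((bump r (x + h n *\<^sub>R b) y - bump r x y) / h n)) / c =
       (moll r U (x + h n *\<^sub>R b) - moll r U x) / h n" for n
    proof -
      have "(LINT y|lborel. U y * ((bump r (x + h n *\<^sub>R b) y - bump r x y) / h n)) =
        (LINT y|lborel. (U y * bump r (x + h n *\<^sub>R b) y - U y * bump r x y) / h n)"
        by (simp add: right_diff_distrib)
      also have "\<dots> = ((LINT y|lborel. U y * bump r (x + h n *\<^sub>R b) y) - (LINT y|lborel. U y * bump r x y)) / h n"
        using integrable_mult_bump[OF U] by simp
      finally show ?thesis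
        by (simp add: moll_def c_def[symmetric] diff_divide_distrib mult.commute)
    qed
    ultimately show "((\<lambda>k. (moll r U (x + (0 + k) *\<^sub>R b) - moll r U (x + 0 *\<^sub>R b)) / k) \<circ> h) \<longlonglongrightarrow>
       - (LINT y|lborel. U y * dbump r b x y) / c"
      by (simp add: o_def)
  qed
qed

lemma abs_moll_le:
  fixes U :: "'a::euclidean_space \<Rightarrow> real"
  assumes U: "integrable lborel U" and r: "r > 0"
  shows "\<bar>moll r U x\<bar> \<le> (LINT y|lborel. \<bar>U y\<bar>) / (LINT y|lborel. bump r 0 (y::'a))"
proof -
  have "\<bar>LINT y|lborel. U y * bump r x y\<bar> \<le> (LINT y|lborel. \<bar>U y * bump r x y\<bar>)"
    by (rule integral_abs_bound)
  also have "\<dots> \<le> (LINT y|lborel. \<bar>U y\<bar>)"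
    using U integrable_abs[OF integrable_mult_bump[OF U, of r x]]
    by (intro integral_mono) (auto simp: abs_mult abs_of_nonneg[OF bump_nonneg] intro!: mult_left_le bump_le_1)
  finally show ?thesis
    using integral_bump_pos[OF r, of "0::'a"] by (simp add: moll_def divide_right_mono)
qed

text \<open>\<open>u\<close> lives on \<open>\<Omega>\<close> with the completed measure, whereas
  translation and Fubini arguments are carried out for Borel functions on the whole space. Since
  \<open>\<psi>\<close> vanishes outside \<open>K\<close>, the representative \<open>U\<close> has
  to match \<open>u\<close> on \<open>K\<close> only.\<close>

lemma integrable_restrict_representative:
  fixes u U \<psi> :: "'a::euclidean_space \<Rightarrow> real"
  assumes K: "K \<subseteq> \<Omega>" "K \<in> sets lebesgue" "\<Omega> \<in> sets lebesgue"
    and u: "u \<in> borel_measurable (lebesgue_on K)"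
    and U [measurable]: "U \<in> borel_measurable borel" and \<psi> [measurable]: "\<psi> \<in> borel_measurable borel"
    and supp: "\<And>x. x \<notin> K \<Longrightarrow> \<psi> x = 0"
    and ae: "AE x in lebesgue. x \<in> K \<longrightarrow> U x = u x"
  shows "integrable (lebesgue_on \<Omega>) (\<lambda>x. u x * \<psi> x) \<longleftrightarrow> integrable lborel (\<lambda>x. U x * \<psi> x)" (is ?A)
    and "(LINT x|lebesgue_on \<Omega>. u x * \<psi> x) = (LINT x|lborel. U x * \<psi> x)" (is ?B)
proof -
  have m1: "(\<lambda>x. if x \<in> K then u x else 0) \<in> borel_measurable lebesgue"
    using u K(2) by (rule borel_measurable_if_I)
  have m2: "\<psi> \<in> borel_measurable lebesgue" "U \<in> borel_measurable lebesgue"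
    using U \<psi> by (simp_all add: measurable_completion)
  have eq: "(\<lambda>x. if x \<in> \<Omega> then u x * \<psi> x else 0) = (\<lambda>x. (if x \<in> K then u x else 0) * \<psi> x)"
    using supp K(1) by (auto simp: fun_eq_iff)
  have ae': "AE x in lebesgue. (if x \<in> K then u x else 0) * \<psi> x = U x * \<psi> x"
    using ae by eventually_elim (use supp in auto)
  have "integrable (lebesgue_on \<Omega>) (\<lambda>x. u x * \<psi> x) \<longleftrightarrow> integrable lebesgue (\<lambda>x. (if x \<in> K then u x else 0) * \<psi> x)"
    using Lebesgue_Measure.integrable_restrict_UNIV[OF K(3), of "\<lambda>x. u x * \<psi> x"] by (simp add: eq)
  also have "\<dots> \<longleftrightarrow> integrable lebesgue (\<lambda>x. U x * \<psi> x)"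
    using m1 m2 ae' by (intro integrable_cong_AE) auto
  also have "\<dots> \<longleftrightarrow> integrable lborel (\<lambda>x. U x * \<psi> x)"
    by (rule integrable_completion) measurable
  finally show ?A .
  have "(LINT x|lebesgue_on \<Omega>. u x * \<psi> x) = (LINT x|lebesgue. (if x \<in> K then u x else 0) * \<psi> x)"
    using Lebesgue_Measure.integral_restrict_UNIV[OF K(3), of "\<lambda>x. u x * \<psi> x"] by (simp add: eq)
  also have "\<dots> = (LINT x|lebesgue. U x * \<psi> x)"
    using m1 m2 ae' by (intro integral_cong_AE) auto
  also have "\<dots> = (LINT x|lborel. U x * \<psi> x)"
    by (rule integral_completion) measurable
  finally show ?B .
qed

text \<open>Extending \<open>u\<close> by 0 from \<open>K\<close> gives an integrable function on
  the whole space, which has a Borel version.\<close>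

lemma locally_integrable_representative:
  fixes u :: "'a::euclidean_space \<Rightarrow> real"
  assumes "locally_integrable_on u \<Omega>" "compact K" "K \<subseteq> \<Omega>"
  obtains U where "integrable lborel U" "AE x in lebesgue. x \<in> K \<longrightarrow> U x = u x"
proof -
  have K: "K \<in> sets lebesgue" using assms(2) by (simp add: borel_compact)
  have i: "integrable lebesgue (\<lambda>x. if x \<in> K then u x else 0)"
    using assms Lebesgue_Measure.integrable_restrict_UNIV[OF K, of u]
    by (auto simp: locally_integrable_on_def)
  then obtain U where U: "U \<in> borel_measurable lborel"
    "AE x in lborel. (if x \<in> K then u x else 0) = U x"
    using completion_ex_borel_measurable_real[OF borel_measurable_integrable[OF i]] by auto
  from AE_completion[OF U(2)] have ae: "AE x in lebesgue. (if x \<in> K then u x else 0) = U x" .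
  have "integrable lebesgue U"
    by (rule integrable_cong_AE_imp[OF i measurable_completion[OF U(1)] ae])
  then have "integrable lborel U"
    using integrable_completion[OF U(1)] by simp
  moreover have "AE x in lebesgue. x \<in> K \<longrightarrow> U x = u x"
    using ae by eventually_elim auto
  ultimately show thesis by (rule that)
qed

text \<open>Leaves room of width \<open>d\<close> around \<open>K\<close>, so that a mollification
  with radius at most \<open>d\<close> at a point of \<open>K\<close> sees only values on a compact
  subset of \<open>\<Omega>\<close>.\<close>

lemma compact_enlarge:
  fixes K :: "'a::euclidean_space set"
  assumes "compact K" "open \<Omega>" "K \<subseteq> \<Omega>"
  obtains K' d where "compact K'" "K' \<subseteq> \<Omega>" "K \<subseteq> K'" "d > 0" "\<And>x. x \<in> K \<Longrightarrow> cball x d \<subseteq> K'"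
proof -
  obtain d where d: "d > 0" "(\<Union>x\<in>K. cball x d) \<subseteq> \<Omega>"
    using compact_subset_open_imp_cball_epsilon_subset[OF assms] by blast
  have eq: "(\<Union>x\<in>K. cball x d) = {x + y |x y. x \<in> K \<and> y \<in> cball 0 d}"
    by (auto simp: dist_norm norm_minus_commute) (metis add.commute diff_add_cancel)
  have "compact (\<Union>x\<in>K. cball x d)"
    unfolding eq using assms(1) by (intro compact_sums) auto
  then show thesis
    using that[of "\<Union>x\<in>K. cball x d" d] d by force
qed

lemma bounded_compact_support:
  fixes \<phi> :: "'a::euclidean_space \<Rightarrow> real"
  assumes "continuous_on UNIV \<phi>" "compact K" "\<And>x. x \<notin> K \<Longrightarrow> \<phi> x = 0"
  obtains B where "\<And>x. \<bar>\<phi> x\<bar> \<le> B"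
proof -
  have "compact (\<phi> ` K)"
    using assms by (intro compact_continuous_image continuous_on_subset[OF assms(1)]) auto
  then obtain C where C: "\<And>x. x \<in> K \<Longrightarrow> \<bar>\<phi> x\<bar> \<le> C"
    using compact_imp_bounded bounded_iff by (metis image_eqI real_norm_def)
  have "\<bar>\<phi> x\<bar> \<le> max C 0" for x
    using C[of x] assms(3)[of x] by (cases "x \<in> K") auto
  then show thesis by (rule that)
qed

text \<open>The support is compact, so the function and its derivative are bounded. The derivative
  vanishes off the support because the complement is open.\<close>

lemma test_function_facts:
  fixes \<phi> :: "'a::euclidean_space \<Rightarrow> real"
  assumes "test_function \<Omega> \<phi>" "b \<in> Basis"
  obtains K B where "compact K" "K \<subseteq> \<Omega>"
    "\<And>x. x \<notin> K \<Longrightarrow> \<phi> x = 0" "\<And>x. x \<notin> K \<Longrightarrow> frechet_derivative \<phi> (at x) b = 0"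
    "\<And>x. \<bar>\<phi> x\<bar> \<le> B" "\<And>x. \<bar>frechet_derivative \<phi> (at x) b\<bar> \<le> B"
    "\<phi> \<in> borel_measurable borel" "(\<lambda>x. frechet_derivative \<phi> (at x) b) \<in> borel_measurable borel"
    "\<And>x. (\<phi> has_derivative frechet_derivative \<phi> (at x)) (at x)"
proof -
  define K where "K = closure {x. \<phi> x \<noteq> 0}"
  have K: "compact K" "K \<subseteq> \<Omega>" and ck: "\<And>k. Ck k \<phi>"
    using assms(1) by (auto simp: test_function_def K_def)
  have 0: "\<phi> x = 0" if "x \<notin> K" for x
    using that closure_subset[of "{x. \<phi> x \<noteq> 0}"] by (auto simp: K_def)
  have d0: "frechet_derivative \<phi> (at x) b = 0" if "x \<notin> K" for x
  proof -
    have "(\<phi> has_derivative (\<lambda>_. 0)) (at x)"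
      by (rule has_derivative_transform_within_open[of "\<lambda>_. 0" _ _ _ "- K"])
        (use that 0 K in \<open>auto intro: compact_imp_closed\<close>)
    from frechet_derivative_at[OF this] show ?thesis by metis
  qed
  have d: "(\<phi> has_derivative frechet_derivative \<phi> (at x)) (at x)" for x
    using CkSucD(1)[OF ck] .
  have c1: "continuous_on UNIV \<phi>" using Ck_continuous[OF ck] .
  have c2: "continuous_on UNIV (\<lambda>x. frechet_derivative \<phi> (at x) b)"
    using Ck_continuous[OF CkSucD(2)[OF ck assms(2)]] .
  obtain B1 where B1: "\<And>x. \<bar>\<phi> x\<bar> \<le> B1"
    using bounded_compact_support[OF c1 K(1) 0] by blast
  obtain B2 where B2: "\<And>x. \<bar>frechet_derivative \<phi> (at x) b\<bar> \<le> B2"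
    using bounded_compact_support[OF c2 K(1) d0] by blast
  show thesis
  proof (rule that[OF K 0 d0 _ _ _ _ d])
    show "\<bar>\<phi> x\<bar> \<le> max B1 B2" "\<bar>frechet_derivative \<phi> (at x) b\<bar> \<le> max B1 B2" for x
      using B1[of x] B2[of x] by auto
  qed (use c1 c2 in \<open>auto intro: borel_measurable_continuous_onI\<close>)
qed

lemma locally_integrable_times_bounded:
  fixes u \<psi> :: "'a::euclidean_space \<Rightarrow> real"
  assumes "locally_integrable_on u \<Omega>" "\<Omega> \<in> sets lebesgue" "compact K" "K \<subseteq> \<Omega>"
    and [measurable]: "\<psi> \<in> borel_measurable borel" and "\<And>x. x \<notin> K \<Longrightarrow> \<psi> x = 0" "\<And>x. \<bar>\<psi> x\<bar> \<le> B"
  shows "integrable (lebesgue_on \<Omega>) (\<lambda>x. u x * \<psi> x)"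
proof -
  obtain U where U: "integrable lborel U" "AE x in lebesgue. x \<in> K \<longrightarrow> U x = u x"
    by (rule locally_integrable_representative[OF assms(1,3,4)]) blast
  have u: "u \<in> borel_measurable (lebesgue_on K)"
    using assms(1,3,4) by (auto simp: locally_integrable_on_def)
  have "integrable lborel (\<lambda>x. U x * \<psi> x)"
  proof (rule Bochner_Integration.integrable_bound[of _ "\<lambda>x. B * \<bar>U x\<bar>"])
    show "AE x in lborel. norm (U x * \<psi> x) \<le> norm (B * \<bar>U x\<bar>)"
      using order_trans[OF assms(7) abs_ge_self]
      by (intro AE_I2) (simp add: abs_mult mult.commute[of "\<bar>B\<bar>"] mult_left_mono)
  qed (use U borel_measurable_integrable[OF U(1)] in auto)
  then show ?thesis
    by (subst integrable_restrict_representative[of K \<Omega> u U])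
      (use assms u U borel_measurable_integrable[OF U(1)] in \<open>auto simp: borel_compact\<close>)
qed

text \<open>Small bumps centred in a compact \<open>K\<close> are test functions, so the
  mollifications of a representative of \<open>h\<close> vanish on \<open>K\<close>. They converge
  to it in \<open>L^1\<close>, hence \<open>h\<close> vanishes almost everywhere on
  \<open>K\<close>, and countably many such sets exhaust \<open>\<Omega>\<close>.\<close>

lemma fundamental_lemma:
  fixes h :: "'a::euclidean_space \<Rightarrow> real"
  assumes \<Omega>: "open \<Omega>" and h: "locally_integrable_on h \<Omega>"
    and z: "\<And>\<phi>. test_function \<Omega> \<phi> \<Longrightarrow> (LINT x|lebesgue_on \<Omega>. h x * \<phi> x) = 0"
  shows "AE x in lebesgue_on \<Omega>. h x = 0"
proof -
  have \<Omega>s: "\<Omega> \<in> sets lebesgue" using \<Omega> by simp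
  have K0: "AE x in lebesgue. x \<in> K \<longrightarrow> h x = 0" if K: "compact K" "K \<subseteq> \<Omega>" for K
  proof -
    obtain K' d where K': "compact K'" "K' \<subseteq> \<Omega>" "K \<subseteq> K'" and d: "d > 0" "\<And>x. x \<in> K \<Longrightarrow> cball x d \<subseteq> K'"
      by (rule compact_enlarge[OF K(1) \<Omega> K(2)]) blast
    obtain H where H: "integrable lborel H" "AE x in lebesgue. x \<in> K' \<longrightarrow> H x = h x"
      by (rule locally_integrable_representative[OF h K'(1,2)]) blast
    have hm: "h \<in> borel_measurable (lebesgue_on K')"
      using h K' by (auto simp: locally_integrable_on_def)
    note [measurable] = borel_measurable_integrable[OF H(1), simplified]
    have [measurable]: "K \<in> sets borel" using K by (simp add: borel_compact)
    have moll0: "moll r H x = 0" if "0 < r" "r \<le> d" "x \<in> K" for r x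
    proof -
      have cb: "cball x r \<subseteq> K'" using d(2)[OF that(3)] that(2) by auto
      have "(LINT y|lborel. H y * bump r x y) = (LINT y|lebesgue_on \<Omega>. h y * bump r x y)"
        by (rule integrable_restrict_representative(2)[of K', symmetric])
          (use K' \<Omega>s hm H(2) cb bump_eq_0_iff[OF that(1), of x] in \<open>auto simp: borel_compact subset_iff\<close>)
      also have "\<dots> = 0"
        using test_function_bump[OF that(1)] cb K' by (intro z) auto
      finally show ?thesis by (simp add: moll_def)
    qed
    have iK: "integrable lborel (\<lambda>x. indicator K x * \<bar>H x\<bar>)"
      by (rule Bochner_Integration.integrable_bound[OF H(1)]) (auto simp: indicator_def)
    have "(LINT x|lborel. indicator K x * \<bar>H x\<bar>) \<le> 0"
    proof (rule field_le_epsilon)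
      fix e :: real assume "e > 0"
      obtain d' where d': "d' > 0" "\<And>r. 0 < r \<Longrightarrow> r \<le> d' \<Longrightarrow> integrable lborel (moll r H)"
        "\<And>r. 0 < r \<Longrightarrow> r \<le> d' \<Longrightarrow> (LINT x|lborel. \<bar>moll r H x - H x\<bar>) \<le> e"
        using moll_L1[OF H(1) \<open>e > 0\<close>] by blast
      let ?r = "min d d'"
      have r: "0 < ?r" "?r \<le> d" "?r \<le> d'" using d d' by auto
      \<comment> \<open>On \<open>K\<close> the mollification is 0, so there \<bar>H\<bar> is
        exactly the mollification error.\<close>
      have "(LINT x|lborel. indicator K x * \<bar>H x\<bar>) \<le> (LINT x|lborel. \<bar>moll ?r H x - H x\<bar>)"
        using d'(2)[OF r(1,3)] H(1) iK moll0[OF r(1,2)]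
        by (intro integral_mono) (auto simp: indicator_def)
      with d'(3)[OF r(1,3)] show "(LINT x|lborel. indicator K x * \<bar>H x\<bar>) \<le> 0 + e" by simp
    qed
    then have "(LINT x|lborel. indicator K x * \<bar>H x\<bar>) = 0"
      by (intro antisym integral_nonneg_AE) auto
    then have "AE x in lborel. indicator K x * \<bar>H x\<bar> = 0"
      using integral_nonneg_eq_0_iff_AE[OF iK] by simp
    then have "AE x in lebesgue. indicator K x * \<bar>H x\<bar> = 0" by (rule AE_completion)
    with H(2) show ?thesis
      by eventually_elim (use K'(3) in auto)
  qed
  obtain C where C: "\<And>n::nat. compact (C n)" "\<And>n. C n \<subseteq> \<Omega>" "\<Union>(range C) = \<Omega>"
    using open_Union_compact_subsets[OF \<Omega>] by metis
  have "AE x in lebesgue. \<forall>n. x \<in> C n \<longrightarrow> h x = 0"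
    unfolding AE_all_countable using K0 C by blast
  then have "AE x in lebesgue. x \<in> \<Omega> \<longrightarrow> h x = 0"
    by eventually_elim (use C(3) in blast)
  then show ?thesis using \<Omega>s by (simp add: AE_restrict_space_iff)
qed

section \<open>Uniqueness and linearity of weak gradients\<close>

lemma locally_integrable_inner:
  fixes g :: "'a::euclidean_space \<Rightarrow> 'b::euclidean_space"
  assumes "locally_integrable_on g \<Omega>"
  shows "locally_integrable_on (\<lambda>x. g x \<bullet> b) \<Omega>"
  using assms by (auto simp: locally_integrable_on_def)

lemma weak_gradient_unique:
  fixes u :: "'a::euclidean_space \<Rightarrow> real"
  assumes \<Omega>: "open \<Omega>" and g: "has_weak_gradient \<Omega> u g" "has_weak_gradient \<Omega> u g'"
  shows "AE x in lebesgue_on \<Omega>. g x = g' x"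
proof -
  have l: "locally_integrable_on g \<Omega>" "locally_integrable_on g' \<Omega>"
    using g by (auto simp: has_weak_gradient_def)
  have "AE x in lebesgue_on \<Omega>. (g x - g' x) \<bullet> b = 0" if b: "b \<in> Basis" for b
  proof (rule fundamental_lemma[OF \<Omega>])
    show "locally_integrable_on (\<lambda>x. (g x - g' x) \<bullet> b) \<Omega>"
      using l by (intro locally_integrable_inner) (auto simp: locally_integrable_on_def)
    fix \<phi> assume \<phi>: "test_function \<Omega> \<phi>"
    obtain K B where K: "compact K" "K \<subseteq> \<Omega>" "\<And>x. x \<notin> K \<Longrightarrow> \<phi> x = 0" "\<And>x. \<bar>\<phi> x\<bar> \<le> B" "\<phi> \<in> borel_measurable borel"
      using test_function_facts[OF \<phi> b] by metis
    have i: "integrable (lebesgue_on \<Omega>) (\<lambda>x. (f x \<bullet> b) * \<phi> x)" if "locally_integrable_on f \<Omega>" for f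
      using locally_integrable_times_bounded[OF locally_integrable_inner[OF that] _ K(1,2,5,3,4)] \<Omega> by simp
    have "(LINT x|lebesgue_on \<Omega>. (g x \<bullet> b) * \<phi> x) = (LINT x|lebesgue_on \<Omega>. (g' x \<bullet> b) * \<phi> x)"
      using g \<phi> b unfolding has_weak_gradient_def by fastforce
    then show "(LINT x|lebesgue_on \<Omega>. ((g x - g' x) \<bullet> b) * \<phi> x) = 0"
      using i[OF l(1)] i[OF l(2)] by (simp add: inner_diff_left left_diff_distrib)
  qed
  then have "AE x in lebesgue_on \<Omega>. \<forall>b\<in>Basis. (g x - g' x) \<bullet> b = 0"
    by (subst AE_ball_countable) (auto intro: countable_finite)
  then show ?thesis
    by eventually_elim (auto simp: euclidean_eq_iff[where 'a='a] inner_diff_left)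
qed

lemma has_weak_gradient_lincomb:
  fixes u v :: "'a::euclidean_space \<Rightarrow> real"
  assumes \<Omega>: "open \<Omega>" and u: "has_weak_gradient \<Omega> u g" and v: "has_weak_gradient \<Omega> v h"
  shows "has_weak_gradient \<Omega> (\<lambda>x. \<alpha> * u x + \<beta> * v x) (\<lambda>x. \<alpha> *\<^sub>R g x + \<beta> *\<^sub>R h x)"
  unfolding has_weak_gradient_def
proof (intro conjI allI impI; (elim conjE)?)
  have l: "locally_integrable_on g \<Omega>" "locally_integrable_on h \<Omega>" "locally_integrable_on u \<Omega>" "locally_integrable_on v \<Omega>"
    using u v by (auto simp: has_weak_gradient_def)
  then show "locally_integrable_on (\<lambda>x. \<alpha> * u x + \<beta> * v x) \<Omega>" "locally_integrable_on (\<lambda>x. \<alpha> *\<^sub>R g x + \<beta> *\<^sub>R h x) \<Omega>"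
    by (auto simp: locally_integrable_on_def)
  fix \<phi> b assume \<phi>: "test_function \<Omega> \<phi>" and b: "b \<in> (Basis :: 'a set)"
  let ?d = "\<lambda>x. frechet_derivative \<phi> (at x) b"
  obtain K B where K: "compact K" "K \<subseteq> \<Omega>" "\<And>x. x \<notin> K \<Longrightarrow> \<phi> x = 0" "\<And>x. x \<notin> K \<Longrightarrow> ?d x = 0"
    "\<And>x. \<bar>\<phi> x\<bar> \<le> B" "\<And>x. \<bar>?d x\<bar> \<le> B" "\<phi> \<in> borel_measurable borel" "?d \<in> borel_measurable borel"
    using test_function_facts[OF \<phi> b] by metis
  have i1: "integrable (lebesgue_on \<Omega>) (\<lambda>x. (f x \<bullet> b) * \<phi> x)" if "locally_integrable_on f \<Omega>" for f
    using locally_integrable_times_bounded[OF locally_integrable_inner[OF that] _ K(1,2,7,3,5)] \<Omega> by simp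
  have i2: "integrable (lebesgue_on \<Omega>) (\<lambda>x. f x * ?d x)" if "locally_integrable_on f \<Omega>" for f
    using locally_integrable_times_bounded[OF that _ K(1,2,8,4,6)] \<Omega> by simp
  have e1: "(LINT x|lebesgue_on \<Omega>. u x * ?d x) = - (LINT x|lebesgue_on \<Omega>. (g x \<bullet> b) * \<phi> x)"
    and e2: "(LINT x|lebesgue_on \<Omega>. v x * ?d x) = - (LINT x|lebesgue_on \<Omega>. (h x \<bullet> b) * \<phi> x)"
    using u v \<phi> b by (auto simp: has_weak_gradient_def)
  have "(LINT x|lebesgue_on \<Omega>. (\<alpha> * u x + \<beta> * v x) * ?d x) =
      \<alpha> * (LINT x|lebesgue_on \<Omega>. u x * ?d x) + \<beta> * (LINT x|lebesgue_on \<Omega>. v x * ?d x)"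
    using i2[OF l(3)] i2[OF l(4)] by (simp add: distrib_right mult.assoc)
  moreover have "(LINT x|lebesgue_on \<Omega>. ((\<alpha> *\<^sub>R g x + \<beta> *\<^sub>R h x) \<bullet> b) * \<phi> x) =
      \<alpha> * (LINT x|lebesgue_on \<Omega>. (g x \<bullet> b) * \<phi> x) + \<beta> * (LINT x|lebesgue_on \<Omega>. (h x \<bullet> b) * \<phi> x)"
    using i1[OF l(1)] i1[OF l(2)] by (simp add: inner_add_left distrib_right mult.assoc)
  ultimately show "(LINT x|lebesgue_on \<Omega>. (\<alpha> * u x + \<beta> * v x) * ?d x) =
      - (LINT x|lebesgue_on \<Omega>. ((\<alpha> *\<^sub>R g x + \<beta> *\<^sub>R h x) \<bullet> b) * \<phi> x)"
    using e1 e2 by simp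
qed

section \<open>The chain rule for weak gradients\<close>

lemma real_lipschitz_deriv:
  assumes "\<And>s. (F has_real_derivative F' s) (at s)" "\<And>s. \<bar>F' s\<bar> \<le> L"
  shows "\<bar>F s - F t\<bar> \<le> L * \<bar>s - t\<bar>"
proof -
  have "norm (F s - F t) \<le> L * norm (s - t)"
    by (rule field_differentiable_bound[OF convex_UNIV, where f' = F'])
      (use assms in \<open>auto intro: DERIV_subset\<close>)
  then show ?thesis by simp
qed

lemma real_lipschitz_deriv_le:
  assumes "\<And>s. (F has_real_derivative F' s) (at s)" "\<And>s. \<bar>F' s\<bar> \<le> L"
  shows "\<bar>F s\<bar> \<le> \<bar>F 0\<bar> + L * \<bar>s\<bar>"
  using real_lipschitz_deriv[OF assms, of s 0] by simp

text \<open>A bump whose ball lies in \<open>\<Omega>\<close> is itself a test function, so the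
  definition of the weak gradient applies to the kernel: the derivative of the mollification is the
  mollification of the weak derivative.\<close>

lemma moll_line_derivative_weak:
  fixes u :: "'a::euclidean_space \<Rightarrow> real"
  assumes \<Omega>: "open \<Omega>" and u: "has_weak_gradient \<Omega> u g" and b: "b \<in> Basis"
    and K: "compact K" "K \<subseteq> \<Omega>" "cball x r \<subseteq> K" and r: "r > 0"
    and U: "integrable lborel U" "AE x in lebesgue. x \<in> K \<longrightarrow> U x = u x"
    and G: "integrable lborel G" "AE x in lebesgue. x \<in> K \<longrightarrow> G x = g x \<bullet> b"
  shows "- (LINT y|lborel. U y * dbump r b x y) / (LINT y|lborel. bump r 0 (y::'a)) = moll r G x"
proof -
  have \<Omega>s: "\<Omega> \<in> sets lebesgue" and Ks: "K \<in> sets lebesgue" using \<Omega> K by (auto simp: borel_compact)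
  have um: "u \<in> borel_measurable (lebesgue_on K)" "(\<lambda>x. g x \<bullet> b) \<in> borel_measurable (lebesgue_on K)"
    using u K by (auto simp: has_weak_gradient_def locally_integrable_on_def)
  have out: "y \<notin> ball x r" if "y \<notin> K" for y using that K(3) by (meson ball_subset_cball subsetD)
  have "(LINT y|lborel. U y * dbump r b x y) = (LINT y|lebesgue_on \<Omega>. u y * dbump r b x y)"
    by (rule integrable_restrict_representative(2)[OF K(2) Ks \<Omega>s um(1), symmetric])
      (use U borel_measurable_integrable[OF U(1)] dbump_eq_0[OF r] out in auto)
  also have "\<dots> = - (LINT y|lebesgue_on \<Omega>. (g y \<bullet> b) * bump r x y)"
    using u b test_function_bump[OF r order_trans[OF K(3,2)]]
    unfolding has_weak_gradient_def frechet_derivative_bump[symmetric] by blast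
  also have "(LINT y|lebesgue_on \<Omega>. (g y \<bullet> b) * bump r x y) = (LINT y|lborel. G y * bump r x y)"
    by (rule integrable_restrict_representative(2)[OF K(2) Ks \<Omega>s um(2)])
      (use G borel_measurable_integrable[OF G(1)] bump_eq_0_iff[OF r] out in auto)
  finally show ?thesis by (simp add: moll_def)
qed

text \<open>The same radii serve \<open>U\<close> and \<open>G\<close>. A subsequence turns the
  \<open>L^1\<close> convergence for \<open>U\<close> into convergence almost everywhere, which is
  what composition with a merely continuous \<open>F'\<close> requires.\<close>

lemma moll_sequence:
  fixes U G :: "'a::euclidean_space \<Rightarrow> real"
  assumes U: "integrable lborel U" and G: "integrable lborel G" and d: "d > 0"
  obtains r :: "nat \<Rightarrow> real" where "\<And>n. 0 < r n" "\<And>n. r n \<le> d"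
    "\<And>n. integrable lborel (moll (r n) U)" "\<And>n. integrable lborel (moll (r n) G)"
    "(\<lambda>n. LINT x|lborel. \<bar>moll (r n) U x - U x\<bar>) \<longlonglongrightarrow> 0"
    "(\<lambda>n. LINT x|lborel. \<bar>moll (r n) G x - G x\<bar>) \<longlonglongrightarrow> 0"
    "AE x in lborel. (\<lambda>n. moll (r n) U x) \<longlonglongrightarrow> U x"
proof -
  have "\<exists>r. 0 < r \<and> r \<le> d \<and> integrable lborel (moll r U) \<and> integrable lborel (moll r G) \<and>
      (LINT x|lborel. \<bar>moll r U x - U x\<bar>) \<le> inverse (Suc n) \<and>
      (LINT x|lborel. \<bar>moll r G x - G x\<bar>) \<le> inverse (Suc n)" (is "\<exists>r. ?Q n r") for n
  proof -
    have e: "inverse (real (Suc n)) > 0" by simp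
    obtain d1 where d1: "d1 > 0" "\<And>r. 0 < r \<Longrightarrow> r \<le> d1 \<Longrightarrow> integrable lborel (moll r U)"
        "\<And>r. 0 < r \<Longrightarrow> r \<le> d1 \<Longrightarrow> (LINT x|lborel. \<bar>moll r U x - U x\<bar>) \<le> inverse (real (Suc n))"
      using moll_L1[OF U e] by blast
    obtain d2 where d2: "d2 > 0" "\<And>r. 0 < r \<Longrightarrow> r \<le> d2 \<Longrightarrow> integrable lborel (moll r G)"
        "\<And>r. 0 < r \<Longrightarrow> r \<le> d2 \<Longrightarrow> (LINT x|lborel. \<bar>moll r G x - G x\<bar>) \<le> inverse (real (Suc n))"
      using moll_L1[OF G e] by blast
    show ?thesis
      by (rule exI[of _ "min d (min d1 d2)"]) (use d d1 d2 in auto)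
  qed
  then have "\<exists>r. \<forall>n. ?Q n (r n)" by (intro choice allI)
  then obtain r where "\<And>n. ?Q n (r n)" by blast
  then have r: "\<And>n. 0 < r n" "\<And>n. r n \<le> d"
    and i: "\<And>n. integrable lborel (moll (r n) U)" "\<And>n. integrable lborel (moll (r n) G)"
    and bd: "\<And>n. (LINT x|lborel. \<bar>moll (r n) U x - U x\<bar>) \<le> inverse (real (Suc n))"
      "\<And>n. (LINT x|lborel. \<bar>moll (r n) G x - G x\<bar>) \<le> inverse (real (Suc n))"
    by blast+
  have lim: "(\<lambda>n. LINT x|lborel. \<bar>moll (r n) U x - U x\<bar>) \<longlonglongrightarrow> 0"
       "(\<lambda>n. LINT x|lborel. \<bar>moll (r n) G x - G x\<bar>) \<longlonglongrightarrow> 0"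
    by (rule tendsto_sandwich[OF _ _ tendsto_const LIMSEQ_inverse_real_of_nat];
        use bd in \<open>auto intro!: always_eventually integral_nonneg_AE\<close>)+
  obtain s where s: "strict_mono s" "AE x in lborel. (\<lambda>n. moll (r (s n)) U x - U x) \<longlonglongrightarrow> 0"
    using tendsto_L1_AE_subseq[of lborel "\<lambda>n x. moll (r n) U x - U x"] i U lim by auto
  show thesis
  proof (rule that[of "r \<circ> s"])
    show "AE x in lborel. (\<lambda>n. moll ((r \<circ> s) n) U x) \<longlonglongrightarrow> U x"
      using s(2) by eventually_elim (simp add: LIM_zero_iff)
  qed (use r i LIMSEQ_subseq_LIMSEQ[OF lim(1) s(1)] LIMSEQ_subseq_LIMSEQ[OF lim(2) s(1)] in \<open>auto simp: o_def\<close>)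
qed

text \<open>The identity holds classically for the mollifications, whose product with the test
  function has compact support. In the limit \<open>F\<close> is handled by its Lipschitz bound and
  \<open>F'\<close> by dominated convergence along a sequence that converges almost
  everywhere.\<close>

lemma weak_gradient_chain:
  fixes u :: "'a::euclidean_space \<Rightarrow> real"
  assumes \<Omega>: "open \<Omega>" and u: "has_weak_gradient \<Omega> u g"
    and F: "\<And>s. (F has_real_derivative F' s) (at s)" and F'c: "continuous_on UNIV F'" and L: "\<And>s. \<bar>F' s\<bar> \<le> L"
  shows "has_weak_gradient \<Omega> (\<lambda>x. F (u x)) (\<lambda>x. F' (u x) *\<^sub>R g x)"
  unfolding has_weak_gradient_def
proof (intro conjI allI impI; (elim conjE)?)
  have \<Omega>s: "\<Omega> \<in> sets lebesgue" using \<Omega> by simp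
  have L0: "0 \<le> L" using L[of 0] by linarith
  have Fc: "continuous_on UNIV F"
    by (rule DERIV_continuous_on) (use F in \<open>auto intro: DERIV_subset\<close>)
  note [measurable] = borel_measurable_continuous_onI[OF Fc] borel_measurable_continuous_onI[OF F'c]
  have lu: "locally_integrable_on u \<Omega>" and lg: "locally_integrable_on g \<Omega>"
    using u by (auto simp: has_weak_gradient_def)
  show "locally_integrable_on (\<lambda>x. F (u x)) \<Omega>"
    unfolding locally_integrable_on_def
  proof (intro allI impI)
    fix K assume K: "compact K \<and> K \<subseteq> \<Omega>"
    then have i: "integrable (lebesgue_on K) u" using lu by (auto simp: locally_integrable_on_def)
    interpret finite_measure "lebesgue_on K"
      using K by (intro finite_measure_lebesgue_on) (simp add: lmeasurable_compact)
    note [measurable] = borel_measurable_integrable[OF i]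
    show "integrable (lebesgue_on K) (\<lambda>x. F (u x))"
      by (rule Bochner_Integration.integrable_bound[of _ "\<lambda>x. \<bar>F 0\<bar> + L * \<bar>u x\<bar>"])
        (use i real_lipschitz_deriv_le[OF F L] in \<open>auto intro!: order_trans[OF _ abs_ge_self]\<close>)
  qed
  show "locally_integrable_on (\<lambda>x. F' (u x) *\<^sub>R g x) \<Omega>"
    unfolding locally_integrable_on_def
  proof (intro allI impI)
    fix K assume K: "compact K \<and> K \<subseteq> \<Omega>"
    then have i: "integrable (lebesgue_on K) u" "integrable (lebesgue_on K) g"
      using lu lg by (auto simp: locally_integrable_on_def)
    note [measurable] = borel_measurable_integrable[OF i(1)] borel_measurable_integrable[OF i(2)]
    show "integrable (lebesgue_on K) (\<lambda>x. F' (u x) *\<^sub>R g x)"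
      by (rule Bochner_Integration.integrable_bound[of _ "\<lambda>x. L * norm (g x)"])
        (use i L L0 in \<open>auto intro!: mult_right_mono simp: abs_mult\<close>)
  qed
  fix \<phi> b assume \<phi>: "test_function \<Omega> \<phi>" and b: "b \<in> (Basis :: 'a set)"
  let ?d = "\<lambda>x. frechet_derivative \<phi> (at x) b"
  obtain K B where K: "compact K" "K \<subseteq> \<Omega>"
    and \<phi>0: "\<And>x. x \<notin> K \<Longrightarrow> \<phi> x = 0" "\<And>x. x \<notin> K \<Longrightarrow> ?d x = 0"
    and B: "\<And>x. \<bar>\<phi> x\<bar> \<le> B" "\<And>x. \<bar>?d x\<bar> \<le> B"
    and \<phi>m [measurable]: "\<phi> \<in> borel_measurable borel" "?d \<in> borel_measurable borel"
    and \<phi>d: "\<And>x. (\<phi> has_derivative frechet_derivative \<phi> (at x)) (at x)"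
    using test_function_facts[OF \<phi> b] by metis
  have B0: "0 \<le> B" using B(1)[of 0] by linarith
  obtain K' d where K': "compact K'" "K' \<subseteq> \<Omega>" "K \<subseteq> K'" and d: "d > 0" "\<And>x. x \<in> K \<Longrightarrow> cball x d \<subseteq> K'"
    using compact_enlarge[OF K(1) \<Omega> K(2)] by blast
  have Ks: "K \<in> sets lebesgue" using K by (auto simp: borel_compact)
  have Kb: "K \<in> sets borel" using K by (auto simp: borel_compact)
  obtain U where U: "integrable lborel U" "AE x in lebesgue. x \<in> K' \<longrightarrow> U x = u x"
    using locally_integrable_representative[OF lu K'(1,2)] by blast
  obtain G where G: "integrable lborel G" "AE x in lebesgue. x \<in> K' \<longrightarrow> G x = g x \<bullet> b"
    using locally_integrable_representative[OF locally_integrable_inner[OF lg] K'(1,2)] by blast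
  note [measurable] = borel_measurable_integrable[OF U(1), simplified] borel_measurable_integrable[OF G(1), simplified]
  obtain r where r: "\<And>n. 0 < r n" "\<And>n. r n \<le> d"
    and vi: "\<And>n. integrable lborel (moll (r n) U)" "\<And>n. integrable lborel (moll (r n) G)"
    and v1: "(\<lambda>n. LINT x|lborel. \<bar>moll (r n) U x - U x\<bar>) \<longlonglongrightarrow> 0"
    and G1: "(\<lambda>n. LINT x|lborel. \<bar>moll (r n) G x - G x\<bar>) \<longlonglongrightarrow> 0"
    and va: "AE x in lborel. (\<lambda>n. moll (r n) U x) \<longlonglongrightarrow> U x"
    using moll_sequence[OF U(1) G(1) d(1)] by blast
  let ?v = "\<lambda>n. moll (r n) U" and ?G = "\<lambda>n. moll (r n) G"
  let ?I = "\<lambda>n x. F' (?v n x) * ?G n x * \<phi> x + F (?v n x) * ?d x"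
  let ?J = "\<lambda>x. F' (U x) * G x * \<phi> x + F (U x) * ?d x"
  \<comment> \<open>Integration by parts for the mollified functions. \<open>V\<close> is their
    classical derivative; on \<open>K\<close> it equals the mollified gradient \<open>?G n\<close>,
    and outside \<open>K\<close> the test function and its derivative vanish.\<close>
  have parts: "(LINT x|lborel. ?I n x) = 0" for n
  proof -
    define c where "c = (LINT y|lborel. bump (r n) 0 (y::'a))"
    have c: "c > 0" unfolding c_def by (rule integral_bump_pos[OF r(1)])
    define V where "V x = - (LINT y|lborel. U y * dbump (r n) b x y) / c" for x
    have [measurable]: "V \<in> borel_measurable borel"
      unfolding V_def dbump_def by measurable
    have dv: "((\<lambda>t. ?v n (x + t *\<^sub>R b)) has_real_derivative V x) (at 0)" for x
      using moll_line_derivative[OF U(1) r(1)] by (simp add: V_def c_def)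
    obtain C where C: "\<And>x a. \<bar>dbump (r n) b (a::'a) x\<bar> \<le> C" using dbump_bounded[OF r(1)] by blast
    have C0: "0 \<le> C" using C[of 0 0] by linarith
    have "\<bar>LINT y|lborel. U y * dbump (r n) b x y\<bar> \<le> (LINT y|lborel. \<bar>U y\<bar> * C)" for x
    proof -
      have i: "integrable lborel (\<lambda>y. U y * dbump (r n) b x y)"
        by (rule Bochner_Integration.integrable_bound[of _ "\<lambda>y. \<bar>U y\<bar> * C"])
          (use U(1) C C0 in \<open>auto simp: abs_mult intro!: mult_left_mono\<close>)
      have "\<bar>LINT y|lborel. U y * dbump (r n) b x y\<bar> \<le> (LINT y|lborel. \<bar>U y * dbump (r n) b x y\<bar>)"
        by (rule integral_abs_bound)
      also have "\<dots> \<le> (LINT y|lborel. \<bar>U y\<bar> * C)"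
        using integrable_abs[OF i] U(1) C by (intro integral_mono) (auto simp: abs_mult intro!: mult_left_mono)
      finally show ?thesis .
    qed
    then have V: "\<bar>V x\<bar> \<le> (LINT y|lborel. \<bar>U y\<bar> * C) / c" for x
      using c by (simp add: V_def divide_right_mono)
    define N where "N = (LINT y|lborel. \<bar>U y\<bar> * C) / c"
    have N: "\<bar>V x\<bar> \<le> N" for x using V by (simp add: N_def)
    have N0: "0 \<le> N" using N[of 0] by linarith
    define M where "M = (LINT y|lborel. \<bar>U y\<bar>) / c"
    have M: "\<bar>?v n x\<bar> \<le> M" for x
      using abs_moll_le[OF U(1) r(1)] by (simp add: M_def c_def)
    have FM: "\<bar>F (?v n x)\<bar> \<le> \<bar>F 0\<bar> + L * M" for x
      using real_lipschitz_deriv_le[OF F L, of "?v n x"] mult_left_mono[OF M L0, of x] by linarith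
    obtain R where R: "\<And>x. x \<in> K \<Longrightarrow> norm x \<le> R"
      using compact_imp_bounded[OF K(1)] bounded_iff by metis
    have VG: "V x = ?G n x" if "x \<in> K" for x
      unfolding V_def c_def
      by (rule moll_line_derivative_weak[OF \<Omega> u b K'(1,2) _ r(1) U G])
        (use d(2)[OF that] r(2)[of n] in auto)
    let ?w = "\<lambda>x. F (?v n x) * \<phi> x" and ?w' = "\<lambda>x. F' (?v n x) * V x * \<phi> x + F (?v n x) * ?d x"
    have "(LINT x|lborel. ?w' x) = 0"
    proof (rule integral_deriv_compact_support[where w = ?w and b = b])
      show "((\<lambda>t. ?w (x + t *\<^sub>R b)) has_real_derivative ?w' x) (at 0)" for x
      proof -
        have dF: "((\<lambda>t. F (?v n (x + t *\<^sub>R b))) has_real_derivative F' (?v n x) * V x) (at 0)"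
          using DERIV_chain2[OF F dv[of x]] by simp
        have d\<phi>: "((\<lambda>t. \<phi> (x + t *\<^sub>R b)) has_real_derivative ?d x) (at 0)"
          using has_derivative_imp_line[of \<phi> "frechet_derivative \<phi> (at x)" x 0 b] \<phi>d[of x] by simp
        show ?thesis using DERIV_mult[OF dF d\<phi>] by (simp add: mult_ac add.commute)
      qed
      show "norm b \<le> 1" using b by simp
      show "\<bar>?w x\<bar> \<le> (\<bar>F 0\<bar> + L * M) * B" for x
        unfolding abs_mult using FM[of x] B(1)[of x] by (intro mult_mono) auto
      show "\<bar>?w' x\<bar> \<le> L * N * B + (\<bar>F 0\<bar> + L * M) * B" for x
      proof (rule order_trans[OF abs_triangle_ineq add_mono])
        show "\<bar>F' (?v n x) * V x * \<phi> x\<bar> \<le> L * N * B"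
          unfolding abs_mult using L[of "?v n x"] N[of x] B(1)[of x] L0 N0 by (intro mult_mono) auto
        show "\<bar>F (?v n x) * ?d x\<bar> \<le> (\<bar>F 0\<bar> + L * M) * B"
          unfolding abs_mult using FM[of x] B(2)[of x] by (intro mult_mono) auto
      qed
      show "?w x \<noteq> 0 \<Longrightarrow> norm x \<le> R" for x using \<phi>0(1)[of x] R[of x] by auto
    qed measurable
    moreover have "?w' x = ?I n x" for x
      using VG[of x] \<phi>0[of x] by (cases "x \<in> K") auto
    ultimately show ?thesis by simp
  qed
  have iF: "integrable lborel (\<lambda>x. F (v x) * ?d x)" if v: "integrable lborel v" for v
  proof (rule Bochner_Integration.integrable_bound[of _ "\<lambda>x. (\<bar>F 0\<bar> * indicator K x + L * \<bar>v x\<bar>) * B"])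
    have "emeasure lborel K < \<infinity>" using emeasure_compact_finite[OF K(1)] by simp
    then show "integrable lborel (\<lambda>x. (\<bar>F 0\<bar> * indicator K x + L * \<bar>v x\<bar>) * B)"
      using v Kb by (auto intro!: Bochner_Integration.integrable_add simp: integrable_indicator_iff)
    show "(\<lambda>x. F (v x) * ?d x) \<in> borel_measurable lborel"
      using borel_measurable_integrable[OF v] by simp
    show "AE x in lborel. norm (F (v x) * ?d x) \<le> norm ((\<bar>F 0\<bar> * indicator K x + L * \<bar>v x\<bar>) * B)"
    proof (rule AE_I2)
      fix x
      have "\<bar>F (v x)\<bar> * \<bar>?d x\<bar> \<le> (\<bar>F 0\<bar> * indicator K x + L * \<bar>v x\<bar>) * B"
        using \<phi>0(2)[of x] real_lipschitz_deriv_le[OF F L, of "v x"] B(2)[of x] B0 L0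
        by (cases "x \<in> K") (auto intro!: mult_mono)
      then show "norm (F (v x) * ?d x) \<le> norm ((\<bar>F 0\<bar> * indicator K x + L * \<bar>v x\<bar>) * B)"
        unfolding real_norm_def abs_mult[of "F (v x)"] by (rule order_trans[OF _ abs_ge_self])
    qed
  qed
  have iG: "integrable lborel (\<lambda>x. F' (v x) * h x * \<phi> x)" if h: "integrable lborel h" and v: "v \<in> borel_measurable borel" for v h
  proof (rule Bochner_Integration.integrable_bound[of _ "\<lambda>x. L * \<bar>h x\<bar> * B"])
    show "integrable lborel (\<lambda>x. L * \<bar>h x\<bar> * B)" using h by simp
    show "(\<lambda>x. F' (v x) * h x * \<phi> x) \<in> borel_measurable lborel"
      using borel_measurable_integrable[OF h] v by simp
    show "AE x in lborel. norm (F' (v x) * h x * \<phi> x) \<le> norm (L * \<bar>h x\<bar> * B)"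
    proof (rule AE_I2)
      fix x
      have "\<bar>F' (v x)\<bar> * \<bar>h x\<bar> * \<bar>\<phi> x\<bar> \<le> L * \<bar>h x\<bar> * B"
        using L[of "v x"] B(1)[of x] L0 by (intro mult_mono) auto
      then show "norm (F' (v x) * h x * \<phi> x) \<le> norm (L * \<bar>h x\<bar> * B)"
        using B0 L0 by (simp add: abs_mult)
    qed
  qed
  have iI: "integrable lborel (?I n)" for n
    using iF[OF vi(1)] iG[OF vi(2)] borel_measurable_integrable[OF vi(1)] by simp
  have iJ: "integrable lborel ?J" using iF[OF U(1)] iG[OF G(1)] by simp
  have iD: "integrable lborel (\<lambda>x. \<bar>F' (?v n x) - F' (U x)\<bar> * \<bar>G x\<bar> * B)" for n
  proof (rule Bochner_Integration.integrable_bound[of _ "\<lambda>x. 2 * L * \<bar>G x\<bar> * B"])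
    show "AE x in lborel. norm (\<bar>F' (?v n x) - F' (U x)\<bar> * \<bar>G x\<bar> * B) \<le> norm (2 * L * \<bar>G x\<bar> * B)"
    proof (rule AE_I2)
      fix x
      have "\<bar>F' (?v n x) - F' (U x)\<bar> * \<bar>G x\<bar> * B \<le> (2 * L) * \<bar>G x\<bar> * B"
        using L[of "?v n x"] L[of "U x"] B0 by (intro mult_mono) auto
      then show "norm (\<bar>F' (?v n x) - F' (U x)\<bar> * \<bar>G x\<bar> * B) \<le> norm (2 * L * \<bar>G x\<bar> * B)"
        using B0 L0 by (simp add: abs_mult)
    qed
  qed (use G(1) in auto)
  have D0: "(\<lambda>n. LINT x|lborel. \<bar>F' (?v n x) - F' (U x)\<bar> * \<bar>G x\<bar> * B) \<longlonglongrightarrow> (LINT x|(lborel :: 'a measure). 0)"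
  proof (rule integral_dominated_convergence[where w = "\<lambda>x. 2 * L * \<bar>G x\<bar> * B"])
    show "AE x in lborel. (\<lambda>n. \<bar>F' (?v n x) - F' (U x)\<bar> * \<bar>G x\<bar> * B) \<longlonglongrightarrow> 0"
      using va
    proof eventually_elim
      case (elim x)
      have "(\<lambda>n. F' (?v n x)) \<longlonglongrightarrow> F' (U x)"
        by (rule continuous_on_tendsto_compose[OF F'c elim]) auto
      then have "(\<lambda>n. \<bar>F' (?v n x) - F' (U x)\<bar>) \<longlonglongrightarrow> 0"
        by (simp add: LIM_zero tendsto_rabs_zero)
      then show ?case by (intro tendsto_mult_left_zero)
    qed
    show "AE x in lborel. norm (\<bar>F' (?v n x) - F' (U x)\<bar> * \<bar>G x\<bar> * B) \<le> 2 * L * \<bar>G x\<bar> * B" for n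
    proof (rule AE_I2)
      fix x
      have "\<bar>F' (?v n x) - F' (U x)\<bar> * \<bar>G x\<bar> * B \<le> (2 * L) * \<bar>G x\<bar> * B"
        using L[of "?v n x"] L[of "U x"] B0 by (intro mult_mono) auto
      then show "norm (\<bar>F' (?v n x) - F' (U x)\<bar> * \<bar>G x\<bar> * B) \<le> 2 * L * \<bar>G x\<bar> * B"
        using B0 by (simp add: abs_mult)
    qed
  qed (use G(1) in auto)
  let ?E = "\<lambda>n. L * B * (LINT x|lborel. \<bar>?G n x - G x\<bar>) + (LINT x|lborel. \<bar>F' (?v n x) - F' (U x)\<bar> * \<bar>G x\<bar> * B)
      + L * B * (LINT x|lborel. \<bar>?v n x - U x\<bar>)"
  have E0: "?E \<longlonglongrightarrow> 0"
    using tendsto_add[OF tendsto_add[OF tendsto_mult_right_zero[OF G1, of "L * B"] D0] tendsto_mult_right_zero[OF v1, of "L * B"]]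
    by simp
  have le: "\<bar>(LINT x|lborel. ?J x)\<bar> \<le> ?E n" for n
  proof -
    have "\<bar>?I n x - ?J x\<bar> \<le> L * B * \<bar>?G n x - G x\<bar> + \<bar>F' (?v n x) - F' (U x)\<bar> * \<bar>G x\<bar> * B + L * B * \<bar>?v n x - U x\<bar>" for x
    proof -
      \<comment> \<open>One factor is exchanged at a time: the gradient, then the value of
        \<open>F'\<close>, then the value of \<open>F\<close>.\<close>
      have eq: "?I n x - ?J x = F' (?v n x) * (?G n x - G x) * \<phi> x + (F' (?v n x) - F' (U x)) * G x * \<phi> x + (F (?v n x) - F (U x)) * ?d x"
        by (simp add: algebra_simps)
      have "\<bar>?I n x - ?J x\<bar> \<le> \<bar>F' (?v n x)\<bar> * \<bar>?G n x - G x\<bar> * \<bar>\<phi> x\<bar> + \<bar>F' (?v n x) - F' (U x)\<bar> * \<bar>G x\<bar> * \<bar>\<phi> x\<bar> + \<bar>F (?v n x) - F (U x)\<bar> * \<bar>?d x\<bar>"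
        unfolding eq abs_mult[symmetric] by linarith
      also have "\<dots> \<le> L * \<bar>?G n x - G x\<bar> * B + \<bar>F' (?v n x) - F' (U x)\<bar> * \<bar>G x\<bar> * B + (L * \<bar>?v n x - U x\<bar>) * B"
      proof (intro add_mono)
        show "\<bar>F' (?v n x)\<bar> * \<bar>?G n x - G x\<bar> * \<bar>\<phi> x\<bar> \<le> L * \<bar>?G n x - G x\<bar> * B"
          using L0 by (intro mult_mono L B(1) mult_nonneg_nonneg) simp_all
        show "\<bar>F' (?v n x) - F' (U x)\<bar> * \<bar>G x\<bar> * \<bar>\<phi> x\<bar> \<le> \<bar>F' (?v n x) - F' (U x)\<bar> * \<bar>G x\<bar> * B"
          by (intro mult_left_mono B(1) mult_nonneg_nonneg) simp_all
        show "\<bar>F (?v n x) - F (U x)\<bar> * \<bar>?d x\<bar> \<le> L * \<bar>?v n x - U x\<bar> * B"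
          using L0 by (intro mult_mono real_lipschitz_deriv[OF F L] B(2) mult_nonneg_nonneg) simp_all
      qed
      finally show ?thesis by (simp add: mult_ac)
    qed
    note pt = this
    have i1: "integrable lborel (\<lambda>x. L * B * \<bar>?G n x - G x\<bar>)" and i2: "integrable lborel (\<lambda>x. L * B * \<bar>?v n x - U x\<bar>)"
      using vi U(1) G(1) by auto
    have "\<bar>LINT x|lborel. ?J x\<bar> = \<bar>LINT x|lborel. ?I n x - ?J x\<bar>"
      unfolding Bochner_Integration.integral_diff[OF iI iJ] using parts[of n] by simp
    also have "\<dots> \<le> (LINT x|lborel. \<bar>?I n x - ?J x\<bar>)" by (rule integral_abs_bound)
    also have "\<dots> \<le> (LINT x|lborel. L * B * \<bar>?G n x - G x\<bar> + \<bar>F' (?v n x) - F' (U x)\<bar> * \<bar>G x\<bar> * B + L * B * \<bar>?v n x - U x\<bar>)"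
      by (rule integral_mono[OF _ _ pt])
        (intro integrable_abs Bochner_Integration.integrable_diff Bochner_Integration.integrable_add iI iJ i1 i2 iD)+
    also have "\<dots> = ?E n"
      unfolding Bochner_Integration.integral_add[OF Bochner_Integration.integrable_add[OF i1 iD] i2]
        Bochner_Integration.integral_add[OF i1 iD] by simp
    finally show ?thesis .
  qed
  have "\<bar>LINT x|lborel. ?J x\<bar> \<le> 0"
    by (rule LIMSEQ_le_const[OF E0]) (use le in blast)
  then have "(LINT x|lborel. F' (U x) * G x * \<phi> x) + (LINT x|lborel. F (U x) * ?d x) = 0"
    using Bochner_Integration.integral_add[OF iG[OF G(1)] iF[OF U(1)]] by simp
  moreover have "(LINT x|lebesgue_on \<Omega>. F (u x) * ?d x) = (LINT x|lborel. F (U x) * ?d x)"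
  proof (rule integrable_restrict_representative(2)[OF K(2) Ks \<Omega>s])
    have [measurable]: "u \<in> borel_measurable (lebesgue_on K)"
      using lu K by (auto simp: locally_integrable_on_def)
    show "(\<lambda>x. F (u x)) \<in> borel_measurable (lebesgue_on K)" by measurable
    show "AE x in lebesgue. x \<in> K \<longrightarrow> F (U x) = F (u x)"
      using U(2) by eventually_elim (use K'(3) in auto)
  qed (use \<phi>0 in auto)
  moreover have "(LINT x|lebesgue_on \<Omega>. (F' (u x) *\<^sub>R g x \<bullet> b) * \<phi> x) = (LINT x|lborel. (F' (U x) * G x) * \<phi> x)"
  proof (rule integrable_restrict_representative(2)[OF K(2) Ks \<Omega>s])
    have [measurable]: "u \<in> borel_measurable (lebesgue_on K)" "g \<in> borel_measurable (lebesgue_on K)"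
      using lu lg K by (auto simp: locally_integrable_on_def)
    show "(\<lambda>x. F' (u x) *\<^sub>R g x \<bullet> b) \<in> borel_measurable (lebesgue_on K)" by measurable
    show "AE x in lebesgue. x \<in> K \<longrightarrow> F' (U x) * G x = F' (u x) *\<^sub>R g x \<bullet> b"
      using U(2) G(2) by eventually_elim (use K'(3) in auto)
  qed (use \<phi>0 in auto)
  ultimately show "(LINT x|lebesgue_on \<Omega>. F (u x) * ?d x) = - (LINT x|lebesgue_on \<Omega>. (F' (u x) *\<^sub>R g x \<bullet> b) * \<phi> x)"
    by simp
qed

section \<open>Weak gradients under \<open>L^1\<close> limits\<close>

lemma integrable_lebesgue_on_subset:
  fixes f :: "'a::euclidean_space \<Rightarrow> 'b::euclidean_space"
  assumes "integrable (lebesgue_on S) f" "T \<subseteq> S" "S \<in> sets lebesgue" "T \<in> sets lebesgue"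
  shows "integrable (lebesgue_on T) f"
proof -
  have "integrable lebesgue (\<lambda>x. indicator T x *\<^sub>R (if x \<in> S then f x else 0))"
    using assms by (intro integrable_mult_indicator) (auto simp: Lebesgue_Measure.integrable_restrict_UNIV)
  also have "(\<lambda>x. indicator T x *\<^sub>R (if x \<in> S then f x else 0)) = (\<lambda>x. if x \<in> T then f x else 0)"
    using assms(2) by (auto simp: fun_eq_iff indicator_def)
  finally show ?thesis
    using assms(4) by (simp add: Lebesgue_Measure.integrable_restrict_UNIV)
qed

lemma integrable_imp_locally_integrable_on:
  assumes "integrable (lebesgue_on \<Omega>) f" "\<Omega> \<in> sets lebesgue"
  shows "locally_integrable_on f \<Omega>"
  unfolding locally_integrable_on_def
proof (intro allI impI)
  fix K assume K: "compact K \<and> K \<subseteq> \<Omega>"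
  then have "K \<in> sets lebesgue" by (simp add: borel_compact)
  with K assms show "integrable (lebesgue_on K) f"
    by (intro integrable_lebesgue_on_subset[OF assms(1) _ assms(2)]) simp_all
qed

text \<open>Test functions and their derivatives are bounded, so \<open>L^1\<close> convergence
  suffices to pass to the limit in the defining identity.\<close>

lemma has_weak_gradient_limit:
  fixes u :: "nat \<Rightarrow> 'a::euclidean_space \<Rightarrow> real"
  assumes \<Omega>: "open \<Omega>" and wg: "\<And>n. has_weak_gradient \<Omega> (u n) (g n)"
    and i: "\<And>n. integrable (lebesgue_on \<Omega>) (u n)" "\<And>n. integrable (lebesgue_on \<Omega>) (g n)"
      "integrable (lebesgue_on \<Omega>) v" "integrable (lebesgue_on \<Omega>) h"
    and lim: "(\<lambda>n. LINT x|lebesgue_on \<Omega>. \<bar>u n x - v x\<bar>) \<longlonglongrightarrow> 0"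
      "(\<lambda>n. LINT x|lebesgue_on \<Omega>. norm (g n x - h x)) \<longlonglongrightarrow> 0"
  shows "has_weak_gradient \<Omega> v h"
  unfolding has_weak_gradient_def
proof (intro conjI allI impI; (elim conjE)?)
  have \<Omega>s: "\<Omega> \<in> sets lebesgue" using \<Omega> by simp
  show "locally_integrable_on v \<Omega>" "locally_integrable_on h \<Omega>"
    using i \<Omega>s by (auto intro: integrable_imp_locally_integrable_on)
  fix \<phi> b assume \<phi>: "test_function \<Omega> \<phi>" and b: "b \<in> (Basis :: 'a set)"
  let ?d = "\<lambda>x. frechet_derivative \<phi> (at x) b"
  obtain B where B: "\<And>x. \<bar>\<phi> x\<bar> \<le> B" "\<And>x. \<bar>?d x\<bar> \<le> B"
    and m: "\<phi> \<in> borel_measurable borel" "?d \<in> borel_measurable borel"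
    using test_function_facts[OF \<phi> b] by metis
  have mm: "\<phi> \<in> borel_measurable (lebesgue_on \<Omega>)" "?d \<in> borel_measurable (lebesgue_on \<Omega>)"
    using m by (simp_all add: measurable_restrict_space1 measurable_completion)
  \<comment> \<open>Stated for scalar functions with a separate error bound \<open>e\<close>, so
    that it applies to the functions themselves and to single components of the gradients, whose
    error is the norm of the whole difference.\<close>
  have L: "(\<lambda>n. LINT x|lebesgue_on \<Omega>. f n x * \<psi> x) \<longlonglongrightarrow> (LINT x|lebesgue_on \<Omega>. k x * \<psi> x)"
    if f: "\<And>n. integrable (lebesgue_on \<Omega>) (f n)" and k: "integrable (lebesgue_on \<Omega>) k"
      and le: "\<And>n x. \<bar>f n x - k x\<bar> \<le> e n x" and e: "\<And>n. integrable (lebesgue_on \<Omega>) (e n)"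
      and e0: "(\<lambda>n. LINT x|lebesgue_on \<Omega>. e n x) \<longlonglongrightarrow> 0"
      and \<psi>: "\<psi> \<in> borel_measurable (lebesgue_on \<Omega>)" "\<And>x. \<bar>\<psi> x\<bar> \<le> B"
    for f e :: "nat \<Rightarrow> 'a \<Rightarrow> real" and k \<psi> :: "'a \<Rightarrow> real"
  proof (rule LIM_zero_cancel, rule tendsto_rabs_zero_cancel, rule tendsto_sandwich[OF _ _ tendsto_const])
    have p: "integrable (lebesgue_on \<Omega>) (\<lambda>x. q x * \<psi> x)" if "integrable (lebesgue_on \<Omega>) q" for q :: "'a \<Rightarrow> real"
    proof (rule Bochner_Integration.integrable_bound[of _ "\<lambda>x. \<bar>q x\<bar> * B"])
      show "AE x in lebesgue_on \<Omega>. norm (q x * \<psi> x) \<le> norm (\<bar>q x\<bar> * B)"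
        using order_trans[OF \<psi>(2) abs_ge_self] by (intro AE_I2) (simp add: abs_mult mult_left_mono)
    qed (use that \<psi>(1) borel_measurable_integrable[OF that] in auto)
    have "\<bar>(LINT x|lebesgue_on \<Omega>. f n x * \<psi> x) - (LINT x|lebesgue_on \<Omega>. k x * \<psi> x)\<bar> \<le> B * (LINT x|lebesgue_on \<Omega>. e n x)" for n
    proof -
      have d: "integrable (lebesgue_on \<Omega>) (\<lambda>x. f n x * \<psi> x - k x * \<psi> x)"
        using p[OF f] p[OF k] by simp
      have "\<bar>(LINT x|lebesgue_on \<Omega>. f n x * \<psi> x) - (LINT x|lebesgue_on \<Omega>. k x * \<psi> x)\<bar> =
          \<bar>LINT x|lebesgue_on \<Omega>. f n x * \<psi> x - k x * \<psi> x\<bar>"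
        using p[OF f] p[OF k] by simp
      also have "\<dots> \<le> (LINT x|lebesgue_on \<Omega>. \<bar>f n x * \<psi> x - k x * \<psi> x\<bar>)" by (rule integral_abs_bound)
      also have "\<dots> \<le> (LINT x|lebesgue_on \<Omega>. B * e n x)"
      proof (rule integral_mono)
        fix x
        have "\<bar>\<psi> x\<bar> * \<bar>f n x - k x\<bar> \<le> B * e n x"
          using \<psi>(2)[of x] le[of n x] by (intro mult_mono) auto
        then show "\<bar>f n x * \<psi> x - k x * \<psi> x\<bar> \<le> B * e n x"
          by (simp only: left_diff_distrib[symmetric] abs_mult mult.commute[of "\<bar>\<psi> x\<bar>"])
      qed (use d e in auto)
      finally show ?thesis by simp
    qed
    then show "\<forall>\<^sub>F n in sequentially. \<bar>(LINT x|lebesgue_on \<Omega>. f n x * \<psi> x) - (LINT x|lebesgue_on \<Omega>. k x * \<psi> x)\<bar> \<le> B * (LINT x|lebesgue_on \<Omega>. e n x)"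
      by simp
    show "(\<lambda>n. B * (LINT x|lebesgue_on \<Omega>. e n x)) \<longlonglongrightarrow> 0"
      using tendsto_mult_right_zero[OF e0] .
  qed simp
  have "(\<lambda>n. LINT x|lebesgue_on \<Omega>. u n x * ?d x) \<longlonglongrightarrow> (LINT x|lebesgue_on \<Omega>. v x * ?d x)"
    by (rule L[OF i(1,3) _ _ lim(1)]) (use i mm B in auto)
  moreover have "(\<lambda>n. LINT x|lebesgue_on \<Omega>. (g n x \<bullet> b) * \<phi> x) \<longlonglongrightarrow> (LINT x|lebesgue_on \<Omega>. (h x \<bullet> b) * \<phi> x)"
  proof (rule L[OF _ _ _ _ lim(2)])
    show "\<bar>g n x \<bullet> b - h x \<bullet> b\<bar> \<le> norm (g n x - h x)" for n x
      using Basis_le_norm[OF b, of "g n x - h x"] by (simp add: inner_diff_left)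
  qed (use i mm B in auto)
  moreover have "(\<lambda>n. LINT x|lebesgue_on \<Omega>. u n x * ?d x) = (\<lambda>n. - (LINT x|lebesgue_on \<Omega>. (g n x \<bullet> b) * \<phi> x))"
    using wg \<phi> b by (simp add: has_weak_gradient_def)
  ultimately show "(LINT x|lebesgue_on \<Omega>. v x * ?d x) = - (LINT x|lebesgue_on \<Omega>. (h x \<bullet> b) * \<phi> x)"
    using LIMSEQ_unique[OF _ tendsto_minus] by simp
qed

subsection \<open>The spaces and the flux\<close>

text \<open>Completeness: every subset of a Lebesgue null set is measurable, so values on a null set
  may be changed freely.\<close>

lemma borel_measurable_AE_lebesgue_on:
  fixes f g :: "'a::euclidean_space \<Rightarrow> 'b::euclidean_space"
  assumes f: "f \<in> borel_measurable (lebesgue_on \<Omega>)" and ae: "AE x in lebesgue_on \<Omega>. f x = g x"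
    and \<Omega>: "\<Omega> \<in> sets lebesgue"
  shows "g \<in> borel_measurable (lebesgue_on \<Omega>)"
proof (rule measurableI)
  have ae': "AE x in lebesgue. x \<in> \<Omega> \<longrightarrow> f x = g x"
    using ae \<Omega> by (simp add: AE_restrict_space_iff)
  then obtain N where N: "N \<in> null_sets lebesgue" "\<And>x. x \<in> space lebesgue - N \<Longrightarrow> x \<in> \<Omega> \<longrightarrow> f x = g x"
    by (rule AE_E3) blast
  fix S :: "'b set" assume S: "S \<in> sets borel"
  have "f -` S \<inter> \<Omega> \<in> sets lebesgue"
    using measurable_sets[OF f S] \<Omega> by (simp add: sets_restrict_space_iff)
  moreover have "g -` S \<inter> \<Omega> = ((f -` S \<inter> \<Omega>) - N) \<union> (g -` S \<inter> \<Omega> \<inter> N)"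
    using N(2) by auto
  moreover have "g -` S \<inter> \<Omega> \<inter> N \<in> sets lebesgue"
    using N(1) null_sets_completion_subset[of "g -` S \<inter> \<Omega> \<inter> N" N lborel] by (auto dest: null_setsD2)
  ultimately have "g -` S \<inter> \<Omega> \<in> sets lebesgue"
    using N(1) by (metis null_setsD2 sets.Diff sets.Un)
  then show "g -` S \<inter> space (lebesgue_on \<Omega>) \<in> sets (lebesgue_on \<Omega>)"
    using \<Omega> by (simp add: sets_restrict_space_iff)
qed simp

lemma borel_measurable_LIMSEQ_AE_lebesgue_on:
  fixes g :: "'a::euclidean_space \<Rightarrow> real"
  assumes f: "\<And>n. f n \<in> borel_measurable (lebesgue_on \<Omega>)"
    and ae: "AE x in lebesgue_on \<Omega>. (\<lambda>n. f n x) \<longlonglongrightarrow> g x" and \<Omega>: "\<Omega> \<in> sets lebesgue"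
  shows "g \<in> borel_measurable (lebesgue_on \<Omega>)"
proof (rule borel_measurable_AE_lebesgue_on[OF _ _ \<Omega>])
  show "(\<lambda>x. lim (\<lambda>n. f n x)) \<in> borel_measurable (lebesgue_on \<Omega>)"
    using f by (rule borel_measurable_lim_metric)
  show "AE x in lebesgue_on \<Omega>. lim (\<lambda>n. f n x) = g x"
    using ae by eventually_elim (rule limI)
qed

text \<open>Fatou's lemma for real integrals whose upper bounds may vary with \<open>n\<close>. It
  also yields integrability of the limit, which is how limits are shown to lie in the
  spaces.\<close>

lemma Fatou_real:
  fixes f :: "nat \<Rightarrow> 'a \<Rightarrow> real"
  assumes f: "\<And>n. integrable M (f n)" "\<And>n. AE x in M. 0 \<le> f n x"
    and lim: "AE x in M. (\<lambda>n. f n x) \<longlonglongrightarrow> g x" and g: "g \<in> borel_measurable M"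
    and bd: "\<And>n. (LINT x|M. f n x) \<le> c n" and c: "c \<longlonglongrightarrow> C"
  shows "integrable M g" "(LINT x|M. g x) \<le> C"
proof -
  note [measurable] = borel_measurable_integrable[OF f(1)] g
  have f0: "AE x in M. \<forall>n. 0 \<le> f n x" using f(2) by (simp add: AE_all_countable)
  have g0: "AE x in M. 0 \<le> g x"
    using lim f0 by eventually_elim (auto intro: LIMSEQ_le_const)
  have eq: "(\<integral>\<^sup>+x. f n x \<partial>M) = ennreal (LINT x|M. f n x)" for n
    using f by (intro nn_integral_eq_integral)
  have C0: "0 \<le> C"
  proof (rule LIMSEQ_le_const[OF c])
    show "\<exists>N. \<forall>n\<ge>N. 0 \<le> c n"
      using order_trans[OF integral_nonneg_AE[OF f(2)] bd] by blast
  qed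
  have "(\<integral>\<^sup>+x. g x \<partial>M) = (\<integral>\<^sup>+x. liminf (\<lambda>n. ennreal (f n x)) \<partial>M)"
  proof (rule nn_integral_cong_AE)
    show "AE x in M. ennreal (g x) = liminf (\<lambda>n. ennreal (f n x))"
      using lim by eventually_elim (metis lim_imp_Liminf sequentially_bot tendsto_ennrealI)
  qed
  also have "\<dots> \<le> liminf (\<lambda>n. \<integral>\<^sup>+x. f n x \<partial>M)"
    by (rule nn_integral_liminf) measurable
  also have "\<dots> \<le> liminf (\<lambda>n. ennreal (c n))"
    unfolding eq using bd by (intro Liminf_mono always_eventually allI ennreal_leI)
  also have "\<dots> = ennreal C"
    by (rule lim_imp_Liminf) (use c in \<open>auto intro: tendsto_ennrealI\<close>)
  finally have le: "(\<integral>\<^sup>+x. g x \<partial>M) \<le> ennreal C" .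
  have "(\<integral>\<^sup>+x. norm (g x) \<partial>M) = (\<integral>\<^sup>+x. g x \<partial>M)"
    by (rule nn_integral_cong_AE) (use g0 in eventually_elim, simp)
  then show i: "integrable M g"
    using le by (intro integrableI_bounded) (auto simp: less_top[symmetric] top_unique)
  have "ennreal (LINT x|M. g x) \<le> ennreal C"
    using nn_integral_eq_integral[OF i g0] le by simp
  then show "(LINT x|M. g x) \<le> C" using C0 by (simp add: ennreal_le_iff)
qed

section \<open>The radial potential and its subgradient\<close>

definition regular_flux :: "('a \<Rightarrow> real \<Rightarrow> real) \<Rightarrow> 'a \<Rightarrow> bool" where
  "regular_flux \<Psi> x \<longleftrightarrow> continuous_on {0..} (flux_modulus \<Psi> x) \<and> mono_on {0..} (flux_modulus \<Psi> x)"

context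
  fixes \<Psi> :: "'a::euclidean_space \<Rightarrow> real \<Rightarrow> real" and x :: 'a
  assumes reg: "regular_flux \<Psi> x"
begin

lemma flux_modulus_0: "flux_modulus \<Psi> x 0 = 0"
  by (simp add: flux_modulus_def)

lemma flux_modulus_mono: "0 \<le> a \<Longrightarrow> a \<le> b \<Longrightarrow> flux_modulus \<Psi> x a \<le> flux_modulus \<Psi> x b"
  using reg by (auto simp: regular_flux_def mono_on_def)

lemma flux_modulus_nonneg: "0 \<le> a \<Longrightarrow> 0 \<le> flux_modulus \<Psi> x a"
  using flux_modulus_mono[of 0 a] by (simp add: flux_modulus_0)

definition flux_primitive :: "real \<Rightarrow> real" where
  "flux_primitive r = (LINT s:{0..r}|lborel. flux_modulus \<Psi> x s)"

lemma flux_primitive_bounds: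
  assumes "0 \<le> a" "a \<le> b"
  shows "(b - a) * flux_modulus \<Psi> x a \<le> flux_primitive b - flux_primitive a"
    and "flux_primitive b - flux_primitive a \<le> (b - a) * flux_modulus \<Psi> x b"
proof -
  let ?f = "flux_modulus \<Psi> x"
  have c: "continuous_on {c..d} ?f" if "0 \<le> c" for c d
    using reg that by (auto simp: regular_flux_def intro: continuous_on_subset)
  have i: "?f integrable_on {c..d}" if "0 \<le> c" for c d
    using c[OF that] by (rule integrable_continuous_real)
  have e: "flux_primitive r = integral {0..r} ?f" for r
    unfolding flux_primitive_def
    by (rule set_borel_integral_eq_integral(2)[OF borel_integrable_atLeastAtMost'[OF c]]) simp
  have eq: "flux_primitive b - flux_primitive a = integral {a..b} ?f"
    using Henstock_Kurzweil_Integration.integral_combine[of 0 a b ?f] assms i[of 0 b] by (simp add: e)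
  have "integral {a..b} (\<lambda>_. ?f a) \<le> integral {a..b} ?f"
    using assms i[of a b] by (intro integral_le) (auto intro: flux_modulus_mono)
  moreover have "integral {a..b} ?f \<le> integral {a..b} (\<lambda>_. ?f b)"
    using assms i[of a b] by (intro integral_le) (auto intro: flux_modulus_mono)
  ultimately show "(b - a) * ?f a \<le> flux_primitive b - flux_primitive a" "flux_primitive b - flux_primitive a \<le> (b - a) * ?f b"
    using assms eq by simp_all
qed

lemma flux_potential_eq: "flux_potential \<Psi> x \<xi> = flux_primitive (norm \<xi>)"
  by (simp add: flux_potential_def flux_primitive_def)

lemma flux_primitive_0: "flux_primitive 0 = 0"
proof -
  have "indicator {0..0} s *\<^sub>R flux_modulus \<Psi> x s = 0" for s :: real
    by (cases "s = 0") (auto simp: flux_modulus_0)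
  then show ?thesis unfolding flux_primitive_def set_lebesgue_integral_def by (simp only: integral_zero)
qed

lemma flux_potential_nonneg: "0 \<le> flux_potential \<Psi> x \<xi>"
  using flux_primitive_bounds(1)[of 0 "norm \<xi>"] by (simp add: flux_primitive_0 flux_modulus_0 flux_potential_eq)

lemma flux_potential_le: "flux_potential \<Psi> x \<xi> \<le> flux_modulus \<Psi> x (norm \<xi>) * norm \<xi>"
  using flux_primitive_bounds(2)[of 0 "norm \<xi>"] by (simp add: flux_primitive_0 flux_potential_eq mult.commute)

lemma flux_potential_mono:
  assumes "norm \<xi> \<le> norm \<eta>"
  shows "flux_potential \<Psi> x \<xi> \<le> flux_potential \<Psi> x \<eta>"
proof -
  have "0 \<le> (norm \<eta> - norm \<xi>) * flux_modulus \<Psi> x (norm \<xi>)"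
    using assms by (intro mult_nonneg_nonneg flux_modulus_nonneg) auto
  with flux_primitive_bounds(1)[of "norm \<xi>" "norm \<eta>"] assms show ?thesis
    by (simp add: flux_potential_eq)
qed

lemma flux_eq: "flux \<Psi> x \<xi> = flux_modulus \<Psi> x (norm \<xi>) *\<^sub>R sgn \<xi>"
  by (simp add: flux_def flux_modulus_def sgn_div_norm)

lemma norm_flux: "norm (flux \<Psi> x \<xi>) = flux_modulus \<Psi> x (norm \<xi>)"
  using flux_modulus_nonneg[of "norm \<xi>"] by (cases "\<xi> = 0") (simp_all add: flux_eq norm_sgn flux_modulus_0)

lemma flux_inner_self: "flux \<Psi> x \<xi> \<bullet> \<xi> = flux_modulus \<Psi> x (norm \<xi>) * norm \<xi>"
  by (cases "\<xi> = 0")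
    (simp_all add: flux_eq sgn_div_norm power2_norm_eq_inner[symmetric] power2_eq_square flux_modulus_0)

text \<open>The potential is an increasing convex function of the norm. Cauchy-Schwarz reduces the
  claim to the tangent inequality in one dimension, which is \<open>flux_primitive_bounds\<close> in
  two cases. Convexity and continuity of the potential and monotonicity of the flux are all derived
  from this inequality.\<close>

lemma flux_subgradient:
  "flux_potential \<Psi> x \<xi> + flux \<Psi> x \<xi> \<bullet> (\<eta> - \<xi>) \<le> flux_potential \<Psi> x \<eta>"
proof -
  have "flux \<Psi> x \<xi> \<bullet> (\<eta> - \<xi>) \<le> flux_modulus \<Psi> x (norm \<xi>) * (norm \<eta> - norm \<xi>)"
    using norm_cauchy_schwarz[of "flux \<Psi> x \<xi>" \<eta>]
    by (simp add: norm_flux flux_inner_self inner_diff_right right_diff_distrib)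
  also have "\<dots> \<le> flux_primitive (norm \<eta>) - flux_primitive (norm \<xi>)"
  proof (cases "norm \<xi> \<le> norm \<eta>")
    case True
    then show ?thesis using flux_primitive_bounds(1)[of "norm \<xi>" "norm \<eta>"] by (simp add: mult.commute)
  next
    case False
    then show ?thesis using flux_primitive_bounds(2)[of "norm \<eta>" "norm \<xi>"] by (simp add: algebra_simps)
  qed
  finally show ?thesis by (simp add: flux_potential_eq)
qed

lemma flux_monotone: "0 \<le> (flux \<Psi> x \<xi> - flux \<Psi> x \<eta>) \<bullet> (\<xi> - \<eta>)"
  using flux_subgradient[of \<xi> \<eta>] flux_subgradient[of \<eta> \<xi>]
  by (simp add: inner_diff_left inner_diff_right)

lemma tendsto_flux_modulus:
  assumes "(r \<longlongrightarrow> s) F" "\<And>n. 0 \<le> r n" "0 \<le> s"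
  shows "((\<lambda>n. flux_modulus \<Psi> x (r n)) \<longlongrightarrow> flux_modulus \<Psi> x s) F"
  by (rule continuous_on_tendsto_compose[of "{0..}"]) (use reg assms in \<open>auto simp: regular_flux_def\<close>)

text \<open>At 0 the direction \<open>sgn\<close> is discontinuous, but there the modulus tends to
  0.\<close>

lemma tendsto_flux:
  assumes "(r \<longlongrightarrow> \<xi>) F"
  shows "((\<lambda>n. flux \<Psi> x (r n)) \<longlongrightarrow> flux \<Psi> x \<xi>) F"
proof -
  have m: "((\<lambda>n. flux_modulus \<Psi> x (norm (r n))) \<longlongrightarrow> flux_modulus \<Psi> x (norm \<xi>)) F"
    by (rule tendsto_flux_modulus) (use assms in \<open>auto intro: tendsto_norm\<close>)
  show ?thesis
  proof (cases "\<xi> = 0")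
    case True
    then have "((\<lambda>n. norm (flux \<Psi> x (r n))) \<longlongrightarrow> 0) F"
      using m by (simp add: norm_flux flux_modulus_0)
    then show ?thesis using True by (simp add: tendsto_norm_zero_iff flux_def)
  next
    case False
    show ?thesis unfolding flux_eq
      by (intro tendsto_scaleR m tendsto_sgn assms False)
  qed
qed

text \<open>The subgradient inequalities at the two points bound the difference of the values by the
  moduli times the distance.\<close>

lemma tendsto_flux_potential:
  assumes "r \<longlonglongrightarrow> \<xi>"
  shows "(\<lambda>n. flux_potential \<Psi> x (r n)) \<longlonglongrightarrow> flux_potential \<Psi> x \<xi>"
proof -
  have "\<bar>flux_potential \<Psi> x \<zeta> - flux_potential \<Psi> x \<xi>\<bar> \<le>
      (flux_modulus \<Psi> x (norm \<zeta>) + flux_modulus \<Psi> x (norm \<xi>)) * norm (\<zeta> - \<xi>)" for \<zeta>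
  proof -
    have "\<bar>flux \<Psi> x \<xi> \<bullet> (\<zeta> - \<xi>)\<bar> \<le> flux_modulus \<Psi> x (norm \<xi>) * norm (\<zeta> - \<xi>)"
      using Cauchy_Schwarz_ineq2[of "flux \<Psi> x \<xi>" "\<zeta> - \<xi>"] by (simp add: norm_flux)
    moreover have "\<bar>flux \<Psi> x \<zeta> \<bullet> (\<xi> - \<zeta>)\<bar> \<le> flux_modulus \<Psi> x (norm \<zeta>) * norm (\<zeta> - \<xi>)"
      using Cauchy_Schwarz_ineq2[of "flux \<Psi> x \<zeta>" "\<xi> - \<zeta>"] by (simp add: norm_flux norm_minus_commute)
    moreover have "0 \<le> flux_modulus \<Psi> x (norm \<xi>) * norm (\<zeta> - \<xi>)" "0 \<le> flux_modulus \<Psi> x (norm \<zeta>) * norm (\<zeta> - \<xi>)"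
      by (auto intro!: mult_nonneg_nonneg flux_modulus_nonneg)
    ultimately show ?thesis
      using flux_subgradient[of \<xi> \<zeta>] flux_subgradient[of \<zeta> \<xi>] by (simp add: distrib_right)
  qed
  note le = this
  have m: "(\<lambda>n. flux_modulus \<Psi> x (norm (r n))) \<longlonglongrightarrow> flux_modulus \<Psi> x (norm \<xi>)"
    by (rule tendsto_flux_modulus) (use assms in \<open>auto intro: tendsto_norm\<close>)
  have d: "(\<lambda>n. norm (r n - \<xi>)) \<longlonglongrightarrow> 0"
    using assms by (simp add: LIM_zero tendsto_norm_zero)
  have "(\<lambda>n. (flux_modulus \<Psi> x (norm (r n)) + flux_modulus \<Psi> x (norm \<xi>)) * norm (r n - \<xi>)) \<longlonglongrightarrow>
     (flux_modulus \<Psi> x (norm \<xi>) + flux_modulus \<Psi> x (norm \<xi>)) * 0"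
    by (intro tendsto_mult tendsto_add m d tendsto_const)
  then have 0: "(\<lambda>n. (flux_modulus \<Psi> x (norm (r n)) + flux_modulus \<Psi> x (norm \<xi>)) * norm (r n - \<xi>)) \<longlonglongrightarrow> 0"
    by simp
  show ?thesis
    by (rule LIM_zero_cancel, rule tendsto_rabs_zero_cancel, rule tendsto_sandwich[OF _ _ tendsto_const 0])
      (use le in auto)
qed

text \<open>Serves measurability: the growth hypothesis makes
  \<open>flux_modulus \<Psi> x (v x)\<close> measurable for suitable functions \<open>v\<close>, so
  the integral defining the potential is approximated by sums of such terms.\<close>

lemma flux_primitive_Riemann:
  assumes r: "0 \<le> r"
  shows "(\<lambda>n. \<Sum>k<Suc n. (r / Suc n) * flux_modulus \<Psi> x (real (Suc k) / Suc n * r)) \<longlonglongrightarrow> flux_primitive r"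
proof -
  let ?f = "flux_modulus \<Psi> x"
  let ?S = "\<lambda>n. \<Sum>k<Suc n. (r / Suc n) * ?f (real (Suc k) / Suc n * r)"
  have bd: "flux_primitive r \<le> ?S n \<and> ?S n \<le> flux_primitive r + (r / Suc n) * ?f r" for n
  proof -
    let ?N = "real (Suc n)"
    define b where "b k = real k / ?N * r" for k
    have b: "0 \<le> b k" "b (Suc k) - b k = r / ?N" for k
      using r by (simp_all add: b_def add_divide_distrib distrib_right)
    have bS: "b k \<le> b (Suc k)" for k
      using b(2)[of k] divide_nonneg_nonneg[OF r, of ?N] by linarith
    have b0: "b 0 = 0" and bn: "b (Suc n) = r" by (simp_all add: b_def del: of_nat_Suc)
    have "flux_primitive r = (\<Sum>k<Suc n. flux_primitive (b (Suc k)) - flux_primitive (b k))"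
      using sum_lessThan_telescope[of "\<lambda>k. flux_primitive (b k)" "Suc n"] b0 bn by (simp add: flux_primitive_0)
    moreover have "(\<Sum>k<Suc n. flux_primitive (b (Suc k)) - flux_primitive (b k)) \<le> (\<Sum>k<Suc n. (r / ?N) * ?f (b (Suc k)))"
      by (rule sum_mono) (use flux_primitive_bounds(2)[OF b(1) bS] b(2) in simp)
    moreover have "(\<Sum>k<Suc n. (r / ?N) * ?f (b k)) \<le> (\<Sum>k<Suc n. flux_primitive (b (Suc k)) - flux_primitive (b k))"
      by (rule sum_mono) (use flux_primitive_bounds(1)[OF b(1) bS] b(2) in simp)
    \<comment> \<open>The difference of upper and lower sum telescopes to one mesh width times the
      value at the right end.\<close>
    moreover have "(\<Sum>k<Suc n. (r / ?N) * ?f (b (Suc k))) - (\<Sum>k<Suc n. (r / ?N) * ?f (b k)) = (r / ?N) * ?f r"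
    proof -
      have "(\<Sum>k<Suc n. ?f (b (Suc k)) - ?f (b k)) = ?f r"
        using sum_lessThan_telescope[of "\<lambda>k. ?f (b k)" "Suc n"] b0 bn by (simp add: flux_modulus_0)
      then show ?thesis
        unfolding sum_subtractf[symmetric] right_diff_distrib[symmetric] sum_distrib_left[symmetric] by simp
    qed
    ultimately show ?thesis unfolding b_def by linarith
  qed
  have 0: "(\<lambda>n. flux_primitive r + (r / real (Suc n)) * ?f r) \<longlonglongrightarrow> flux_primitive r + 0 * ?f r"
    unfolding divide_inverse
    by (intro tendsto_add tendsto_mult_left_zero tendsto_mult tendsto_const tendsto_mult_right_zero LIMSEQ_inverse_real_of_nat)
  show ?thesis
    by (rule tendsto_sandwich[OF _ _ tendsto_const]) (use bd 0 in auto)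
qed

end

section \<open>Integrability in the variable exponent setting\<close>

locale flux_setting =
  fixes \<Omega> :: "'a::euclidean_space set" and p :: "'a \<Rightarrow> real" and \<Psi> :: "'a \<Rightarrow> real \<Rightarrow> real"
    and q P \<delta> \<delta>' :: real
  assumes open_domain: "open \<Omega>" and bounded_domain: "bounded \<Omega>"
    and p_measurable: "p \<in> borel_measurable (lebesgue_on \<Omega>)"
    and p_lower: "\<And>x. x \<in> \<Omega> \<Longrightarrow> q \<le> p x" and p_upper: "\<And>x. x \<in> \<Omega> \<Longrightarrow> p x \<le> P" and q_gt_1: "1 < q"
    and regular: "AE x in lebesgue_on \<Omega>. regular_flux \<Psi> x"
    and growth: "\<And>v. v \<in> Lvar \<Omega> p \<Longrightarrow> (\<lambda>x. flux_modulus \<Psi> x (v x)) \<in> Lvar \<Omega> (conj_exponent p)"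
    and delta_pos: "\<delta> > 0"
    and coercive: "\<And>v. v \<in> W1var \<Omega> p \<Longrightarrow>
      (LINT x|lebesgue_on \<Omega>. flux_potential \<Psi> x (weak_grad \<Omega> v x))
        \<ge> \<delta> * (LINT x|lebesgue_on \<Omega>. norm (weak_grad \<Omega> v x) powr p x) - \<delta>'"
begin

abbreviation M :: "'a measure" where "M \<equiv> lebesgue_on \<Omega>"

lemma domain_sets: "\<Omega> \<in> sets lebesgue"
  using open_domain by simp

sublocale finite_measure M
  by (rule finite_measure_lebesgue_on) (simp add: bounded_domain open_domain lmeasurable_open)

lemmas measurable_LIMSEQ_AE = borel_measurable_LIMSEQ_AE_lebesgue_on[OF _ _ domain_sets]

declare p_measurable [measurable]

lemma Lvar_measurable: "u \<in> Lvar \<Omega> r \<Longrightarrow> u \<in> borel_measurable M"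
  by (simp add: Lvar_def)

lemma Lvar_bound:
  assumes u: "u \<in> Lvar \<Omega> p" and v: "v \<in> borel_measurable M" and le: "AE x in M. \<bar>v x\<bar> \<le> \<bar>u x\<bar>"
  shows "v \<in> Lvar \<Omega> p"
proof -
  have "integrable M (\<lambda>x. \<bar>v x\<bar> powr p x)"
  proof (rule Bochner_Integration.integrable_bound[of M "\<lambda>x. \<bar>u x\<bar> powr p x"])
    show "AE x in M. norm (\<bar>v x\<bar> powr p x) \<le> norm (\<bar>u x\<bar> powr p x)"
      using le AE_space
    proof eventually_elim
      case (elim x)
      have "0 \<le> p x" using p_lower[of x] q_gt_1 elim(2) by simp
      with elim show ?case by (simp add: powr_mono2)
    qed
  qed (use u v in \<open>auto simp: Lvar_def\<close>)
  with v show ?thesis by (simp add: Lvar_def)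
qed

text \<open>The sum is at most twice the larger term, and \<open>2 powr P\<close> is a uniform
  constant because \<open>p\<close> is bounded above by \<open>P\<close>.\<close>

lemma Lvar_add:
  assumes u: "u \<in> Lvar \<Omega> p" and v: "v \<in> Lvar \<Omega> p"
  shows "(\<lambda>x. \<bar>u x\<bar> + \<bar>v x\<bar>) \<in> Lvar \<Omega> p"
proof -
  have [measurable]: "u \<in> borel_measurable M" "v \<in> borel_measurable M"
    using u v by (auto simp: Lvar_def)
  have "integrable M (\<lambda>x. \<bar>\<bar>u x\<bar> + \<bar>v x\<bar>\<bar> powr p x)"
  proof (rule Bochner_Integration.integrable_bound[of M "\<lambda>x. 2 powr P * (\<bar>u x\<bar> powr p x + \<bar>v x\<bar> powr p x)"])
    show "AE x in M. norm (\<bar>\<bar>u x\<bar> + \<bar>v x\<bar>\<bar> powr p x) \<le> norm (2 powr P * (\<bar>u x\<bar> powr p x + \<bar>v x\<bar> powr p x))"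
    proof (rule AE_I2)
      fix x assume "x \<in> space M"
      then have x: "0 \<le> p x" "p x \<le> P" using p_lower[of x] p_upper[of x] q_gt_1 by auto
      let ?m = "max \<bar>u x\<bar> \<bar>v x\<bar>"
      have "(\<bar>u x\<bar> + \<bar>v x\<bar>) powr p x \<le> (2 * ?m) powr p x"
        by (rule powr_mono2) (use x in auto)
      also have "\<dots> = 2 powr p x * ?m powr p x" by (simp add: powr_mult)
      also have "\<dots> \<le> 2 powr P * (\<bar>u x\<bar> powr p x + \<bar>v x\<bar> powr p x)"
        using x by (intro mult_mono powr_mono) (auto simp: max_def)
      finally show "norm (\<bar>\<bar>u x\<bar> + \<bar>v x\<bar>\<bar> powr p x) \<le> norm (2 powr P * (\<bar>u x\<bar> powr p x + \<bar>v x\<bar> powr p x))"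
        by simp
    qed
  qed (use u v in \<open>auto simp: Lvar_def\<close>)
  then show ?thesis by (simp add: Lvar_def)
qed

lemma Lvar_scale:
  assumes u: "u \<in> Lvar \<Omega> p"
  shows "(\<lambda>x. c * u x) \<in> Lvar \<Omega> p"
proof -
  have [measurable]: "u \<in> borel_measurable M" using u by (auto simp: Lvar_def)
  have "integrable M (\<lambda>x. \<bar>c * u x\<bar> powr p x)"
  proof (rule Bochner_Integration.integrable_bound[of M "\<lambda>x. (1 + \<bar>c\<bar>) powr P * \<bar>u x\<bar> powr p x"])
    show "AE x in M. norm (\<bar>c * u x\<bar> powr p x) \<le> norm ((1 + \<bar>c\<bar>) powr P * \<bar>u x\<bar> powr p x)"
    proof (rule AE_I2)
      fix x assume "x \<in> space M"
      then have x: "0 \<le> p x" "p x \<le> P" using p_lower[of x] p_upper[of x] q_gt_1 by auto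
      have "\<bar>c\<bar> powr p x \<le> (1 + \<bar>c\<bar>) powr p x" by (rule powr_mono2) (use x in auto)
      also have "\<dots> \<le> (1 + \<bar>c\<bar>) powr P" by (rule powr_mono) (use x in auto)
      finally show "norm (\<bar>c * u x\<bar> powr p x) \<le> norm ((1 + \<bar>c\<bar>) powr P * \<bar>u x\<bar> powr p x)"
        by (simp add: abs_mult powr_mult mult_right_mono)
    qed
  qed (use u in \<open>auto simp: Lvar_def\<close>)
  then show ?thesis by (simp add: Lvar_def)
qed

lemma Lvar_bounded:
  assumes v [measurable]: "v \<in> borel_measurable M" and le: "AE x in M. \<bar>v x\<bar> \<le> C"
  shows "v \<in> Lvar \<Omega> p"
proof (rule Lvar_bound[OF _ v])
  have "integrable M (\<lambda>x. \<bar>1 :: real\<bar> powr p x)" by simp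
  then have "(\<lambda>x. 1) \<in> Lvar \<Omega> p" by (simp add: Lvar_def)
  from Lvar_scale[OF this, of C] show "(\<lambda>x. C * 1) \<in> Lvar \<Omega> p" .
  show "AE x in M. \<bar>v x\<bar> \<le> \<bar>C * 1\<bar>" using le by eventually_elim simp
qed

lemma powr_ge_linear: "x \<in> \<Omega> \<Longrightarrow> 0 \<le> t \<Longrightarrow> t \<le> 1 + t powr p x"
  using powr_mono[of 1 "p x" t] p_lower[of x] q_gt_1 by (cases "t \<le> 1") (auto intro: add_increasing2)

lemma Lvar_integrable:
  assumes u: "u \<in> Lvar \<Omega> p"
  shows "integrable M u"
proof (rule Bochner_Integration.integrable_bound[of M "\<lambda>x. 1 + \<bar>u x\<bar> powr p x"])
  show "AE x in M. norm (u x) \<le> norm (1 + \<bar>u x\<bar> powr p x)"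
    using powr_ge_linear by (intro AE_I2) (simp add: add_nonneg_nonneg)
qed (use u in \<open>auto simp: Lvar_def\<close>)

text \<open>The factors \<open>1 / p'\<close> and \<open>1 / p\<close> of Young's inequality are
  below 1 and are dropped.\<close>

lemma Young:
  assumes "x \<in> \<Omega>" "0 \<le> a" "0 \<le> b"
  shows "a * b \<le> a powr conj_exponent p x + b powr p x"
proof -
  have p: "1 < p x" using p_lower[OF assms(1)] q_gt_1 by simp
  define p' where "p' = conj_exponent p x"
  have p': "1 < p'" "1 / p' + 1 / p x = 1"
    using p by (simp_all add: p'_def conj_exponent_def divide_simps)
  have "a * b \<le> a powr p' / p' + b powr p x / p x"
    by (rule Youngs_inequality) (use p p' assms in auto)
  also have "\<dots> \<le> a powr p' + b powr p x"
    using p p' mult_left_mono[of 1 p' "a powr p'"] mult_left_mono[of 1 "p x" "b powr p x"]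
    by (intro add_mono) (simp_all add: divide_le_eq)
  finally show ?thesis by (simp add: p'_def)
qed

lemma integrable_Young:
  assumes w: "w \<in> Lvar \<Omega> (conj_exponent p)" and v: "v \<in> Lvar \<Omega> p"
  shows "integrable M (\<lambda>x. \<bar>w x\<bar> * \<bar>v x\<bar>)"
proof (rule Bochner_Integration.integrable_bound[of M "\<lambda>x. \<bar>w x\<bar> powr conj_exponent p x + \<bar>v x\<bar> powr p x"])
  show "AE x in M. norm (\<bar>w x\<bar> * \<bar>v x\<bar>) \<le> norm (\<bar>w x\<bar> powr conj_exponent p x + \<bar>v x\<bar> powr p x)"
  proof (rule AE_I2)
    fix x assume "x \<in> space M"
    then show "norm (\<bar>w x\<bar> * \<bar>v x\<bar>) \<le> norm (\<bar>w x\<bar> powr conj_exponent p x + \<bar>v x\<bar> powr p x)"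
      using Young[of x "\<bar>w x\<bar>" "\<bar>v x\<bar>"] by (simp add: abs_mult)
  qed
qed (use w v in \<open>auto simp: Lvar_def\<close>)

text \<open>The basic domination for flux and potential: the growth hypothesis puts the modulus into
  the conjugate space, and Young's inequality pairs it with \<open>v\<close>.\<close>

lemma integrable_growth:
  assumes "u \<in> Lvar \<Omega> p" "v \<in> Lvar \<Omega> p"
  shows "integrable M (\<lambda>x. flux_modulus \<Psi> x (\<bar>u x\<bar>) * \<bar>v x\<bar>)"
proof -
  have u: "(\<lambda>x. \<bar>u x\<bar>) \<in> Lvar \<Omega> p" using assms(1) by (auto simp: Lvar_def)
  have i: "integrable M (\<lambda>x. \<bar>flux_modulus \<Psi> x (\<bar>u x\<bar>)\<bar> * \<bar>v x\<bar>)"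
    by (rule integrable_Young[OF growth[OF u] assms(2)])
  show ?thesis
    by (rule Bochner_Integration.integrable_bound[OF i])
      (use Lvar_measurable[OF growth[OF u]] Lvar_measurable[OF assms(2)] in \<open>auto simp: abs_mult\<close>)
qed

text \<open>The modulus at the norm of \<open>G\<close> is measurable by the growth hypothesis, and
  the direction is a Borel function of \<open>G\<close>.\<close>

lemma flux_measurable:
  assumes G: "G \<in> borel_measurable M" "(\<lambda>x. norm (G x)) \<in> Lvar \<Omega> p"
  shows "(\<lambda>x. flux \<Psi> x (G x)) \<in> borel_measurable M"
proof -
  have [measurable]: "(\<lambda>x. flux_modulus \<Psi> x (norm (G x))) \<in> borel_measurable M" "G \<in> borel_measurable M"
    using Lvar_measurable[OF growth[OF G(2)]] G by auto
  have "flux \<Psi> x (G x) = flux_modulus \<Psi> x (norm (G x)) *\<^sub>R sgn (G x)" for x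
    by (simp add: flux_def flux_modulus_def sgn_div_norm)
  then show ?thesis by (simp add: sgn_div_norm)
qed

lemma flux_integrable:
  assumes G: "G \<in> borel_measurable M" "(\<lambda>x. norm (G x)) \<in> Lvar \<Omega> p"
    and H: "H \<in> borel_measurable M" "(\<lambda>x. norm (H x)) \<in> Lvar \<Omega> p"
  shows "integrable M (\<lambda>x. flux \<Psi> x (G x) \<bullet> H x)"
proof (rule Bochner_Integration.integrable_bound[OF integrable_growth[OF G(2) H(2)]])
  show "(\<lambda>x. flux \<Psi> x (G x) \<bullet> H x) \<in> borel_measurable M"
    using flux_measurable[OF G] H(1) by measurable
  show "AE x in M. norm (flux \<Psi> x (G x) \<bullet> H x) \<le> norm (flux_modulus \<Psi> x \<bar>norm (G x)\<bar> * \<bar>norm (H x)\<bar>)"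
    using regular
  proof eventually_elim
    case (elim x)
    show ?case
      using Cauchy_Schwarz_ineq2[of "flux \<Psi> x (G x)" "H x"] flux_modulus_nonneg[OF elim, of "norm (G x)"]
      by (simp add: norm_flux[OF elim] abs_mult)
  qed
qed

lemma flux_potential_measurable:
  assumes G: "G \<in> borel_measurable M" "(\<lambda>x. norm (G x)) \<in> Lvar \<Omega> p"
  shows "(\<lambda>x. flux_potential \<Psi> x (G x)) \<in> borel_measurable M"
proof (rule measurable_LIMSEQ_AE)
  have [measurable]: "(\<lambda>x. flux_modulus \<Psi> x (c * norm (G x))) \<in> borel_measurable M" for c
    by (rule Lvar_measurable[OF growth[OF Lvar_scale[OF G(2)]]])
  note [measurable] = G(1)
  show "(\<lambda>x. \<Sum>k<Suc n. (norm (G x) / Suc n) * flux_modulus \<Psi> x (real (Suc k) / Suc n * norm (G x))) \<in> borel_measurable M" for n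
    by measurable
  show "AE x in M. (\<lambda>n. \<Sum>k<Suc n. (norm (G x) / Suc n) * flux_modulus \<Psi> x (real (Suc k) / Suc n * norm (G x)))
      \<longlonglongrightarrow> flux_potential \<Psi> x (G x)"
    using regular
  proof eventually_elim
    case (elim x)
    show ?case unfolding flux_potential_eq[OF elim] by (rule flux_primitive_Riemann[OF elim]) simp
  qed
qed

lemma flux_potential_integrable:
  assumes G: "G \<in> borel_measurable M" "(\<lambda>x. norm (G x)) \<in> Lvar \<Omega> p"
  shows "integrable M (\<lambda>x. flux_potential \<Psi> x (G x))"
proof (rule Bochner_Integration.integrable_bound[OF integrable_growth[OF G(2) G(2)] flux_potential_measurable[OF G]])
  show "AE x in M. norm (flux_potential \<Psi> x (G x)) \<le> norm (flux_modulus \<Psi> x \<bar>norm (G x)\<bar> * \<bar>norm (G x)\<bar>)"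
    using regular
  proof eventually_elim
    case (elim x)
    show ?case
      using flux_potential_nonneg[OF elim, of "G x"] flux_potential_le[OF elim, of "G x"] by simp
  qed
qed

text \<open>The energy controls \<open>u\<close> in \<open>L\<^sup>2\<close> only, so the minimisation takes place in a space that does not
  ask for \<open>u \<in> Lvar \<Omega> p\<close>; this is recovered from \<open>0 \<le> u \<le> 1\<close>.\<close>

definition Y :: "('a \<Rightarrow> real) \<Rightarrow> ('a \<Rightarrow> 'a) \<Rightarrow> bool" where
  "Y u G \<longleftrightarrow> u \<in> borel_measurable M \<and> integrable M (\<lambda>x. (u x)\<^sup>2) \<and> has_weak_gradient \<Omega> u G \<and>
     G \<in> borel_measurable M \<and> (\<lambda>x. norm (G x)) \<in> Lvar \<Omega> p"

lemma YD:
  assumes "Y u G"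
  shows "u \<in> borel_measurable M" "integrable M (\<lambda>x. (u x)\<^sup>2)" "has_weak_gradient \<Omega> u G"
    "G \<in> borel_measurable M" "(\<lambda>x. norm (G x)) \<in> Lvar \<Omega> p"
  using assms by (auto simp: Y_def)

lemma integrable_product:
  assumes [measurable]: "u \<in> borel_measurable M" "v \<in> borel_measurable M"
    and "integrable M (\<lambda>x. (u x :: real)\<^sup>2)" "integrable M (\<lambda>x. (v x)\<^sup>2)"
  shows "integrable M (\<lambda>x. u x * v x)"
proof (rule Bochner_Integration.integrable_bound[of M "\<lambda>x. (u x)\<^sup>2 + (v x)\<^sup>2"])
  have "\<bar>u x * v x\<bar> \<le> (u x)\<^sup>2 + (v x)\<^sup>2" for x
  proof -
    have "0 \<le> \<bar>u x\<bar> * \<bar>v x\<bar>" by simp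
    then show ?thesis
      using sum_squares_bound[of "\<bar>u x\<bar>" "\<bar>v x\<bar>"] unfolding abs_mult power2_abs by linarith
  qed
  then show "AE x in M. norm (u x * v x) \<le> norm ((u x)\<^sup>2 + (v x)\<^sup>2)" by simp
qed (use assms in auto)

lemma Y_lincomb:
  assumes u: "Y u G" and v: "Y v H"
  shows "Y (\<lambda>x. a * u x + b * v x) (\<lambda>x. a *\<^sub>R G x + b *\<^sub>R H x)"
proof -
  note [measurable] = YD(1,4)[OF u] YD(1,4)[OF v]
  have "integrable M (\<lambda>x. a\<^sup>2 * (u x)\<^sup>2 + 2 * a * b * (u x * v x) + b\<^sup>2 * (v x)\<^sup>2)"
    using YD(2)[OF u] YD(2)[OF v] integrable_product[OF YD(1)[OF u] YD(1)[OF v] YD(2)[OF u] YD(2)[OF v]] by simp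
  also have "(\<lambda>x. a\<^sup>2 * (u x)\<^sup>2 + 2 * a * b * (u x * v x) + b\<^sup>2 * (v x)\<^sup>2) = (\<lambda>x. (a * u x + b * v x)\<^sup>2)"
    by (simp add: fun_eq_iff power2_eq_square algebra_simps)
  finally have i: "integrable M (\<lambda>x. (a * u x + b * v x)\<^sup>2)" .
  have "(\<lambda>x. norm (a *\<^sub>R G x + b *\<^sub>R H x)) \<in> Lvar \<Omega> p"
  proof (rule Lvar_bound[OF Lvar_add[OF Lvar_scale[OF YD(5)[OF u], of a] Lvar_scale[OF YD(5)[OF v], of b]]])
    show "AE x in M. \<bar>norm (a *\<^sub>R G x + b *\<^sub>R H x)\<bar> \<le> \<bar>\<bar>a * norm (G x)\<bar> + \<bar>b * norm (H x)\<bar>\<bar>"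
      using norm_triangle_ineq[of "a *\<^sub>R G _" "b *\<^sub>R H _"] by (intro AE_I2) (simp add: abs_mult)
  qed measurable
  then show ?thesis
    using i has_weak_gradient_lincomb[OF open_domain YD(3)[OF u] YD(3)[OF v]] by (simp add: Y_def)
qed

lemma Y_chain:
  assumes u: "Y u G"
    and F: "\<And>s. (F has_real_derivative F' s) (at s)" and F'c: "continuous_on UNIV F'" and L: "\<And>s. \<bar>F' s\<bar> \<le> L"
  shows "Y (\<lambda>x. F (u x)) (\<lambda>x. F' (u x) *\<^sub>R G x)"
proof -
  note [measurable] = YD(1,4)[OF u]
  have Fc: "continuous_on UNIV F"
    by (rule DERIV_continuous_on) (use F in \<open>auto intro: DERIV_subset\<close>)
  note [measurable] = borel_measurable_continuous_onI[OF Fc] borel_measurable_continuous_onI[OF F'c]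
  have "integrable M (\<lambda>x. (F (u x))\<^sup>2)"
  proof (rule Bochner_Integration.integrable_bound[of M "\<lambda>x. 2 * \<bar>F 0\<bar>\<^sup>2 + 2 * L\<^sup>2 * (u x)\<^sup>2"])
    show "AE x in M. norm ((F (u x))\<^sup>2) \<le> norm (2 * \<bar>F 0\<bar>\<^sup>2 + 2 * L\<^sup>2 * (u x)\<^sup>2)"
    proof (rule AE_I2)
      fix x
      have "\<bar>F (u x)\<bar>\<^sup>2 \<le> (\<bar>F 0\<bar> + L * \<bar>u x\<bar>)\<^sup>2"
        using real_lipschitz_deriv_le[OF F L, of "u x"] by (intro power_mono) auto
      also have "\<dots> \<le> 2 * \<bar>F 0\<bar>\<^sup>2 + 2 * (L * \<bar>u x\<bar>)\<^sup>2"
        using sum_squares_bound[of "\<bar>F 0\<bar>" "L * \<bar>u x\<bar>"] by (simp add: power2_sum)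
      finally show "norm ((F (u x))\<^sup>2) \<le> norm (2 * \<bar>F 0\<bar>\<^sup>2 + 2 * L\<^sup>2 * (u x)\<^sup>2)"
        by (simp add: power_mult_distrib)
    qed
  qed (use YD(2)[OF u] in auto)
  moreover have "(\<lambda>x. norm (F' (u x) *\<^sub>R G x)) \<in> Lvar \<Omega> p"
  proof (rule Lvar_bound[OF Lvar_scale[OF YD(5)[OF u], of L]])
    show "AE x in M. \<bar>norm (F' (u x) *\<^sub>R G x)\<bar> \<le> \<bar>L * norm (G x)\<bar>"
      using order_trans[OF L abs_ge_self] by (intro AE_I2) (simp add: abs_mult mult_right_mono)
  qed measurable
  ultimately show ?thesis
    using weak_gradient_chain[OF open_domain YD(3)[OF u] F F'c L] by (simp add: Y_def)
qed

lemma Y_zero: "Y (\<lambda>x. 0) (\<lambda>x. 0)"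
proof -
  have "(\<lambda>x. norm (0::'a)) \<in> Lvar \<Omega> p" by (rule Lvar_bounded[of _ 0]) auto
  then show ?thesis by (simp add: Y_def has_weak_gradient_def locally_integrable_on_def)
qed

lemma Y_one: "Y (\<lambda>x. 1) (\<lambda>x. 0)"
  using Y_chain[OF Y_zero, of "\<lambda>_. 1" "\<lambda>_. 0" 0] by simp

text \<open>The definition makes \<open>G\<close> integrable, hence measurable, on compact subsets
  only; countably many of them cover \<open>\<Omega>\<close>.\<close>

lemma weak_gradient_measurable:
  assumes "has_weak_gradient \<Omega> u G"
  shows "G \<in> borel_measurable M"
proof -
  obtain C where C: "\<And>n::nat. compact (C n)" "\<And>n. C n \<subseteq> \<Omega>" "\<Union>(range C) = \<Omega>"
    using open_Union_compact_subsets[OF open_domain] by metis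
  show ?thesis
  proof (rule measurable_piecewise_restrict[of "range C"])
    show "countable (range C)" by simp
    show "space M \<subseteq> \<Union>(range C)" using C(3) by simp
    fix K assume "K \<in> range C"
    then have K: "compact K" "K \<subseteq> \<Omega>" using C by auto
    then have Ks: "K \<in> sets lebesgue" by (simp add: borel_compact)
    then show "K \<inter> space M \<in> sets M" using K domain_sets by (simp add: sets_restrict_space_iff Int_absorb2)
    have "restrict_space M K = lebesgue_on K"
      using K(2) domain_sets by (subst restrict_restrict_space) (auto simp: Int_absorb1 Ks)
    then show "G \<in> borel_measurable (restrict_space M K)"
      using assms K by (auto simp: has_weak_gradient_def locally_integrable_on_def)
  qed
qed

lemma W1var_gradient:
  assumes "v \<in> W1var \<Omega> p"
  shows "has_weak_gradient \<Omega> v (weak_grad \<Omega> v)" "weak_grad \<Omega> v \<in> borel_measurable M"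
    "(\<lambda>x. norm (weak_grad \<Omega> v x)) \<in> Lvar \<Omega> p" "v \<in> borel_measurable M"
proof -
  show 1: "has_weak_gradient \<Omega> v (weak_grad \<Omega> v)"
    using assms someI_ex[of "has_weak_gradient \<Omega> v"] by (auto simp: W1var_def weak_grad_def)
  show "weak_grad \<Omega> v \<in> borel_measurable M" by (rule weak_gradient_measurable[OF 1])
qed (use assms in \<open>auto simp: W1var_def Lvar_def\<close>)

text \<open>\<open>weak_grad\<close> is a chosen representative; uniqueness identifies it with
  \<open>G\<close> almost everywhere, so the condition on the norm carries over.\<close>

lemma Y_imp_W1var:
  assumes Y: "Y u G" and u: "u \<in> Lvar \<Omega> p"
  shows "u \<in> W1var \<Omega> p" "AE x in M. weak_grad \<Omega> u x = G x"
proof -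
  have w: "has_weak_gradient \<Omega> u (weak_grad \<Omega> u)"
    using YD(3)[OF Y] someI_ex[of "has_weak_gradient \<Omega> u"] by (auto simp: weak_grad_def)
  show ae: "AE x in M. weak_grad \<Omega> u x = G x"
    by (rule weak_gradient_unique[OF open_domain w YD(3)[OF Y]])
  have [measurable]: "weak_grad \<Omega> u \<in> borel_measurable M"
    by (rule weak_gradient_measurable[OF w])
  have "(\<lambda>x. norm (weak_grad \<Omega> u x)) \<in> Lvar \<Omega> p"
    by (rule Lvar_bound[OF YD(5)[OF Y]]) (use ae in \<open>measurable, eventually_elim, simp\<close>)
  then show "u \<in> W1var \<Omega> p" using u w by (auto simp: W1var_def)
qed

end

subsection \<open>Minimisation\<close>

text \<open>A subsequence with summable distances converges almost everywhere, and Fatou's lemma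
  identifies its limit as the \<open>L^1\<close> limit of the whole sequence. The subsequence is
  part of the conclusion because continuity of the potential is used pointwise.\<close>

lemma L1_complete:
  fixes f :: "nat \<Rightarrow> 'a \<Rightarrow> 'b::euclidean_space"
  assumes f: "\<And>n. integrable M (f n)"
    and cauchy: "\<And>e. e > 0 \<Longrightarrow> \<exists>N. \<forall>m\<ge>N. \<forall>n\<ge>N. (LINT x|M. norm (f m x - f n x)) \<le> e"
  obtains g s where "strict_mono (s :: nat \<Rightarrow> nat)" "AE x in M. (\<lambda>n. f (s n) x) \<longlonglongrightarrow> g x"
    "integrable M g" "(\<lambda>n. LINT x|M. norm (f n x - g x)) \<longlonglongrightarrow> 0"
proof -
  note [measurable] = borel_measurable_integrable[OF f]
  have "\<exists>N. \<forall>k. \<forall>m\<ge>N k. \<forall>n\<ge>N k. (LINT x|M. norm (f m x - f n x)) \<le> (1/2) ^ k"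
    by (rule choice) (use cauchy in simp)
  then obtain N where N: "\<And>k m n. m \<ge> N k \<Longrightarrow> n \<ge> N k \<Longrightarrow> (LINT x|M. norm (f m x - f n x)) \<le> (1/2) ^ k"
    by blast
  \<comment> \<open>\<open>s k\<close> lies beyond \<open>N k\<close> and is forced to increase
    strictly, so consecutive distances are at most \<open>(1/2) ^ k\<close>.\<close>
  define s where "s = rec_nat (N 0) (\<lambda>k sk. max (N (Suc k)) (Suc sk))"
  have sS: "s (Suc k) = max (N (Suc k)) (Suc (s k))" for k by (simp add: s_def)
  have sm: "strict_mono s" by (rule strict_mono_Suc_iff[THEN iffD2]) (simp add: sS less_max_iff_disj)
  have sN: "N k \<le> s k" for k by (cases k) (simp_all add: sS, simp add: s_def)
  let ?d = "\<lambda>k x. norm (f (s (Suc k)) x - f (s k) x)"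
  have di: "integrable M (?d k)" for k using f by auto
  have "(\<integral>\<^sup>+x. (\<Sum>k. ennreal (?d k x)) \<partial>M) = (\<Sum>k. \<integral>\<^sup>+x. ennreal (?d k x) \<partial>M)"
    by (rule nn_integral_suminf) measurable
  also have "\<dots> = (\<Sum>k. ennreal (LINT x|M. ?d k x))"
    using di by (intro suminf_cong nn_integral_eq_integral) auto
  also have "\<dots> \<le> (\<Sum>k. ennreal ((1/2) ^ k))"
  proof (intro suminf_le ennreal_leI summableI)
    fix k
    have "s k \<le> s (Suc k)" by (simp add: sS)
    with N[of k "s (Suc k)" "s k"] sN[of k] show "(LINT x|M. ?d k x) \<le> (1/2) ^ k" by simp
  qed
  also have "\<dots> = ennreal (\<Sum>k. (1/2) ^ k)"
    by (rule suminf_ennreal2) (simp_all add: summable_geometric)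
  finally have "(\<integral>\<^sup>+x. (\<Sum>k. ennreal (?d k x)) \<partial>M) < top"
    using ennreal_less_top order.strict_trans1 by blast
  then have "AE x in M. (\<Sum>k. ennreal (?d k x)) \<noteq> \<infinity>"
    by (intro nn_integral_noteq_infinite) auto
  then have conv: "AE x in M. convergent (\<lambda>k. f (s k) x)"
  proof eventually_elim
    case (elim x)
    have "summable (\<lambda>k. ?d k x)"
      by (rule summable_suminf_not_top) (use elim in auto)
    then have "summable (\<lambda>k. f (s (Suc k)) x - f (s k) x)" by (rule summable_norm_cancel)
    then have "convergent (\<lambda>n. \<Sum>k<n. f (s (Suc k)) x - f (s k) x)"
      by (simp add: summable_iff_convergent)
    then have "convergent (\<lambda>n. f (s n) x - f (s 0) x)"
      unfolding sum_lessThan_telescope[of "\<lambda>k. f (s k) x"] .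
    then have "convergent (\<lambda>n. f (s n) x - f (s 0) x + f (s 0) x)"
      by (rule convergent_add[OF _ convergent_const])
    then show ?case by simp
  qed
  define g where "g x = lim (\<lambda>k. f (s k) x)" for x
  have gm [measurable]: "g \<in> borel_measurable M" unfolding g_def by measurable
  have lim: "AE x in M. (\<lambda>k. f (s k) x) \<longlonglongrightarrow> g x"
    using conv by eventually_elim (simp add: g_def convergent_LIMSEQ_iff)
  have main: "\<exists>n0. \<forall>n\<ge>n0. integrable M (\<lambda>x. norm (f n x - g x)) \<and> (LINT x|M. norm (f n x - g x)) \<le> e" if e: "e > 0" for e
  proof -
    obtain n0 where n0: "\<And>m n. m \<ge> n0 \<Longrightarrow> n \<ge> n0 \<Longrightarrow> (LINT x|M. norm (f m x - f n x)) \<le> e"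
      using cauchy[OF e] by blast
    have "integrable M (\<lambda>x. norm (f n x - g x)) \<and> (LINT x|M. norm (f n x - g x)) \<le> e" if n: "n \<ge> n0" for n
    proof (intro conjI)
      \<comment> \<open>Fatou's lemma is applied in \<open>k\<close>, with \<open>n\<close> fixed;
        the shift by \<open>n0\<close> places the whole subsequence in the range of the Cauchy
        estimate.\<close>
      let ?h = "\<lambda>k x. norm (f n x - f (s (k + n0)) x)"
      have h: "integrable M (?h k)" for k using f by auto
      have hl: "AE x in M. (\<lambda>k. ?h k x) \<longlonglongrightarrow> norm (f n x - g x)"
        using lim
      proof eventually_elim
        case (elim x)
        show ?case by (intro tendsto_norm tendsto_diff tendsto_const LIMSEQ_ignore_initial_segment[OF elim])
      qed
      have hb: "(LINT x|M. ?h k x) \<le> e" for k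
        using n0[OF n, of "s (k + n0)"] seq_suble[OF sm, of "k + n0"] by simp
      show "integrable M (\<lambda>x. norm (f n x - g x))" "(LINT x|M. norm (f n x - g x)) \<le> e"
        using Fatou_real[OF h _ hl _ hb tendsto_const] by auto
    qed
    then show ?thesis by blast
  qed
  obtain n1 where n1: "integrable M (\<lambda>x. norm (f n1 x - g x))" using main[of 1] by auto
  then have "integrable M (\<lambda>x. f n1 x - g x)" by (simp add: integrable_norm_iff)
  from Bochner_Integration.integrable_diff[OF f[of n1] this] have gi: "integrable M g" by simp
  have "(\<lambda>n. LINT x|M. norm (f n x - g x)) \<longlonglongrightarrow> 0"
  proof (rule LIMSEQ_I)
    fix e :: real assume "e > 0"
    then obtain n0 where "\<forall>n\<ge>n0. (LINT x|M. norm (f n x - g x)) \<le> e / 2" using main[of "e/2"] by auto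
    with \<open>e > 0\<close> show "\<exists>n0. \<forall>n\<ge>n0. norm ((LINT x|M. norm (f n x - g x)) - 0) < e"
      by (intro exI[of _ n0]) (auto simp: integral_nonneg_AE intro: le_less_trans)
  qed
  with sm lim gi show thesis by (rule that)
qed

section \<open>A strictly convex functional of linear growth\<close>

definition japanese :: "'a::real_normed_vector \<Rightarrow> real" where
  "japanese \<xi> = sqrt (1 + (norm \<xi>)\<^sup>2)"

lemma japanese_bounds: "norm \<xi> \<le> japanese \<xi>" "1 \<le> japanese \<xi>" "japanese \<xi> \<le> 1 + norm \<xi>"
proof -
  show "norm \<xi> \<le> japanese \<xi>" "1 \<le> japanese \<xi>"
    by (simp_all add: japanese_def real_le_rsqrt)
  show "japanese \<xi> \<le> 1 + norm \<xi>"
    unfolding japanese_def by (rule real_le_lsqrt) (simp_all add: power2_sum)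
qed

lemma japanese_square: "(japanese \<xi>)\<^sup>2 = 1 + \<xi> \<bullet> \<xi>"
  by (simp add: japanese_def power2_norm_eq_inner add_nonneg_nonneg)

text \<open>\<open>japanese \<xi>\<close> is the length of \<open>(1, \<xi>)\<close>, and the Gram determinant of \<open>(1, \<xi>)\<close> and \<open>(1, \<zeta>)\<close> is at
  least \<open>|\<xi> - \<zeta>|\<^sup>2\<close>.\<close>

lemma japanese_midpoint_gap:
  fixes \<xi> \<zeta> :: "'a::euclidean_space"
  defines "D \<equiv> japanese \<xi> / 2 + japanese \<zeta> / 2 - japanese ((1/2) *\<^sub>R \<xi> + (1/2) *\<^sub>R \<zeta>)"
  shows "(norm (\<xi> - \<zeta>))\<^sup>2 \<le> 4 * (japanese \<xi> + japanese \<zeta>) ^ 3 * D" "0 \<le> D"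
proof -
  \<comment> \<open>\<open>?a\<close> and \<open>?b\<close> are the lengths of the lifted vectors
    (1, \<xi>) and (1, \<zeta>), \<open>?m\<close> is the length of their sum, and \<open>?t\<close>
    is their scalar product.\<close>
  let ?a = "japanese \<xi>" and ?b = "japanese \<zeta>" and ?m = "2 * japanese ((1/2) *\<^sub>R \<xi> + (1/2) *\<^sub>R \<zeta>)"
  let ?t = "1 + \<xi> \<bullet> \<zeta>" and ?d = "(norm (\<xi> - \<zeta>))\<^sup>2"
  have a2: "?a\<^sup>2 = 1 + \<xi> \<bullet> \<xi>" and b2: "?b\<^sup>2 = 1 + \<zeta> \<bullet> \<zeta>"
    by (simp_all add: japanese_square)
  have m2: "?m\<^sup>2 = 4 + (\<xi> \<bullet> \<xi> + 2 * (\<xi> \<bullet> \<zeta>) + \<zeta> \<bullet> \<zeta>)"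
    unfolding power_mult_distrib japanese_square by (simp add: inner_simps inner_commute algebra_simps)
  have d: "?d = \<xi> \<bullet> \<xi> - 2 * (\<xi> \<bullet> \<zeta>) + \<zeta> \<bullet> \<zeta>"
    by (simp add: power2_norm_eq_inner inner_diff inner_commute)
  have a1: "1 \<le> ?a" and b1: "1 \<le> ?b" using japanese_bounds by auto
  have m0: "0 \<le> ?m" using japanese_bounds(2)[of "(1/2) *\<^sub>R \<xi> + (1/2) *\<^sub>R \<zeta>"] by simp
  have cs: "(\<xi> \<bullet> \<zeta>)\<^sup>2 \<le> (\<xi> \<bullet> \<xi>) * (\<zeta> \<bullet> \<zeta>)" by (rule Cauchy_Schwarz_ineq)
  have ab2: "(?a * ?b)\<^sup>2 = (1 + \<xi> \<bullet> \<xi>) * (1 + \<zeta> \<bullet> \<zeta>)" by (simp add: power_mult_distrib a2 b2)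
  \<comment> \<open>The Gram determinant equals \<open>?d\<close> plus the Cauchy-Schwarz defect of
    \<xi> and \<zeta>.\<close>
  have diff: "?d \<le> (?a * ?b)\<^sup>2 - ?t\<^sup>2"
    using cs unfolding ab2 d by (simp add: power2_eq_square algebra_simps)
  have ab0: "0 < ?a * ?b" using a1 b1 by simp
  have t: "\<bar>?t\<bar> \<le> ?a * ?b"
  proof (rule power2_le_imp_le)
    show "\<bar>?t\<bar>\<^sup>2 \<le> (?a * ?b)\<^sup>2"
      using diff zero_le_power2[of "norm (\<xi> - \<zeta>)"] unfolding power2_abs by linarith
  qed (use ab0 in simp)
  have fac: "?d \<le> (?a * ?b - ?t) * (2 * (?a * ?b))"
  proof -
    have "(?a * ?b)\<^sup>2 - ?t\<^sup>2 = (?a * ?b - ?t) * (?a * ?b + ?t)" by (simp add: power2_eq_square algebra_simps)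
    also have "\<dots> \<le> (?a * ?b - ?t) * (2 * (?a * ?b))" using t by (intro mult_left_mono) auto
    finally show ?thesis using diff by simp
  qed
  \<comment> \<open>The squared triangle inequality has twice the Cauchy-Schwarz defect of the
    lifted vectors as its defect. Factoring the left-hand side brings in \<open>D\<close>.\<close>
  have sq: "(?a + ?b)\<^sup>2 - ?m\<^sup>2 = 2 * (?a * ?b - ?t)"
    unfolding power2_sum a2 b2 m2 by (simp add: algebra_simps)
  have mle: "?m \<le> ?a + ?b"
    by (rule power2_le_imp_le) (use sq t a1 b1 in auto)
  then show D0: "0 \<le> D" by (simp add: D_def)
  have D: "2 * D = ?a + ?b - ?m" by (simp add: D_def)
  have "2 * (?a * ?b - ?t) = (2 * D) * (?a + ?b + ?m)"
    unfolding D sq[symmetric] by (simp add: power2_eq_square algebra_simps)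
  also have "\<dots> \<le> (2 * D) * (2 * (?a + ?b))"
    using D0 mle by (intro mult_left_mono) auto
  also have "\<dots> = 2 * (2 * D * (?a + ?b))" by simp
  finally have "?a * ?b - ?t \<le> 2 * D * (?a + ?b)" by (rule mult_left_le_imp_le) simp
  then have "(?a * ?b - ?t) * (2 * (?a * ?b)) \<le> (2 * D * (?a + ?b)) * (2 * (?a * ?b))"
    using ab0 by (intro mult_right_mono) auto
  also have "\<dots> \<le> (2 * D * (?a + ?b)) * (2 * (?a + ?b)\<^sup>2)"
  proof (intro mult_left_mono mult_nonneg_nonneg)
    have "0 \<le> ?a\<^sup>2 + ?b\<^sup>2 + ?a * ?b" using ab0 by (simp add: add_nonneg_nonneg)
    then show "?a * ?b \<le> (?a + ?b)\<^sup>2" by (simp add: power2_sum)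
  qed (use D0 a1 b1 in auto)
  finally have "?d \<le> (2 * D * (?a + ?b)) * (2 * (?a + ?b)\<^sup>2)" using fac by linarith
  moreover have "(2 * D * s) * (2 * s\<^sup>2) = 4 * s ^ 3 * D" for s
    by (simp add: power3_eq_cube power2_eq_square)
  ultimately show "?d \<le> 4 * (?a + ?b) ^ 3 * D" by metis
qed

text \<open>Two regimes for the sum \<open>s\<close> of the two values of \<open>japanese\<close>.
  If \<open>s \<le> R\<close>, the gap controls the squared distance, and
  \<open>d \<le> \<eta> + d^2 / \<eta>\<close> brings it back to the distance. If
  \<open>s > R\<close>, superlinear growth takes over through
  \<open>s \<le> s powr q / R powr (q - 1)\<close>, and \<open>R\<close> is chosen so that
  \<open>4 powr q / R powr (q - 1) = \<eta>\<close>.\<close>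

lemma norm_diff_le_gap:
  fixes \<eta> q :: real
  assumes "0 < \<eta>" "1 < q"
  obtains C where "0 \<le> C" "\<And>\<xi> \<zeta> :: 'a::euclidean_space. norm (\<xi> - \<zeta>) \<le>
    C * (japanese \<xi> / 2 + japanese \<zeta> / 2 - japanese ((1/2) *\<^sub>R \<xi> + (1/2) *\<^sub>R \<zeta>))
      + \<eta> * (1 + norm \<xi> powr q + norm \<zeta> powr q)"
proof -
  define R where "R = (4 powr q / \<eta>) powr (1 / (q - 1))"
  have R: "0 < R" using assms by (simp add: R_def)
  have Rq: "4 powr q / R powr (q - 1) = \<eta>"
    using assms by (simp add: R_def powr_powr)
  define C where "C = 4 * R ^ 3 / \<eta>"
  show thesis
  proof (rule that[of C])
    show "0 \<le> C" using assms R by (simp add: C_def)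
    fix \<xi> \<zeta> :: 'a
    let ?D = "japanese \<xi> / 2 + japanese \<zeta> / 2 - japanese ((1/2) *\<^sub>R \<xi> + (1/2) *\<^sub>R \<zeta>)"
    let ?s = "japanese \<xi> + japanese \<zeta>" and ?d = "norm (\<xi> - \<zeta>)"
    have D0: "0 \<le> ?D" and gap: "?d\<^sup>2 \<le> 4 * ?s ^ 3 * ?D" using japanese_midpoint_gap[where \<xi> = \<xi> and \<zeta> = \<zeta>] by auto
    have s2: "2 \<le> ?s" using japanese_bounds(2)[of \<xi>] japanese_bounds(2)[of \<zeta>] by linarith
    have pq: "1 \<le> 1 + norm \<xi> powr q + norm \<zeta> powr q" by simp
    show "?d \<le> C * ?D + \<eta> * (1 + norm \<xi> powr q + norm \<zeta> powr q)"
    proof (cases "?s \<le> R")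
      case True
      have le1: "?d \<le> \<eta> + ?d\<^sup>2 / \<eta>"
      proof (cases "?d \<le> \<eta>")
        case True
        then show ?thesis using assms by (simp add: add_increasing2)
      next
        case False
        then have "?d * \<eta> \<le> ?d * ?d" by (intro mult_left_mono) auto
        then have "?d \<le> ?d\<^sup>2 / \<eta>" using assms by (simp add: pos_le_divide_eq power2_eq_square)
        then show ?thesis using assms by simp
      qed
      have "4 * ?s ^ 3 * ?D \<le> 4 * R ^ 3 * ?D"
        using True s2 D0 by (intro mult_right_mono mult_left_mono power_mono) auto
      with gap have "?d\<^sup>2 / \<eta> \<le> C * ?D"
        using assms by (simp add: C_def divide_right_mono)
      moreover have "\<eta> \<le> \<eta> * (1 + norm \<xi> powr q + norm \<zeta> powr q)"
        using assms pq by simp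
      ultimately show ?thesis using le1 by linarith
    next
      case False
      let ?w = "max 1 (max (norm \<xi>) (norm \<zeta>))"
      have "?s \<le> 4 * ?w" using japanese_bounds(3)[of \<xi>] japanese_bounds(3)[of \<zeta>] by linarith
      then have "?s powr q \<le> (4 * ?w) powr q" using s2 assms by (intro powr_mono2) auto
      also have "\<dots> = 4 powr q * ?w powr q" by (simp add: powr_mult)
      also have "\<dots> \<le> 4 powr q * (1 + norm \<xi> powr q + norm \<zeta> powr q)"
        by (intro mult_left_mono) (auto simp: max_def)
      finally have sq: "?s powr q \<le> 4 powr q * (1 + norm \<xi> powr q + norm \<zeta> powr q)" .
      have "?d \<le> ?s"
        using norm_triangle_ineq4[of \<xi> \<zeta>] japanese_bounds(1)[of \<xi>] japanese_bounds(1)[of \<zeta>] by linarith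
      also have "?s * R powr (q - 1) \<le> ?s * ?s powr (q - 1)"
        using False R s2 assms by (intro mult_left_mono powr_mono2) auto
      then have "?s \<le> (?s * ?s powr (q - 1)) / R powr (q - 1)"
        using R by (simp add: pos_le_divide_eq)
      also have "?s * ?s powr (q - 1) = ?s powr q"
        using s2 powr_add[of ?s 1 "q - 1"] by simp
      also have "?s powr q / R powr (q - 1) \<le> (4 powr q * (1 + norm \<xi> powr q + norm \<zeta> powr q)) / R powr (q - 1)"
        using sq by (rule divide_right_mono) simp
      also have "\<dots> = \<eta> * (1 + norm \<xi> powr q + norm \<zeta> powr q)"
        using Rq by (metis times_divide_eq_left)
      finally show ?thesis using D0 \<open>0 \<le> C\<close> by (simp add: add_increasing)
    qed
  qed
qed

text \<open>A \<open>C^1\<close> truncation at height of order \<open>k\<close>: it is bounded,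
  shrinks absolute values, and has a derivative between 0 and 1. The bound 2 is a rounding of pi /
  2.\<close>

lemma real_truncation:
  fixes k :: real
  assumes "0 < k"
  shows "((\<lambda>s. k * arctan (s / k)) has_real_derivative inverse (1 + (s / k)\<^sup>2)) (at s)"
    and "continuous_on UNIV (\<lambda>s. inverse (1 + (s / k)\<^sup>2))"
    and "\<bar>inverse (1 + (s / k)\<^sup>2)\<bar> \<le> 1"
    and "\<bar>k * arctan (s / k)\<bar> \<le> k * 2"
    and "\<bar>k * arctan (s / k)\<bar> \<le> \<bar>s\<bar>"
proof -
  have pos: "1 + (s / k)\<^sup>2 > 0" for s by (simp add: add_pos_nonneg)
  have "((\<lambda>s. s / k) has_real_derivative 1 / k) (at s)" for s
    using assms by (auto intro!: derivative_eq_intros)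
  from DERIV_cmult[OF DERIV_chain2[OF DERIV_arctan this], of k]
  show d: "((\<lambda>s. k * arctan (s / k)) has_real_derivative inverse (1 + (s / k)\<^sup>2)) (at s)" for s
    using assms by simp
  show "continuous_on UNIV (\<lambda>s. inverse (1 + (s / k)\<^sup>2))"
    using pos by (intro continuous_intros) (use assms in \<open>auto simp: less_imp_neq[symmetric]\<close>)
  show i: "\<bar>inverse (1 + (s / k)\<^sup>2)\<bar> \<le> 1" for s
    using pos[of s] by (simp add: inverse_le_1_iff)
  have "\<bar>arctan (s / k)\<bar> \<le> 2"
    using arctan_bounded[of "s / k"] pi_less_4 by auto
  then show "\<bar>k * arctan (s / k)\<bar> \<le> k * 2"
    using assms by (simp add: abs_mult)
  show "\<bar>k * arctan (s / k)\<bar> \<le> \<bar>s\<bar>"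
    using real_lipschitz_deriv_le[of "\<lambda>s. k * arctan (s / k)" _ 1, OF d i] by simp
qed

text \<open>With \<open>h = 1 / (n + 1)\<close> the first limit is the derivative of
  \<open>arctan (s * h)\<close> at \<open>h = 0\<close>.\<close>

lemma tendsto_truncation:
  fixes s :: real
  shows "(\<lambda>n. real (Suc n) * arctan (s / real (Suc n))) \<longlonglongrightarrow> s"
    and "(\<lambda>n. inverse (1 + (s / real (Suc n))\<^sup>2)) \<longlonglongrightarrow> 1"
proof -
  have h0: "(\<lambda>n. s * inverse (real (Suc n))) \<longlonglongrightarrow> 0"
    using tendsto_mult_right_zero[OF LIMSEQ_inverse_real_of_nat] .
  have "((\<lambda>h. arctan (s * h)) has_real_derivative s) (at 0)"
    by (auto intro!: derivative_eq_intros)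
  then have "((\<lambda>h. arctan (s * h) / h) \<longlongrightarrow> s) (at 0)"
    by (simp add: DERIV_def)
  moreover have "filterlim (\<lambda>n. inverse (real (Suc n))) (at 0) sequentially"
    using LIMSEQ_inverse_real_of_nat by (auto simp: filterlim_at)
  ultimately have "(\<lambda>n. arctan (s * inverse (real (Suc n))) / inverse (real (Suc n))) \<longlonglongrightarrow> s"
    by (rule filterlim_compose)
  then show "(\<lambda>n. real (Suc n) * arctan (s / real (Suc n))) \<longlonglongrightarrow> s"
    by (simp add: divide_inverse mult.commute)
  have "(\<lambda>n. inverse (1 + (s * inverse (real (Suc n)))\<^sup>2)) \<longlonglongrightarrow> inverse (1 + 0\<^sup>2)"
    by (intro tendsto_intros h0) simp
  then show "(\<lambda>n. inverse (1 + (s / real (Suc n))\<^sup>2)) \<longlonglongrightarrow> 1"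
    by (simp add: divide_inverse)
qed

context flux_setting
begin

text \<open>The truncated function is bounded and \<open>\<Omega>\<close> has finite measure; this
  supplies the integrability of the function itself that \<open>W1var\<close> asks for and
  \<open>Y\<close> does not.\<close>

lemma Y_truncation:
  fixes n :: nat
  assumes "Y u G"
  defines "v \<equiv> \<lambda>x. real (Suc n) * arctan (u x / real (Suc n))"
    and "H \<equiv> \<lambda>x. inverse (1 + (u x / real (Suc n))\<^sup>2) *\<^sub>R G x"
  shows "Y v H" "v \<in> W1var \<Omega> p" "AE x in M. weak_grad \<Omega> v x = H x" "norm (H x) \<le> norm (G x)"
proof -
  show Y: "Y v H"
    unfolding v_def H_def
    by (rule Y_chain[OF assms(1), where L = 1]) (rule real_truncation(1-3), simp)+
  have "v \<in> Lvar \<Omega> p"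
  proof (rule Lvar_bounded[OF YD(1)[OF Y]])
    show "AE x in M. \<bar>v x\<bar> \<le> real (Suc n) * 2"
      unfolding v_def by (intro AE_I2 real_truncation(4)) simp
  qed
  then show "v \<in> W1var \<Omega> p" "AE x in M. weak_grad \<Omega> v x = H x"
    using Y_imp_W1var[OF Y] by auto
  show "norm (H x) \<le> norm (G x)"
    using mult_right_mono[OF real_truncation(3)[of "real (Suc n)" "u x"], of "norm (G x)"] by (simp add: H_def)
qed

text \<open>The hypothesis is available on \<open>W1var\<close> only; it passes to \<open>Y\<close> through truncations of \<open>u\<close>, because the
  potential increases with the norm of the gradient.\<close>

lemma Y_coercive:
  assumes Y: "Y u G"
  shows "\<delta> * (LINT x|M. norm (G x) powr p x) - \<delta>' \<le> (LINT x|M. flux_potential \<Psi> x (G x))"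
proof -
  let ?v = "\<lambda>n x. real (Suc n) * arctan (u x / real (Suc n))"
  let ?H = "\<lambda>n x. inverse (1 + (u x / real (Suc n))\<^sup>2) *\<^sub>R G x"
  note tr = Y_truncation[OF Y]
  have iG: "integrable M (\<lambda>x. norm (G x) powr p x)" using YD(5)[OF Y] by (simp add: Lvar_def)
  have iH: "integrable M (\<lambda>x. norm (?H n x) powr p x)" for n
    using YD(5)[OF tr(1), of n] unfolding Lvar_def by simp
  have "\<delta> * (LINT x|M. norm (?H n x) powr p x) \<le> (LINT x|M. flux_potential \<Psi> x (G x)) + \<delta>'" for n
  proof -
    note m = W1var_gradient[OF tr(2)[of n]]
    have "(LINT x|M. norm (?H n x) powr p x) = (LINT x|M. norm (weak_grad \<Omega> (?v n) x) powr p x)"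
    proof (rule integral_cong_AE)
      show "AE x in M. norm (?H n x) powr p x = norm (weak_grad \<Omega> (?v n) x) powr p x"
        using tr(3)[of n] by eventually_elim simp
    qed (use borel_measurable_integrable[OF iH[of n]] Lvar_measurable[OF m(3)] p_measurable in auto)
    moreover have "\<delta> * (LINT x|M. norm (weak_grad \<Omega> (?v n) x) powr p x) - \<delta>' \<le>
        (LINT x|M. flux_potential \<Psi> x (weak_grad \<Omega> (?v n) x))"
      by (rule coercive[OF tr(2)])
    moreover have "(LINT x|M. flux_potential \<Psi> x (weak_grad \<Omega> (?v n) x)) \<le> (LINT x|M. flux_potential \<Psi> x (G x))"
    proof (rule integral_mono_AE)
      show "integrable M (\<lambda>x. flux_potential \<Psi> x (weak_grad \<Omega> (?v n) x))"
        by (rule flux_potential_integrable[OF m(2,3)])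
      show "integrable M (\<lambda>x. flux_potential \<Psi> x (G x))"
        by (rule flux_potential_integrable[OF YD(4,5)[OF Y]])
      show "AE x in M. flux_potential \<Psi> x (weak_grad \<Omega> (?v n) x) \<le> flux_potential \<Psi> x (G x)"
        using regular tr(3)[of n]
      proof eventually_elim
        case (elim x)
        show ?case
          by (rule flux_potential_mono[OF elim(1)]) (use elim(2) tr(4)[where n = n and x = x] in simp)
      qed
    qed
    ultimately show ?thesis by simp
  qed
  moreover have "(\<lambda>n. \<delta> * (LINT x|M. norm (?H n x) powr p x)) \<longlonglongrightarrow> \<delta> * (LINT x|M. norm (G x) powr p x)"
  proof (rule tendsto_mult_left, rule integral_dominated_convergence[OF _ _ iG])
    show "(\<lambda>x. norm (G x) powr p x) \<in> borel_measurable M" using iG by auto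
    show "(\<lambda>x. norm (?H n x) powr p x) \<in> borel_measurable M" for n using iH[of n] by auto
    show "AE x in M. (\<lambda>n. norm (?H n x) powr p x) \<longlonglongrightarrow> norm (G x) powr p x"
    proof (rule AE_I2)
      fix x assume "x \<in> space M"
      then have p: "0 < p x" using p_lower[of x] q_gt_1 by simp
      have "(\<lambda>n. ?H n x) \<longlonglongrightarrow> 1 *\<^sub>R G x"
        by (rule tendsto_scaleR[OF tendsto_truncation(2) tendsto_const])
      from tendsto_norm[OF this] have "(\<lambda>n. norm (?H n x)) \<longlonglongrightarrow> norm (G x)" by (simp only: scaleR_one)
      then show "(\<lambda>n. norm (?H n x) powr p x) \<longlonglongrightarrow> norm (G x) powr p x"
        by (rule tendsto_powr2[OF _ tendsto_const]) (use p in auto)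
    qed
    show "AE x in M. norm (norm (?H n x) powr p x) \<le> norm (G x) powr p x" for n
    proof (rule AE_I2)
      fix x assume "x \<in> space M"
      then have p: "0 < p x" using p_lower[of x] q_gt_1 by simp
      show "norm (norm (?H n x) powr p x) \<le> norm (G x) powr p x"
        using powr_mono2[OF less_imp_le[OF p] norm_ge_zero tr(4)[where n = n and x = x]] by simp
    qed
  qed
  ultimately have "\<delta> * (LINT x|M. norm (G x) powr p x) \<le> (LINT x|M. flux_potential \<Psi> x (G x)) + \<delta>'"
    by (intro LIMSEQ_le_const2) auto
  then show ?thesis by simp
qed


lemma Y_integrable:
  assumes "Y u G"
  shows "integrable M u" "integrable M G" "integrable M (\<lambda>x. japanese (G x))"
proof -
  note [measurable] = YD(1,4)[OF assms]
  have b: "\<bar>t\<bar> \<le> 1 + t\<^sup>2" for t :: real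
    using zero_le_power2[of "\<bar>t\<bar> - 1"] by (simp add: power2_diff)
  show "integrable M u"
    by (rule Bochner_Integration.integrable_bound[of M "\<lambda>x. 1 + (u x)\<^sup>2"])
      (use YD(2)[OF assms] b in \<open>auto intro!: order_trans[OF _ abs_ge_self]\<close>)
  have n: "integrable M (\<lambda>x. norm (G x))" by (rule Lvar_integrable[OF YD(5)[OF assms]])
  then show "integrable M G" by (simp add: integrable_norm_iff)
  have [measurable]: "(\<lambda>x. japanese (G x)) \<in> borel_measurable M"
    unfolding japanese_def by measurable
  show "integrable M (\<lambda>x. japanese (G x))"
  proof (rule Bochner_Integration.integrable_bound[of M "\<lambda>x. 1 + norm (G x)"])
    show "AE x in M. norm (japanese (G x)) \<le> norm (1 + norm (G x))"
    proof (rule AE_I2)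
      fix x show "norm (japanese (G x)) \<le> norm (1 + norm (G x))"
        using japanese_bounds(2)[of "G x"] japanese_bounds(3)[of "G x"] by simp
    qed
  qed (use n in auto)
qed

section \<open>The energy and its almost minimisers\<close>

context
  fixes \<mu> :: real and g :: "'a \<Rightarrow> real"
  assumes mu: "\<mu> > 0" and g: "g \<in> borel_measurable M" "integrable M (\<lambda>x. (g x)\<^sup>2)"
begin

text \<open>Up to the constant \<open>g\<^sup>2 / (2 * \<mu>)\<close> the zero-order part is
  \<open>\<mu> * u\<^sup>2 / 2 - g * u\<close>, whose derivative in \<open>u\<close> is the term
  \<open>\<mu> * u - g\<close> of the equation. Completing the square makes the density nonnegative,
  as Fatou's lemma requires.\<close>

definition dens :: "('a \<Rightarrow> real) \<Rightarrow> ('a \<Rightarrow> 'a) \<Rightarrow> 'a \<Rightarrow> real" where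
  "dens u G x = flux_potential \<Psi> x (G x) + (\<mu> * u x - g x)\<^sup>2 / (2 * \<mu>)"

definition energy :: "('a \<Rightarrow> real) \<Rightarrow> ('a \<Rightarrow> 'a) \<Rightarrow> real" where
  "energy u G = (LINT x|M. dens u G x)"

lemma square_integrable:
  assumes "u \<in> borel_measurable M" "integrable M (\<lambda>x. (u x)\<^sup>2)"
  shows "integrable M (\<lambda>x. (\<mu> * u x - g x)\<^sup>2)"
proof -
  have "integrable M (\<lambda>x. \<mu>\<^sup>2 * (u x)\<^sup>2 - 2 * \<mu> * (u x * g x) + (g x)\<^sup>2)"
    using assms g integrable_product[OF assms(1) g(1) assms(2) g(2)] by simp
  also have "(\<lambda>x. \<mu>\<^sup>2 * (u x)\<^sup>2 - 2 * \<mu> * (u x * g x) + (g x)\<^sup>2) = (\<lambda>x. (\<mu> * u x - g x)\<^sup>2)"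
    by (simp add: fun_eq_iff power2_eq_square algebra_simps)
  finally show ?thesis .
qed

lemma dens_integrable:
  assumes "Y u G" shows "integrable M (dens u G)"
  unfolding dens_def
  using flux_potential_integrable[OF YD(4,5)[OF assms]] square_integrable[OF YD(1,2)[OF assms]] by simp

lemma dens_nonneg: "AE x in M. 0 \<le> dens u G x"
  using regular
proof eventually_elim
  case (elim x)
  show ?case using flux_potential_nonneg[OF elim] mu by (simp add: dens_def)
qed

text \<open>The subgradient at the midpoint gives convexity of the potential, since its two linear
  terms cancel. For the quadratic part the midpoint defect is computed exactly.\<close>

lemma dens_midpoint:
  "AE x in M. dens (\<lambda>x. 1/2 * u x + 1/2 * v x) (\<lambda>x. (1/2) *\<^sub>R G x + (1/2) *\<^sub>R H x) x + \<mu> / 8 * (u x - v x)\<^sup>2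
     \<le> dens u G x / 2 + dens v H x / 2"
  using regular
proof eventually_elim
  case (elim x)
  let ?m = "(1/2) *\<^sub>R G x + (1/2) *\<^sub>R H x"
  have "flux \<Psi> x ?m \<bullet> (G x - ?m) + flux \<Psi> x ?m \<bullet> (H x - ?m) = flux \<Psi> x ?m \<bullet> ((G x - ?m) + (H x - ?m))"
    by (simp add: inner_add_right)
  also have "(G x - ?m) + (H x - ?m) = (G x - (1/2) *\<^sub>R G x - (1/2) *\<^sub>R G x) + (H x - (1/2) *\<^sub>R H x - (1/2) *\<^sub>R H x)"
    by (simp add: algebra_simps)
  also have "\<dots> = 0" by (simp add: diff_diff_eq scaleR_add_left[symmetric])
  finally have "flux_potential \<Psi> x ?m \<le> flux_potential \<Psi> x (G x) / 2 + flux_potential \<Psi> x (H x) / 2"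
    using flux_subgradient[OF elim, of ?m "G x"] flux_subgradient[OF elim, of ?m "H x"] by simp
  moreover have "(\<mu> * (1/2 * u x + 1/2 * v x) - g x)\<^sup>2 / (2 * \<mu>) + \<mu> / 8 * (u x - v x)\<^sup>2 =
      (\<mu> * u x - g x)\<^sup>2 / (2 * \<mu>) / 2 + (\<mu> * v x - g x)\<^sup>2 / (2 * \<mu>) / 2"
    using mu by (simp add: field_simps power2_eq_square)
  ultimately show ?case unfolding dens_def by (simp only: add_divide_distrib)
qed

text \<open>The first bound is coercivity after discarding the quadratic part; the second discards
  the potential and removes \<open>g\<close> from the square.\<close>

lemma energy_bounds:
  assumes Y: "Y u G" and le: "energy u G \<le> c"
  shows "(LINT x|M. norm (G x) powr p x) \<le> (c + \<delta>') / \<delta>"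
    and "(LINT x|M. (u x)\<^sup>2) \<le> 2 / \<mu>\<^sup>2 * (2 * \<mu> * c + (LINT x|M. (g x)\<^sup>2))"
proof -
  note i1 = flux_potential_integrable[OF YD(4,5)[OF Y]] and i2 = square_integrable[OF YD(1,2)[OF Y]]
  have eq: "energy u G = (LINT x|M. flux_potential \<Psi> x (G x)) + (LINT x|M. (\<mu> * u x - g x)\<^sup>2) / (2 * \<mu>)"
    using i1 i2 by (simp add: energy_def dens_def)
  have "AE x in M. 0 \<le> flux_potential \<Psi> x (G x)"
    using regular by eventually_elim (rule flux_potential_nonneg)
  then have n1: "0 \<le> (LINT x|M. flux_potential \<Psi> x (G x))"
    by (rule integral_nonneg_AE)
  have n2: "0 \<le> (LINT x|M. (\<mu> * u x - g x)\<^sup>2)" by (intro integral_nonneg_AE) simp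
  have "\<delta> * (LINT x|M. norm (G x) powr p x) \<le> c + \<delta>'"
    using Y_coercive[OF Y] le eq divide_nonneg_pos[OF n2, of "2 * \<mu>"] mu by linarith
  then show "(LINT x|M. norm (G x) powr p x) \<le> (c + \<delta>') / \<delta>"
    using delta_pos by (simp add: pos_le_divide_eq mult.commute)
  have "(LINT x|M. (\<mu> * u x - g x)\<^sup>2) / (2 * \<mu>) \<le> c" using eq n1 le by simp
  then have b: "(LINT x|M. (\<mu> * u x - g x)\<^sup>2) \<le> 2 * \<mu> * c" using mu by (simp add: pos_divide_le_eq mult.commute)
  have "(LINT x|M. (u x)\<^sup>2) \<le> (LINT x|M. 2 / \<mu>\<^sup>2 * ((\<mu> * u x - g x)\<^sup>2 + (g x)\<^sup>2))"
  proof (rule integral_mono)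
    fix x
    have "(\<mu> * u x)\<^sup>2 \<le> 2 * ((\<mu> * u x - g x)\<^sup>2 + (g x)\<^sup>2)"
      using zero_le_power2[of "\<mu> * u x - 2 * g x"] by (simp add: power2_eq_square algebra_simps)
    then show "(u x)\<^sup>2 \<le> 2 / \<mu>\<^sup>2 * ((\<mu> * u x - g x)\<^sup>2 + (g x)\<^sup>2)"
      using mu by (simp add: power_mult_distrib pos_le_divide_eq mult.commute)
  qed (use i2 g YD(2)[OF Y] in auto)
  also have "\<dots> = 2 / \<mu>\<^sup>2 * ((LINT x|M. (\<mu> * u x - g x)\<^sup>2) + (LINT x|M. (g x)\<^sup>2))"
    using i2 g by simp
  also have "\<dots> \<le> 2 / \<mu>\<^sup>2 * (2 * \<mu> * c + (LINT x|M. (g x)\<^sup>2))"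
    using b by (intro mult_left_mono add_right_mono) auto
  finally show "(LINT x|M. (u x)\<^sup>2) \<le> 2 / \<mu>\<^sup>2 * (2 * \<mu> * c + (LINT x|M. (g x)\<^sup>2))" .
qed

lemma energy_midpoint:
  assumes u: "Y u G" and v: "Y v H"
  shows "energy (\<lambda>x. 1/2 * u x + 1/2 * v x) (\<lambda>x. (1/2) *\<^sub>R G x + (1/2) *\<^sub>R H x) + \<mu> / 8 * (LINT x|M. (u x - v x)\<^sup>2)
     \<le> energy u G / 2 + energy v H / 2"
proof -
  have d: "integrable M (\<lambda>x. (u x - v x)\<^sup>2)"
    using YD(2)[OF Y_lincomb[OF u v, of 1 "-1"]] by simp
  note m = dens_integrable[OF Y_lincomb[OF u v, of "1/2" "1/2"]]
  have "(LINT x|M. dens (\<lambda>x. 1/2 * u x + 1/2 * v x) (\<lambda>x. (1/2) *\<^sub>R G x + (1/2) *\<^sub>R H x) x + \<mu> / 8 * (u x - v x)\<^sup>2)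
     \<le> (LINT x|M. dens u G x / 2 + dens v H x / 2)"
    using m d dens_integrable[OF u] dens_integrable[OF v] by (intro integral_mono_AE dens_midpoint) auto
  then show ?thesis
    unfolding energy_def using m d dens_integrable[OF u] dens_integrable[OF v] by simp
qed

text \<open>\<open>r n\<close> is the infimum of \<open>\<integral> japanese (G x)\<close> over the sublevel set of the energy at \<open>I + 1 / (n + 1)\<close>;
  by convexity this set contains the midpoint of any two of its elements.\<close>

lemma minimizing_sequence:
  obtains I L :: real and u :: "nat \<Rightarrow> 'a \<Rightarrow> real" and G :: "nat \<Rightarrow> 'a \<Rightarrow> 'a" and r :: "nat \<Rightarrow> real"
  where "\<And>v H. Y v H \<Longrightarrow> I \<le> energy v H" "\<And>n. Y (u n) (G n)"
    "\<And>n. energy (u n) (G n) \<le> I + inverse (Suc n)" "r \<longlonglongrightarrow> L"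
    "\<And>n m. n \<le> m \<Longrightarrow> (LINT x|M. japanese (G n x)) / 2 + (LINT x|M. japanese (G m x)) / 2
       - (LINT x|M. japanese ((1/2) *\<^sub>R G n x + (1/2) *\<^sub>R G m x)) \<le> (L - r n) / 2 + inverse (Suc n)"
proof -
  define A where "A = {energy v H |v H. Y v H}"
  define I where "I = Inf A"
  have A0: "0 \<le> a" if "a \<in> A" for a
    using that dens_nonneg by (auto simp: A_def energy_def intro!: integral_nonneg_AE)
  have Abdd: "bdd_below A" using A0 by (rule bdd_belowI)
  have Ane: "A \<noteq> {}" using Y_zero by (auto simp: A_def)
  have I: "I \<le> energy v H" if "Y v H" for v H
    unfolding I_def by (rule cInf_lower[OF _ Abdd]) (use that in \<open>auto simp: A_def\<close>)
  define S where "S n v H \<longleftrightarrow> Y v H \<and> energy v H \<le> I + inverse (Suc n)" for n :: nat and v H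
  have Sne: "\<exists>v H. S n v H" for n
  proof -
    have "Inf A < I + inverse (Suc n)" by (simp add: I_def)
    from cInf_lessD[OF Ane this] show ?thesis by (force simp: A_def S_def)
  qed
  have Smono: "S n v H" if "S m v H" "n \<le> m" for n m v H
  proof -
    have "inverse (real (Suc m)) \<le> inverse (real (Suc n))" using that(2) by simp
    then show ?thesis using that(1) unfolding S_def by linarith
  qed
  define \<rho> where "\<rho> H = (LINT x|M. japanese (H x))" for H :: "'a \<Rightarrow> 'a"
  define B where "B n = {\<rho> H |v H. S n v H}" for n
  define r where "r n = Inf (B n)" for n
  have B0: "0 \<le> b" if "b \<in> B n" for b n
  proof -
    have "0 \<le> japanese z" for z :: 'a using japanese_bounds(2)[of z] by linarith
    then show ?thesis using that by (auto simp: B_def \<rho>_def intro!: integral_nonneg_AE)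
  qed
  have Bbdd: "bdd_below (B n)" for n using B0[of _ n] by (rule bdd_belowI)
  have Bne: "B n \<noteq> {}" for n using Sne[of n] by (auto simp: B_def)
  have rle: "r n \<le> \<rho> H" if "S n v H" for n v H
    unfolding r_def by (rule cInf_lower[OF _ Bbdd]) (use that in \<open>auto simp: B_def\<close>)
  have "incseq r"
    unfolding incseq_def r_def
  proof (intro allI impI cInf_superset_mono Bne Bbdd)
    fix m n :: nat assume "m \<le> n"
    then show "B n \<subseteq> B m" using Smono[of n _ _ m] by (auto simp: B_def)
  qed
  \<comment> \<open>Coercivity bounds the integral of \<open>norm (H x) powr p x\<close> on the
    sublevel sets, and \<open>japanese\<close> is at most 2 plus this power. So the increasing
    sequence \<open>r\<close> is bounded and converges.\<close>
  moreover have "r n \<le> 2 * measure M (space M) + (I + 1 + \<delta>') / \<delta>" for n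
  proof -
    obtain v H where S: "S n v H" using Sne by blast
    then have Y: "Y v H" by (simp add: S_def)
    have "inverse (real (Suc n)) \<le> 1" using le_imp_inverse_le[of 1 "real (Suc n)"] by simp
    then have "energy v H \<le> I + 1" using S unfolding S_def by linarith
    from energy_bounds(1)[OF Y this] have K: "(LINT x|M. norm (H x) powr p x) \<le> (I + 1 + \<delta>') / \<delta>" .
    have i: "integrable M (\<lambda>x. norm (H x) powr p x)" using YD(5)[OF Y] by (simp add: Lvar_def)
    have "\<rho> H \<le> (LINT x|M. 2 + norm (H x) powr p x)"
      unfolding \<rho>_def
    proof (rule integral_mono[OF Y_integrable(3)[OF Y]])
      fix x assume "x \<in> space M"
      then show "japanese (H x) \<le> 2 + norm (H x) powr p x"
        using powr_ge_linear[of x "norm (H x)"] japanese_bounds(3)[of "H x"] by simp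
    qed (use i in simp)
    also have "\<dots> = 2 * measure M (space M) + (LINT x|M. norm (H x) powr p x)" using i by simp
    finally show ?thesis using K rle[OF S] by linarith
  qed
  ultimately obtain L where L: "r \<longlonglongrightarrow> L" "\<And>n. r n \<le> L"
    using incseq_convergent[of r] by blast
  have "\<exists>w. S n (fst w) (snd w) \<and> \<rho> (snd w) \<le> r n + inverse (Suc n)" for n
  proof -
    have "Inf (B n) < r n + inverse (Suc n)" by (simp add: r_def)
    from cInf_lessD[OF Bne this] obtain v H where "S n v H" "\<rho> H < r n + inverse (Suc n)"
      by (auto simp: B_def)
    then show ?thesis by (intro exI[of _ "(v, H)"]) auto
  qed
  then have "\<exists>w. \<forall>n. S n (fst (w n)) (snd (w n)) \<and> \<rho> (snd (w n)) \<le> r n + inverse (Suc n)"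
    by (intro choice allI)
  then obtain w where w: "\<And>n. S n (fst (w n)) (snd (w n))" "\<And>n. \<rho> (snd (w n)) \<le> r n + inverse (Suc n)"
    by blast
  show thesis
  proof (rule that[of I "\<lambda>n. fst (w n)" "\<lambda>n. snd (w n)" r L])
    show "Y (fst (w n)) (snd (w n))" "energy (fst (w n)) (snd (w n)) \<le> I + inverse (Suc n)" for n
      using w(1)[of n] by (auto simp: S_def)
    fix n m :: nat assume nm: "n \<le> m"
    let ?v = "\<lambda>x. 1/2 * fst (w n) x + 1/2 * fst (w m) x" and ?H = "\<lambda>x. (1/2) *\<^sub>R snd (w n) x + (1/2) *\<^sub>R snd (w m) x"
    have Yn: "Y (fst (w n)) (snd (w n))" and Ym: "Y (fst (w m)) (snd (w m))"
      and en: "energy (fst (w n)) (snd (w n)) \<le> I + inverse (Suc n)"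
      and em: "energy (fst (w m)) (snd (w m)) \<le> I + inverse (Suc n)"
      using w(1)[of n] Smono[OF w(1)[of m] nm] by (auto simp: S_def)
    have "0 \<le> (LINT x|M. (fst (w n) x - fst (w m) x)\<^sup>2)" by (intro integral_nonneg_AE) simp
    then have "0 \<le> \<mu> / 8 * (LINT x|M. (fst (w n) x - fst (w m) x)\<^sup>2)" using mu by simp
    then have "energy ?v ?H \<le> I + inverse (Suc n)"
      using energy_midpoint[OF Yn Ym] en em by linarith
    then have "S n ?v ?H" using Y_lincomb[OF Yn Ym, of "1/2" "1/2"] unfolding S_def by blast
    from rle[OF this] have "r n \<le> (LINT x|M. japanese (?H x))" by (simp add: \<rho>_def)
    moreover have "inverse (real (Suc m)) \<le> inverse (real (Suc n))" using nm by simp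
    \<comment> \<open>The arithmetic of the gap: the values at the two points exceed
      \<open>r n\<close> and \<open>r m\<close> only by small errors, the midpoint value is at least
      \<open>r n\<close>, and \<open>r m \<le> L\<close>.\<close>
    moreover have "a / 2 + b / 2 - c \<le> (L - rn) / 2 + e"
      if "rn \<le> c" "e' \<le> e" "a \<le> rn + e" "b \<le> rm + e'" "rm \<le> L" for a b c rn rm e e' :: real
      using that by (simp add: field_simps)
    ultimately show "(LINT x|M. japanese (snd (w n) x)) / 2 + (LINT x|M. japanese (snd (w m) x)) / 2
       - (LINT x|M. japanese (?H x)) \<le> (L - r n) / 2 + inverse (Suc n)"
      using w(2)[of n] w(2)[of m] L(2)[of m] unfolding \<rho>_def by blast
  qed (use I L in auto)
qed

end


text \<open>The pointwise bound, integrated. The exponent \<open>q\<close> is replaced by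
  \<open>p x\<close> through \<open>t powr q \<le> 1 + t powr p x\<close>, used twice, which turns
  the summand 1 into 3.\<close>

lemma LINT_norm_diff_le_gap:
  assumes "0 < \<eta>" and K: "0 \<le> K"
  obtains C where "0 \<le> C" "\<And>u v G H. Y u G \<Longrightarrow> Y v H \<Longrightarrow> (LINT x|M. norm (G x) powr p x) \<le> K \<Longrightarrow>
    (LINT x|M. norm (H x) powr p x) \<le> K \<Longrightarrow> (LINT x|M. norm (G x - H x)) \<le>
      C * ((LINT x|M. japanese (G x)) / 2 + (LINT x|M. japanese (H x)) / 2
       - (LINT x|M. japanese ((1/2) *\<^sub>R G x + (1/2) *\<^sub>R H x))) + \<eta> * (3 * measure M (space M) + 2 * K)"
proof -
  obtain C where C: "0 \<le> C" "\<And>\<xi> \<zeta> :: 'a. norm (\<xi> - \<zeta>) \<le>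
    C * (japanese \<xi> / 2 + japanese \<zeta> / 2 - japanese ((1/2) *\<^sub>R \<xi> + (1/2) *\<^sub>R \<zeta>))
      + \<eta> * (1 + norm \<xi> powr q + norm \<zeta> powr q)"
    using norm_diff_le_gap[OF assms(1) q_gt_1] by blast
  show thesis
  proof (rule that[OF C(1)])
    fix u v G H assume u: "Y u G" and v: "Y v H"
      and KG: "(LINT x|M. norm (G x) powr p x) \<le> K" and KH: "(LINT x|M. norm (H x) powr p x) \<le> K"
    have iG: "integrable M (\<lambda>x. norm (G x) powr p x)" and iH: "integrable M (\<lambda>x. norm (H x) powr p x)"
      using YD(5)[OF u] YD(5)[OF v] by (auto simp: Lvar_def)
    note j = Y_integrable(3)[OF u] Y_integrable(3)[OF v] Y_integrable(3)[OF Y_lincomb[OF u v, of "1/2" "1/2"]]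
    let ?D = "\<lambda>x. japanese (G x) / 2 + japanese (H x) / 2 - japanese ((1/2) *\<^sub>R G x + (1/2) *\<^sub>R H x)"
    have iD: "integrable M ?D" using j by simp
    have qp: "t powr q \<le> 1 + t powr p x" if "x \<in> \<Omega>" "0 \<le> t" for t x
    proof (cases "t \<le> 1")
      case True
      then have "t powr q \<le> 1 powr q" using that q_gt_1 by (intro powr_mono2) auto
      then show ?thesis by (simp add: add_increasing2)
    next
      case False
      then have "t powr q \<le> t powr p x" using p_lower[OF that(1)] by (intro powr_mono) auto
      then show ?thesis by simp
    qed
    have "(LINT x|M. norm (G x - H x)) \<le> (LINT x|M. C * ?D x + \<eta> * (3 + norm (G x) powr p x + norm (H x) powr p x))"
    proof (rule integral_mono)
      show "integrable M (\<lambda>x. norm (G x - H x))"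
        using Y_integrable(2)[OF u] Y_integrable(2)[OF v] by simp
      show "integrable M (\<lambda>x. C * ?D x + \<eta> * (3 + norm (G x) powr p x + norm (H x) powr p x))"
        using iD iG iH by simp
      fix x assume "x \<in> space M"
      then have x: "x \<in> \<Omega>" by simp
      have "\<eta> * (1 + norm (G x) powr q + norm (H x) powr q) \<le> \<eta> * (3 + norm (G x) powr p x + norm (H x) powr p x)"
        using qp[OF x, of "norm (G x)"] qp[OF x, of "norm (H x)"] assms(1) by (intro mult_left_mono) auto
      with C(2)[of "G x" "H x"] show "norm (G x - H x) \<le> C * ?D x + \<eta> * (3 + norm (G x) powr p x + norm (H x) powr p x)"
        by linarith
    qed
    also have "\<dots> = C * (LINT x|M. ?D x) + \<eta> * (3 * measure M (space M) + (LINT x|M. norm (G x) powr p x) + (LINT x|M. norm (H x) powr p x))"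
      using iD iG iH by simp
    also have "(LINT x|M. ?D x) = (LINT x|M. japanese (G x)) / 2 + (LINT x|M. japanese (H x)) / 2
       - (LINT x|M. japanese ((1/2) *\<^sub>R G x + (1/2) *\<^sub>R H x))"
      using j by simp
    also have "\<eta> * (3 * measure M (space M) + (LINT x|M. norm (G x) powr p x) + (LINT x|M. norm (H x) powr p x))
        \<le> \<eta> * (3 * measure M (space M) + 2 * K)"
      using KG KH assms(1) by (intro mult_left_mono) auto
    finally show "(LINT x|M. norm (G x - H x)) \<le>
      C * ((LINT x|M. japanese (G x)) / 2 + (LINT x|M. japanese (H x)) / 2
       - (LINT x|M. japanese ((1/2) *\<^sub>R G x + (1/2) *\<^sub>R H x))) + \<eta> * (3 * measure M (space M) + 2 * K)"
      by simp
  qed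
qed

text \<open>Uses the pointwise bound \<bar>t\<bar> \<le> t^2 / \<eta> + \<eta> in place of
  Cauchy-Schwarz, in the same additive form as the gradient estimate with which it is
  combined.\<close>

lemma LINT_abs_le_square:
  assumes "0 < \<eta>" "integrable M w" "integrable M (\<lambda>x. (w x :: real)\<^sup>2)"
  shows "(LINT x|M. \<bar>w x\<bar>) \<le> (LINT x|M. (w x)\<^sup>2) / \<eta> + \<eta> * measure M (space M)"
proof -
  have "\<bar>t\<bar> \<le> t\<^sup>2 / \<eta> + \<eta>" for t :: real
  proof (cases "\<bar>t\<bar> \<le> \<eta>")
    case True
    then show ?thesis using assms by (simp add: add_increasing)
  next
    case False
    then have "\<bar>t\<bar> * \<eta> \<le> \<bar>t\<bar> * \<bar>t\<bar>" by (intro mult_left_mono) auto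
    then have "\<bar>t\<bar> \<le> t\<^sup>2 / \<eta>" using assms by (simp add: pos_le_divide_eq power2_eq_square)
    then show ?thesis using assms by simp
  qed
  then have "(LINT x|M. \<bar>w x\<bar>) \<le> (LINT x|M. (w x)\<^sup>2 / \<eta> + \<eta>)"
    using assms by (intro integral_mono) auto
  also have "\<dots> = (LINT x|M. (w x)\<^sup>2) / \<eta> + \<eta> * measure M (space M)"
    using assms by (simp add: mult.commute)
  finally show ?thesis .
qed

lemma minimizer:
  assumes mu: "\<mu> > 0" and g: "g \<in> borel_measurable M" "integrable M (\<lambda>x. (g x)\<^sup>2)"
  obtains u G where "Y u G" "\<And>v H. Y v H \<Longrightarrow> energy \<mu> g u G \<le> energy \<mu> g v H"
proof -
  obtain I L :: real and u :: "nat \<Rightarrow> 'a \<Rightarrow> real" and G :: "nat \<Rightarrow> 'a \<Rightarrow> 'a" and r :: "nat \<Rightarrow> real"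
    where I: "\<And>v H. Y v H \<Longrightarrow> I \<le> energy \<mu> g v H" and Y: "\<And>n. Y (u n) (G n)"
    and en: "\<And>n. energy \<mu> g (u n) (G n) \<le> I + inverse (Suc n)" and r: "r \<longlonglongrightarrow> L"
    and gap: "\<And>n m. n \<le> m \<Longrightarrow> (LINT x|M. japanese (G n x)) / 2 + (LINT x|M. japanese (G m x)) / 2
       - (LINT x|M. japanese ((1/2) *\<^sub>R G n x + (1/2) *\<^sub>R G m x)) \<le> (L - r n) / 2 + inverse (Suc n)"
    by (rule minimizing_sequence[OF mu g]) (rule that; assumption)
  define K where "K = (I + 1 + \<delta>') / \<delta>"
  define K2 where "K2 = 2 / \<mu>\<^sup>2 * (2 * \<mu> * (I + 1) + (LINT x|M. (g x)\<^sup>2))"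
  have en1: "energy \<mu> g (u n) (G n) \<le> I + 1" for n
    using en[of n] le_imp_inverse_le[of 1 "real (Suc n)"] by simp
  have K: "(LINT x|M. norm (G n x) powr p x) \<le> K" for n
    using energy_bounds(1)[OF mu g Y en1] by (simp add: K_def)
  have K2: "(LINT x|M. (u n x)\<^sup>2) \<le> K2" for n
    using energy_bounds(2)[OF mu g Y en1] by (simp add: K2_def)
  have K0: "0 \<le> K"
    by (rule order_trans[OF _ K[of 0]]) (auto intro: integral_nonneg_AE)
  let ?\<epsilon> = "\<lambda>n. inverse (real (Suc n))"
  have d2: "integrable M (\<lambda>x. (u n x - u m x)\<^sup>2)" for n m
    using YD(2)[OF Y_lincomb[OF Y[of n] Y[of m], of 1 "-1"]] by simp
  \<comment> \<open>The midpoint has energy at least \<open>I\<close>, so the strict convexity of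
    the quadratic part bounds the distance by the excess energy.\<close>
  have sq: "(LINT x|M. (u n x - u m x)\<^sup>2) \<le> 8 / \<mu> * ?\<epsilon> n" if "n \<le> m" for n m
  proof -
    have "?\<epsilon> m \<le> ?\<epsilon> n" using that by simp
    then have "energy \<mu> g (u m) (G m) \<le> I + ?\<epsilon> n" using en[of m] by linarith
    moreover have "I \<le> energy \<mu> g (\<lambda>x. 1/2 * u n x + 1/2 * u m x) (\<lambda>x. (1/2) *\<^sub>R G n x + (1/2) *\<^sub>R G m x)"
      by (rule I[OF Y_lincomb[OF Y Y]])
    ultimately have "\<mu> / 8 * (LINT x|M. (u n x - u m x)\<^sup>2) \<le> ?\<epsilon> n"
      using energy_midpoint[OF mu g Y[of n] Y[of m]] en[of n] by linarith
    then have "8 / \<mu> * (\<mu> / 8 * (LINT x|M. (u n x - u m x)\<^sup>2)) \<le> 8 / \<mu> * ?\<epsilon> n"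
      using mu by (intro mult_left_mono) auto
    then show ?thesis using mu by simp
  qed
  \<comment> \<open>Function and gradient are treated as one function with values in a product, so
    that a single subsequence serves both.\<close>
  let ?f = "\<lambda>n x. (u n x, G n x)"
  note ui = Y_integrable(1)[OF Y] and Gi = Y_integrable(2)[OF Y]
  have fi: "integrable M (?f n)" for n
  proof (rule Bochner_Integration.integrable_bound[of M "\<lambda>x. \<bar>u n x\<bar> + norm (G n x)"])
    show "AE x in M. norm (?f n x) \<le> norm (\<bar>u n x\<bar> + norm (G n x))"
      using norm_Pair_le[of "u n _" "G n _"] by (intro AE_I2) simp
    show "?f n \<in> borel_measurable M"
      using borel_measurable_integrable[OF ui] borel_measurable_integrable[OF Gi] by (rule borel_measurable_Pair)
  qed (use ui Gi in auto)
  let ?m = "measure M (space M)"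
  have cauchy: "\<exists>N. \<forall>m\<ge>N. \<forall>n\<ge>N. (LINT x|M. norm (?f m x - ?f n x)) \<le> e" if e: "e > 0" for e
  proof -
    \<comment> \<open>All terms carrying \<eta> add up to \<open>\<eta> * (4 * ?m + 2 * K)\<close>,
      which this choice keeps below \<open>e / 2\<close>; the added 1 keeps the denominator
      positive.\<close>
    define \<eta> where "\<eta> = e / (2 * (4 * ?m + 2 * K + 1))"
    have den: "0 < 4 * ?m + 2 * K + 1" using K0 by (simp add: add_nonneg_pos)
    have \<eta>: "0 < \<eta>" using e den by (simp add: \<eta>_def)
    have "\<eta> * (4 * ?m + 2 * K) \<le> \<eta> * (4 * ?m + 2 * K + 1)" using \<eta> by (intro mult_left_mono) auto
    also have "\<dots> = e / 2"
    proof -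
      have "e / (2 * z) * z = e / 2" if "0 < z" for z :: real using that by simp
      from this[OF den] show ?thesis by (simp only: \<eta>_def)
    qed
    finally have \<eta>e: "\<eta> * (4 * ?m + 2 * K) \<le> e / 2" .
    obtain C where C: "0 \<le> C" and CG: "\<And>u v G H. Y u G \<Longrightarrow> Y v H \<Longrightarrow> (LINT x|M. norm (G x) powr p x) \<le> K \<Longrightarrow>
      (LINT x|M. norm (H x) powr p x) \<le> K \<Longrightarrow> (LINT x|M. norm (G x - H x)) \<le>
      C * ((LINT x|M. japanese (G x)) / 2 + (LINT x|M. japanese (H x)) / 2
       - (LINT x|M. japanese ((1/2) *\<^sub>R G x + (1/2) *\<^sub>R H x))) + \<eta> * (3 * ?m + 2 * K)"
      using LINT_norm_diff_le_gap[OF \<eta> K0] by blast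
    let ?R = "\<lambda>n. 8 / \<mu> * ?\<epsilon> n / \<eta> + C * ((L - r n) / 2 + ?\<epsilon> n)"
    have "?R \<longlonglongrightarrow> 8 / \<mu> * 0 / \<eta> + C * ((L - L) / 2 + 0)"
      by (intro tendsto_intros r LIMSEQ_inverse_real_of_nat) (use \<eta> in auto)
    then have "?R \<longlonglongrightarrow> 0" by simp
    from order_tendstoD(2)[OF this, of "e/2"] e obtain N where N: "\<And>n. n \<ge> N \<Longrightarrow> ?R n < e / 2"
      by (auto simp: eventually_sequentially)
    have main: "(LINT x|M. norm (?f n x - ?f m x)) \<le> e" if "N \<le> n" "n \<le> m" for n m
    proof -
      have iu: "integrable M (\<lambda>x. u n x - u m x)" and iG: "integrable M (\<lambda>x. G n x - G m x)"
        using ui Gi by auto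
      have "(LINT x|M. norm (?f n x - ?f m x)) \<le> (LINT x|M. \<bar>u n x - u m x\<bar> + norm (G n x - G m x))"
      proof (rule integral_mono)
        show "integrable M (\<lambda>x. norm (?f n x - ?f m x))" using fi by (intro integrable_norm Bochner_Integration.integrable_diff)
        show "norm (?f n x - ?f m x) \<le> \<bar>u n x - u m x\<bar> + norm (G n x - G m x)" for x
          using norm_Pair_le[of "u n x - u m x" "G n x - G m x"] by simp
      qed (use iu iG in auto)
      also have "\<dots> = (LINT x|M. \<bar>u n x - u m x\<bar>) + (LINT x|M. norm (G n x - G m x))"
        using iu iG by simp
      also have "\<dots> \<le> (8 / \<mu> * ?\<epsilon> n / \<eta> + \<eta> * ?m) + (C * ((L - r n) / 2 + ?\<epsilon> n) + \<eta> * (3 * ?m + 2 * K))"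
      proof (rule add_mono)
        show "(LINT x|M. \<bar>u n x - u m x\<bar>) \<le> 8 / \<mu> * ?\<epsilon> n / \<eta> + \<eta> * ?m"
          using LINT_abs_le_square[OF \<eta> iu d2] divide_right_mono[OF sq[OF that(2)], of \<eta>] \<eta> by linarith
        show "(LINT x|M. norm (G n x - G m x)) \<le> C * ((L - r n) / 2 + ?\<epsilon> n) + \<eta> * (3 * ?m + 2 * K)"
          using CG[OF Y[of n] Y[of m] K K] mult_left_mono[OF gap[OF that(2)] C] by linarith
      qed
      also have "\<dots> = ?R n + \<eta> * (4 * ?m + 2 * K)" by (simp add: algebra_simps)
      also have "\<dots> \<le> e" using N[OF that(1)] \<eta>e by linarith
      finally show ?thesis .
    qed
    have "(LINT x|M. norm (?f m x - ?f n x)) \<le> e" if "N \<le> m" "N \<le> n" for m n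
    proof (cases "m \<le> n")
      case True
      then show ?thesis by (rule main[OF that(1)])
    next
      case False
      then have "(LINT x|M. norm (?f n x - ?f m x)) \<le> e" using main[OF that(2), of m] by simp
      then show ?thesis by (subst norm_minus_commute)
    qed
    then show ?thesis by blast
  qed
  obtain h and s :: "nat \<Rightarrow> nat" where s: "strict_mono s" "AE x in M. (\<lambda>n. ?f (s n) x) \<longlonglongrightarrow> h x"
    and hi: "integrable M h" and hl: "(\<lambda>n. LINT x|M. norm (?f n x - h x)) \<longlonglongrightarrow> 0"
    using L1_complete[OF fi cauchy] by blast
  define v where "v x = fst (h x)" for x
  define H where "H x = snd (h x)" for x
  have h_eq: "h x = (v x, H x)" for x by (simp add: v_def H_def)
  have vi: "integrable M v" and Hi: "integrable M H"
    unfolding v_def H_def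
    by (rule integrable_bounded_linear[OF bounded_linear_fst hi], rule integrable_bounded_linear[OF bounded_linear_snd hi])
  note [measurable] = borel_measurable_integrable[OF vi] borel_measurable_integrable[OF Hi]
  have lim_u: "AE x in M. (\<lambda>n. u (s n) x) \<longlonglongrightarrow> v x"
    using s(2)
  proof eventually_elim
    case (elim x)
    from tendsto_fst[OF elim] show ?case by (simp add: v_def)
  qed
  have lim_G: "AE x in M. (\<lambda>n. G (s n) x) \<longlonglongrightarrow> H x"
    using s(2)
  proof eventually_elim
    case (elim x)
    from tendsto_snd[OF elim] show ?case by (simp add: H_def)
  qed
  have di: "integrable M (\<lambda>x. norm (?f n x - h x))" for n
    using fi hi by (intro integrable_norm Bochner_Integration.integrable_diff)
  have wg: "has_weak_gradient \<Omega> v H"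
  proof (rule has_weak_gradient_limit[OF open_domain YD(3)[OF Y] ui Gi vi Hi])
    show "(\<lambda>n. LINT x|M. \<bar>u n x - v x\<bar>) \<longlonglongrightarrow> 0"
    proof (rule tendsto_sandwich[OF _ _ tendsto_const hl])
      show "\<forall>\<^sub>F n in sequentially. (LINT x|M. \<bar>u n x - v x\<bar>) \<le> (LINT x|M. norm (?f n x - h x))"
      proof (intro always_eventually allI integral_mono di)
        show "\<bar>u n x - v x\<bar> \<le> norm (?f n x - h x)" for n x
          using norm_fst_le[of "u n x - v x" "G n x - H x"] by (simp add: h_eq)
      qed (use ui vi in auto)
    qed simp
    show "(\<lambda>n. LINT x|M. norm (G n x - H x)) \<longlonglongrightarrow> 0"
    proof (rule tendsto_sandwich[OF _ _ tendsto_const hl])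
      show "\<forall>\<^sub>F n in sequentially. (LINT x|M. norm (G n x - H x)) \<le> (LINT x|M. norm (?f n x - h x))"
      proof (intro always_eventually allI integral_mono di)
        show "norm (G n x - H x) \<le> norm (?f n x - h x)" for n x
          using norm_snd_le[of "G n x - H x" "u n x - v x"] by (simp add: h_eq)
      qed (use Gi Hi in auto)
    qed simp
  qed
  have v2: "integrable M (\<lambda>x. (v x)\<^sup>2)"
  proof (rule Fatou_real(1)[OF YD(2)[OF Y]])
    show "AE x in M. (\<lambda>n. (u (s n) x)\<^sup>2) \<longlonglongrightarrow> (v x)\<^sup>2"
      using lim_u by eventually_elim (rule tendsto_power)
    show "(LINT x|M. (u (s n) x)\<^sup>2) \<le> K2" for n by (rule K2)
  qed auto
  have HL: "integrable M (\<lambda>x. norm (H x) powr p x)"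
  proof (rule Fatou_real(1)[where f = "\<lambda>n x. norm (G (s n) x) powr p x"])
    show "integrable M (\<lambda>x. norm (G (s n) x) powr p x)" for n
      using YD(5)[OF Y] by (simp add: Lvar_def)
    show "AE x in M. (\<lambda>n. norm (G (s n) x) powr p x) \<longlonglongrightarrow> norm (H x) powr p x"
      using lim_G AE_space
    proof eventually_elim
      case (elim x)
      have p: "0 < p x" using p_lower[of x] q_gt_1 elim(2) by simp
      show ?case
        by (rule tendsto_powr2[OF tendsto_norm[OF elim(1)] tendsto_const]) (use p in auto)
    qed
    show "(LINT x|M. norm (G (s n) x) powr p x) \<le> K" for n by (rule K)
  qed auto
  have YH: "Y v H"
    using v2 wg HL by (simp add: Y_def Lvar_def)
  have "(LINT x|M. dens \<mu> g v H x) \<le> I"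
  proof (rule Fatou_real(2)[where f = "\<lambda>n. dens \<mu> g (u (s n)) (G (s n))"])
    show "integrable M (dens \<mu> g (u (s n)) (G (s n)))" for n by (rule dens_integrable[OF mu g Y])
    show "AE x in M. 0 \<le> dens \<mu> g (u (s n)) (G (s n)) x" for n by (rule dens_nonneg[OF mu g])
    show "AE x in M. (\<lambda>n. dens \<mu> g (u (s n)) (G (s n)) x) \<longlonglongrightarrow> dens \<mu> g v H x"
      using lim_u lim_G regular
    proof eventually_elim
      case (elim x)
      show ?case unfolding dens_def[OF mu g]
        by (intro tendsto_intros tendsto_flux_potential[OF elim(3)] elim(1,2)) (use mu in auto)
    qed
    show "dens \<mu> g v H \<in> borel_measurable M"
      using dens_integrable[OF mu g YH] by auto
    show "(LINT x|M. dens \<mu> g (u (s n)) (G (s n)) x) \<le> I + ?\<epsilon> (s n)" for n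
      using en[of "s n"] by (simp add: energy_def[OF mu g])
    show "(\<lambda>n. I + ?\<epsilon> (s n)) \<longlonglongrightarrow> I"
      using tendsto_add[OF tendsto_const LIMSEQ_subseq_LIMSEQ[OF LIMSEQ_inverse_real_of_nat s(1)], of I]
      by (simp add: o_def)
  qed
  then have "energy \<mu> g v H \<le> energy \<mu> g w W" if "Y w W" for w W
    using I[OF that] by (simp add: energy_def[OF mu g])
  with YH show thesis by (rule that)
qed

end

subsection \<open>The auxiliary equation\<close>

lemma DERIV_max_square: "((\<lambda>s::real. (max 0 s)\<^sup>2) has_real_derivative 2 * max 0 s) (at s)"
proof -
  consider "s < 0" | "s > 0" | "s = 0" by linarith
  then show ?thesis
  proof cases
    case 1
    have "((\<lambda>s. 0) has_real_derivative 2 * max 0 s) (at s)" using 1 by simp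
    then show ?thesis
      by (rule has_field_derivative_transform_within_open[of _ _ _ "{..<0}"]) (use 1 in auto)
  next
    case 2
    have "((\<lambda>s. s\<^sup>2) has_real_derivative 2 * max 0 s) (at s)"
      using 2 by (auto intro!: derivative_eq_intros)
    then show ?thesis
      by (rule has_field_derivative_transform_within_open[of _ _ _ "{0<..}"]) (use 2 in auto)
  next
    case 3
    have "((\<lambda>h::real. (max 0 h)\<^sup>2 / h) \<longlongrightarrow> 0) (at 0)"
    proof (rule Lim_null_comparison[of _ "\<lambda>h. \<bar>h\<bar>"])
      have "norm ((max 0 h)\<^sup>2 / h) \<le> \<bar>h\<bar>" for h :: real
        by (cases "h \<le> 0") (simp_all add: max_def power2_eq_square)
      then show "\<forall>\<^sub>F h in at 0. norm ((max 0 h)\<^sup>2 / h) \<le> \<bar>h :: real\<bar>" by simp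
      show "((\<lambda>h::real. \<bar>h\<bar>) \<longlongrightarrow> 0) (at 0)" by (simp add: tendsto_rabs_zero)
    qed
    then show ?thesis using 3 by (simp add: DERIV_def)
  qed
qed

text \<open>Stands in for the positive part in the comparison argument. It vanishes exactly for
  \<open>s \<le> 0\<close>, and its derivative is continuous, nonnegative and bounded, as the chain
  rule and the sign conditions demand.\<close>

definition smooth_pos :: "real \<Rightarrow> real" where
  "smooth_pos s = sqrt (1 + (max 0 s)\<^sup>2) - 1"

definition smooth_pos' :: "real \<Rightarrow> real" where
  "smooth_pos' s = max 0 s / sqrt (1 + (max 0 s)\<^sup>2)"

lemma smooth_pos_deriv: "(smooth_pos has_real_derivative smooth_pos' s) (at s)"
proof -
  have p: "0 < 1 + (max 0 s)\<^sup>2" by (simp add: add_pos_nonneg)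
  have "((\<lambda>s. sqrt (1 + (max 0 s)\<^sup>2) - 1) has_real_derivative
      inverse (sqrt (1 + (max 0 s)\<^sup>2)) / 2 * (0 + 2 * max 0 s) - 0) (at s)"
    by (intro DERIV_diff DERIV_const DERIV_chain2[where f = sqrt and g = "\<lambda>s. 1 + (max 0 s)\<^sup>2", OF DERIV_real_sqrt[OF p]] DERIV_add DERIV_max_square)
  then show ?thesis by (simp add: smooth_pos_def[abs_def] smooth_pos'_def field_simps)
qed

lemma smooth_pos'_continuous: "continuous_on UNIV smooth_pos'"
proof -
  have "sqrt (1 + (max 0 s)\<^sup>2) \<noteq> 0" for s :: real
    by (metis add_pos_nonneg less_irrefl real_sqrt_eq_0_iff zero_le_power2 zero_less_one)
  then show ?thesis
    unfolding smooth_pos'_def[abs_def] by (intro continuous_intros) auto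
qed

lemma smooth_pos'_bounds: "0 \<le> smooth_pos' s" "\<bar>smooth_pos' s\<bar> \<le> 1"
proof -
  show "0 \<le> smooth_pos' s" by (simp add: smooth_pos'_def)
  moreover have "max 0 s \<le> sqrt (1 + (max 0 s)\<^sup>2)" by (rule real_le_rsqrt) simp
  then have "smooth_pos' s \<le> 1"
    unfolding smooth_pos'_def by (simp add: divide_le_eq_1 add_pos_nonneg)
  ultimately show "\<bar>smooth_pos' s\<bar> \<le> 1" by simp
qed

lemma smooth_pos_nonneg: "0 \<le> smooth_pos s" and smooth_pos_eq_0: "s \<le> 0 \<Longrightarrow> smooth_pos s = 0"
  and smooth_pos_pos: "0 < s \<Longrightarrow> 0 < smooth_pos s"
  by (simp_all add: smooth_pos_def)

context flux_setting
begin

text \<open>The weak form is tested with all of \<open>Y\<close>, the class in which the minimiser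
  is found. Tests from \<open>W1var\<close> are recovered in \<open>solves_test_W1var\<close> when
  the residual is bounded.\<close>

definition solves :: "real \<Rightarrow> ('a \<Rightarrow> real) \<Rightarrow> ('a \<Rightarrow> real) \<Rightarrow> ('a \<Rightarrow> 'a) \<Rightarrow> bool" where
  "solves \<mu> g u G \<longleftrightarrow> Y u G \<and>
     (\<forall>v H. Y v H \<longrightarrow> (LINT x|M. flux \<Psi> x (G x) \<bullet> H x + (\<mu> * u x - g x) * v x) = 0)"

lemma residual_integrable:
  assumes g: "g \<in> borel_measurable M" "integrable M (\<lambda>x. (g x)\<^sup>2)" and u: "Y u G" and v: "Y v H"
  shows "integrable M (\<lambda>x. (\<mu> * u x - g x) * v x)"
  using integrable_product[OF YD(1)[OF u] YD(1)[OF v] YD(2)[OF u] YD(2)[OF v]]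
    integrable_product[OF g(1) YD(1)[OF v] g(2) YD(2)[OF v]]
  by (simp add: left_diff_distrib mult.assoc)

lemma test_integrable:
  assumes g: "g \<in> borel_measurable M" "integrable M (\<lambda>x. (g x)\<^sup>2)" and u: "Y u G" and v: "Y v H"
  shows "integrable M (\<lambda>x. flux \<Psi> x (G x) \<bullet> H x + (\<mu> * u x - g x) * v x)"
  using residual_integrable[OF g u v] flux_integrable[OF YD(4,5)[OF u] YD(4,5)[OF v]]
  by simp

text \<open>Instead of differentiating the potential, the subgradient inequality is taken at the
  perturbed point \<open>u + t v\<close>. Minimality gives the sign of the perturbed form for each
  \<open>t = 1 / (n + 1)\<close>, and continuity of the flux carries it to
  \<open>t = 0\<close>.\<close>

lemma minimizer_variation_nonneg:
  assumes mu: "\<mu> > 0" and g: "g \<in> borel_measurable M" "integrable M (\<lambda>x. (g x)\<^sup>2)"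
    and u: "Y u G" and min: "\<And>v H. Y v H \<Longrightarrow> energy \<mu> g u G \<le> energy \<mu> g v H" and v: "Y v H"
  shows "0 \<le> (LINT x|M. flux \<Psi> x (G x) \<bullet> H x + (\<mu> * u x - g x) * v x)"
proof -
  let ?t = "\<lambda>n. inverse (real (Suc n))"
  let ?u = "\<lambda>n x. 1 * u x + ?t n * v x" and ?G = "\<lambda>n x. 1 *\<^sub>R G x + ?t n *\<^sub>R H x"
  let ?K = "\<lambda>n x. flux \<Psi> x (?G n x) \<bullet> H x + (\<mu> * ?u n x - g x) * v x"
  note Yn = Y_lincomb[OF u v, of 1]
  have iK: "integrable M (?K n)" for n by (rule test_integrable[OF g Yn v])
  have step: "0 \<le> (LINT x|M. ?K n x)" for n
  proof -
    have t: "0 < ?t n" by simp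
    have "AE x in M. dens \<mu> g (?u n) (?G n) x - ?t n * ?K n x \<le> dens \<mu> g u G x"
      using regular
    proof eventually_elim
      case (elim x)
      have "G x - ?G n x = - ?t n *\<^sub>R H x" by simp
      with flux_subgradient[OF elim, of "?G n x" "G x"]
      have a: "flux_potential \<Psi> x (?G n x) - ?t n * (flux \<Psi> x (?G n x) \<bullet> H x) \<le> flux_potential \<Psi> x (G x)"
        by (simp only: inner_scaleR_right)
      have "b\<^sup>2 - 2 * b * (b - a) \<le> a\<^sup>2" for a b :: real
        using zero_le_power2[of "a - b"] by (simp add: power2_eq_square algebra_simps)
      from this[of "\<mu> * ?u n x - g x" "\<mu> * u x - g x"]
      have "((\<mu> * ?u n x - g x)\<^sup>2 - 2 * (\<mu> * ?u n x - g x) * (\<mu> * (?t n * v x))) / (2 * \<mu>) \<le> (\<mu> * u x - g x)\<^sup>2 / (2 * \<mu>)"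
        using mu by (intro divide_right_mono) (simp_all add: distrib_left)
      also have "((\<mu> * ?u n x - g x)\<^sup>2 - 2 * (\<mu> * ?u n x - g x) * (\<mu> * (?t n * v x))) / (2 * \<mu>) =
          (\<mu> * ?u n x - g x)\<^sup>2 / (2 * \<mu>) - ?t n * ((\<mu> * ?u n x - g x) * v x)"
        using mu by (simp add: diff_divide_distrib)
      finally show ?case using a unfolding dens_def[OF mu g] distrib_left[of "?t n"] by linarith
    qed
    then have "(LINT x|M. dens \<mu> g (?u n) (?G n) x - ?t n * ?K n x) \<le> (LINT x|M. dens \<mu> g u G x)"
      using iK[of n] dens_integrable[OF mu g Yn[of "?t n"]] dens_integrable[OF mu g u]
      by (intro integral_mono_AE) auto
    then have "energy \<mu> g (?u n) (?G n) - ?t n * (LINT x|M. ?K n x) \<le> energy \<mu> g u G"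
      unfolding energy_def[OF mu g]
      using iK[of n] dens_integrable[OF mu g Yn[of "?t n"]] by (subst (asm) Bochner_Integration.integral_diff) auto
    with min[OF Yn[of "?t n"]] have "0 \<le> ?t n * (LINT x|M. ?K n x)" by linarith
    with t show ?thesis by (simp add: zero_le_mult_iff)
  qed
  \<comment> \<open>The modulus is monotone and the perturbed gradient is no longer than the sum of
    the norms of \<open>G\<close> and \<open>H\<close>, so the bound is independent of
    \<open>n\<close>.\<close>
  let ?W = "\<lambda>x. flux_modulus \<Psi> x \<bar>\<bar>norm (G x)\<bar> + \<bar>norm (H x)\<bar>\<bar> * \<bar>norm (H x)\<bar> + (\<bar>(\<mu> * u x - g x) * v x\<bar> + \<mu> * (v x)\<^sup>2)"
  have "(\<lambda>n. LINT x|M. ?K n x) \<longlonglongrightarrow> (LINT x|M. flux \<Psi> x (G x) \<bullet> H x + (\<mu> * u x - g x) * v x)"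
  proof (rule integral_dominated_convergence[where w = ?W])
    show "integrable M ?W"
      using integrable_growth[OF Lvar_add[OF YD(5)[OF u] YD(5)[OF v]] YD(5)[OF v]]
        residual_integrable[OF g u v, of \<mu>] YD(2)[OF v]
      by (intro Bochner_Integration.integrable_add integrable_abs) auto
    show "AE x in M. (\<lambda>n. ?K n x) \<longlonglongrightarrow> flux \<Psi> x (G x) \<bullet> H x + (\<mu> * u x - g x) * v x"
      using regular
    proof eventually_elim
      case (elim x)
      have "(\<lambda>n. ?G n x) \<longlonglongrightarrow> 1 *\<^sub>R G x + 0 *\<^sub>R H x"
        by (intro tendsto_intros LIMSEQ_inverse_real_of_nat)
      then have 1: "(\<lambda>n. ?G n x) \<longlonglongrightarrow> G x" by simp
      have "(\<lambda>n. ?u n x) \<longlonglongrightarrow> 1 * u x + 0 * v x"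
        by (intro tendsto_intros LIMSEQ_inverse_real_of_nat)
      then have 2: "(\<lambda>n. ?u n x) \<longlonglongrightarrow> u x" by simp
      show ?case by (intro tendsto_intros tendsto_flux[OF elim 1] 2)
    qed
    show "AE x in M. norm (?K n x) \<le> ?W x" for n
      using regular
    proof eventually_elim
      case (elim x)
      have t: "0 \<le> ?t n" "?t n \<le> 1" using le_imp_inverse_le[of 1 "real (Suc n)"] by auto
      have "norm (?G n x) \<le> norm (G x) + ?t n * norm (H x)"
        using norm_triangle_ineq[of "1 *\<^sub>R G x" "?t n *\<^sub>R H x"] by simp
      also have "\<dots> \<le> norm (G x) + norm (H x)" using mult_right_mono[OF t(2), of "norm (H x)"] by simp
      finally have nG: "norm (?G n x) \<le> norm (G x) + norm (H x)" .
      have "\<bar>flux \<Psi> x (?G n x) \<bullet> H x\<bar> \<le> flux_modulus \<Psi> x (norm (?G n x)) * norm (H x)"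
        using Cauchy_Schwarz_ineq2[of "flux \<Psi> x (?G n x)" "H x"] by (simp only: norm_flux[OF elim])
      also have "\<dots> \<le> flux_modulus \<Psi> x (norm (G x) + norm (H x)) * norm (H x)"
        by (intro mult_right_mono flux_modulus_mono[OF elim] nG) auto
      finally have A: "\<bar>flux \<Psi> x (?G n x) \<bullet> H x\<bar> \<le> flux_modulus \<Psi> x (norm (G x) + norm (H x)) * norm (H x)" .
      have "(\<mu> * ?u n x - g x) * v x = (\<mu> * u x - g x) * v x + ?t n * (\<mu> * (v x)\<^sup>2)"
        by (simp add: power2_eq_square algebra_simps)
      moreover have "\<bar>?t n * (\<mu> * (v x)\<^sup>2)\<bar> \<le> \<mu> * (v x)\<^sup>2"
        using mult_right_mono[OF t(2), of "\<mu> * (v x)\<^sup>2"] t mu by (simp add: abs_mult)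
      ultimately have B: "\<bar>(\<mu> * ?u n x - g x) * v x\<bar> \<le> \<bar>(\<mu> * u x - g x) * v x\<bar> + \<mu> * (v x)\<^sup>2"
        using abs_triangle_ineq[of "(\<mu> * u x - g x) * v x" "?t n * (\<mu> * (v x)\<^sup>2)"] by linarith
      have N: "norm (?K n x) \<le> \<bar>flux \<Psi> x (?G n x) \<bullet> H x\<bar> + \<bar>(\<mu> * ?u n x - g x) * v x\<bar>"
        unfolding real_norm_def by (rule abs_triangle_ineq)
      have absn: "\<bar>norm (G x) + norm (H x)\<bar> = norm (G x) + norm (H x)" by simp
      show ?case unfolding abs_norm_cancel absn by (rule order_trans[OF N add_mono[OF A B]])
    qed
  qed (use iK test_integrable[OF g u v] in auto)
  then show ?thesis using step by (intro LIMSEQ_le_const) auto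
qed

lemma solution_exists:
  assumes mu: "\<mu> > 0" and g: "g \<in> borel_measurable M" "integrable M (\<lambda>x. (g x)\<^sup>2)"
  shows "\<exists>u G. solves \<mu> g u G"
proof -
  obtain u G where u: "Y u G" and min: "\<And>v H. Y v H \<Longrightarrow> energy \<mu> g u G \<le> energy \<mu> g v H"
    by (rule minimizer[OF mu g]) (rule that; assumption)
  have "(LINT x|M. flux \<Psi> x (G x) \<bullet> H x + (\<mu> * u x - g x) * v x) = 0" if v: "Y v H" for v H
  proof -
    \<comment> \<open>The variation \<open>- v\<close>, written as a linear combination so that
      \<open>Y_lincomb\<close> applies.\<close>
    have "0 \<le> (LINT x|M. flux \<Psi> x (G x) \<bullet> ((-1) *\<^sub>R H x + 0 *\<^sub>R H x) + (\<mu> * u x - g x) * (-1 * v x + 0 * v x))"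
      by (rule minimizer_variation_nonneg[OF mu g u min Y_lincomb[OF v v]])
    also have "\<dots> = (LINT x|M. - (flux \<Psi> x (G x) \<bullet> H x + (\<mu> * u x - g x) * v x))"
      by (rule Bochner_Integration.integral_cong[OF refl]) simp
    also have "\<dots> = - (LINT x|M. flux \<Psi> x (G x) \<bullet> H x + (\<mu> * u x - g x) * v x)"
      by (rule integral_minus)
    finally show ?thesis using minimizer_variation_nonneg[OF mu g u min v] by linarith
  qed
  with u show ?thesis unfolding solves_def by blast
qed

lemma solves_difference:
  assumes g: "g \<in> borel_measurable M" "integrable M (\<lambda>x. (g x)\<^sup>2)"
    and h: "h \<in> borel_measurable M" "integrable M (\<lambda>x. (h x)\<^sup>2)"
    and u: "solves \<mu> g u G" and v: "solves \<mu> h v H" and w: "Y w W"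
  defines "R \<equiv> \<lambda>x. (flux \<Psi> x (G x) - flux \<Psi> x (H x)) \<bullet> W x + (\<mu> * (u x - v x) - (g x - h x)) * w x"
  shows "integrable M R" "(LINT x|M. R x) = 0"
proof -
  have Y: "Y u G" "Y v H" using u v by (auto simp: solves_def)
  note i = test_integrable[OF g Y(1) w, of \<mu>] test_integrable[OF h Y(2) w, of \<mu>]
  have eq: "R = (\<lambda>x. (flux \<Psi> x (G x) \<bullet> W x + (\<mu> * u x - g x) * w x) - (flux \<Psi> x (H x) \<bullet> W x + (\<mu> * v x - h x) * w x))"
    unfolding R_def by (simp add: fun_eq_iff inner_diff_left algebra_simps)
  show "integrable M R" unfolding eq by (rule Bochner_Integration.integrable_diff[OF i])
  show "(LINT x|M. R x) = 0"
    unfolding eq Bochner_Integration.integral_diff[OF i] using u v w by (simp add: solves_def)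
qed

text \<open>Tested with \<open>smooth_pos\<close> of \<open>u - v\<close>, the difference of the
  equations has an integrand that is a sum of nonnegative terms and has integral 0. Hence the
  product of \<open>u - v\<close> and \<open>smooth_pos (u - v)\<close> vanishes almost
  everywhere.\<close>

lemma comparison:
  assumes mu: "\<mu> > 0" and g: "g \<in> borel_measurable M" "integrable M (\<lambda>x. (g x)\<^sup>2)"
    and h: "h \<in> borel_measurable M" "integrable M (\<lambda>x. (h x)\<^sup>2)"
    and u: "solves \<mu> g u G" and v: "solves \<mu> h v H" and le: "AE x in M. g x \<le> h x"
  shows "AE x in M. u x \<le> v x"
proof -
  have Y: "Y u G" "Y v H" using u v by (auto simp: solves_def)
  let ?w = "\<lambda>x. 1 * u x + (-1) * v x" and ?W = "\<lambda>x. 1 *\<^sub>R G x + (-1) *\<^sub>R H x"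
  have Yw: "Y (\<lambda>x. smooth_pos (?w x)) (\<lambda>x. smooth_pos' (?w x) *\<^sub>R ?W x)"
    by (rule Y_chain[OF Y_lincomb[OF Y] smooth_pos_deriv smooth_pos'_continuous smooth_pos'_bounds(2)])
  let ?R = "\<lambda>x. (flux \<Psi> x (G x) - flux \<Psi> x (H x)) \<bullet> (smooth_pos' (?w x) *\<^sub>R ?W x) + (\<mu> * (u x - v x) - (g x - h x)) * smooth_pos (?w x)"
  have R: "integrable M ?R" "(LINT x|M. ?R x) = 0"
    using solves_difference[OF g h u v Yw] by simp_all
  have ge: "AE x in M. \<mu> * ((u x - v x) * smooth_pos (u x - v x)) \<le> ?R x"
    using regular le
  proof eventually_elim
    case (elim x)
    have "0 \<le> smooth_pos' (u x - v x) * ((flux \<Psi> x (G x) - flux \<Psi> x (H x)) \<bullet> (G x - H x))"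
      by (intro mult_nonneg_nonneg smooth_pos'_bounds flux_monotone[OF elim(1)])
    moreover have "0 \<le> (h x - g x) * smooth_pos (u x - v x)"
      using elim(2) by (intro mult_nonneg_nonneg smooth_pos_nonneg) simp
    ultimately show ?case by (simp add: algebra_simps)
  qed
  have nn: "0 \<le> \<mu> * (s * smooth_pos s)" for s
    using mu smooth_pos_nonneg[of s] smooth_pos_eq_0[of s] by (cases "s \<le> 0") auto
  have R0: "AE x in M. 0 \<le> ?R x"
    using ge by eventually_elim (use nn order_trans in blast)
  have "AE x in M. ?R x = 0"
    using integral_nonneg_eq_0_iff_AE[OF R(1) R0] R(2) by simp
  with ge show ?thesis
  proof eventually_elim
    case (elim x)
    show ?case
    proof (rule ccontr)
      assume "\<not> u x \<le> v x"
      then have "0 < \<mu> * ((u x - v x) * smooth_pos (u x - v x))"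
        using mu by (intro mult_pos_pos smooth_pos_pos) auto
      with elim show False by linarith
    qed
  qed
qed

text \<open>The difference of the equations is tested with \<open>u - v\<close>, and the monotone
  flux term is discarded. This is the continuity of the solution operator.\<close>

lemma stability:
  assumes mu: "\<mu> > 0" and g: "g \<in> borel_measurable M" "integrable M (\<lambda>x. (g x)\<^sup>2)"
    and h: "h \<in> borel_measurable M" "integrable M (\<lambda>x. (h x)\<^sup>2)"
    and u: "solves \<mu> g u G" and v: "solves \<mu> h v H"
  shows "\<mu> * (LINT x|M. (u x - v x)\<^sup>2) \<le> (LINT x|M. (g x - h x) * (u x - v x))"
proof -
  have Y: "Y u G" "Y v H" using u v by (auto simp: solves_def)
  let ?w = "\<lambda>x. 1 * u x + (-1) * v x" and ?W = "\<lambda>x. 1 *\<^sub>R G x + (-1) *\<^sub>R H x"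
  note Yw = Y_lincomb[OF Y, of 1 "-1"]
  let ?R = "\<lambda>x. (flux \<Psi> x (G x) - flux \<Psi> x (H x)) \<bullet> ?W x + (\<mu> * (u x - v x) - (g x - h x)) * ?w x"
  have R: "integrable M ?R" "(LINT x|M. ?R x) = 0"
    using solves_difference[OF g h u v Yw] by simp_all
  have i1: "integrable M (\<lambda>x. (u x - v x)\<^sup>2)" and wm: "(\<lambda>x. u x - v x) \<in> borel_measurable M"
    using YD(2,1)[OF Yw] by simp_all
  have i2: "integrable M (\<lambda>x. (g x - h x) * (u x - v x))"
    using integrable_product[OF g(1) wm g(2) i1] integrable_product[OF h(1) wm h(2) i1]
    by (simp add: left_diff_distrib)
  have "(LINT x|M. \<mu> * (u x - v x)\<^sup>2 - (g x - h x) * (u x - v x)) \<le> (LINT x|M. ?R x)"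
  proof (rule integral_mono_AE[OF _ R(1)])
    show "AE x in M. \<mu> * (u x - v x)\<^sup>2 - (g x - h x) * (u x - v x) \<le> ?R x"
      using regular
    proof eventually_elim
      case (elim x)
      show ?case
        using flux_monotone[OF elim, of "G x" "H x"] by (simp add: power2_eq_square left_diff_distrib mult.assoc)
    qed
  qed (use i1 i2 in simp)
  then show ?thesis using R(2) i1 i2 by simp
qed

lemma solves_zero: "solves \<mu> (\<lambda>x. 0) (\<lambda>x. 0) (\<lambda>x. 0)"
  using Y_zero by (simp add: solves_def flux_def)

lemma solves_one: "solves \<mu> (\<lambda>x. \<mu>) (\<lambda>x. 1) (\<lambda>x. 0)"
  using Y_one by (simp add: solves_def flux_def)

subsection \<open>Monotone iteration\<close>


text \<open>An element of \<open>W1var\<close> may fail to be square integrable, but its truncations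
  are bounded and thus lie in \<open>Y\<close>.\<close>

lemma W1var_truncation:
  fixes n :: nat
  assumes \<phi>: "\<phi> \<in> W1var \<Omega> p"
  shows "Y (\<lambda>x. real (Suc n) * arctan (\<phi> x / real (Suc n)))
    (\<lambda>x. inverse (1 + (\<phi> x / real (Suc n))\<^sup>2) *\<^sub>R weak_grad \<Omega> \<phi> x)"
proof -
  let ?k = "real (Suc n)"
  have k: "0 < ?k" by simp
  note W = W1var_gradient[OF \<phi>]
  note [measurable] = W(2,4)
  have "integrable M (\<lambda>x. (?k * arctan (\<phi> x / ?k))\<^sup>2)"
  proof (rule integrable_const_bound[of _ "(?k * 2)\<^sup>2"])
    show "AE x in M. norm ((?k * arctan (\<phi> x / ?k))\<^sup>2) \<le> (?k * 2)\<^sup>2"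
    proof (rule AE_I2)
      fix x show "norm ((?k * arctan (\<phi> x / ?k))\<^sup>2) \<le> (?k * 2)\<^sup>2"
        using power_mono[OF real_truncation(4)[OF k, of "\<phi> x"], of 2] by simp
    qed
  qed measurable
  moreover have "(\<lambda>x. norm (inverse (1 + (\<phi> x / ?k)\<^sup>2) *\<^sub>R weak_grad \<Omega> \<phi> x)) \<in> Lvar \<Omega> p"
  proof (rule Lvar_bound[OF W(3)])
    show "AE x in M. \<bar>norm (inverse (1 + (\<phi> x / ?k)\<^sup>2) *\<^sub>R weak_grad \<Omega> \<phi> x)\<bar> \<le> \<bar>norm (weak_grad \<Omega> \<phi> x)\<bar>"
    proof (rule AE_I2)
      fix x
      show "\<bar>norm (inverse (1 + (\<phi> x / ?k)\<^sup>2) *\<^sub>R weak_grad \<Omega> \<phi> x)\<bar> \<le> \<bar>norm (weak_grad \<Omega> \<phi> x)\<bar>"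
        using mult_right_mono[OF real_truncation(3)[OF k, of "\<phi> x"], of "norm (weak_grad \<Omega> \<phi> x)"] by simp
    qed
  qed measurable
  moreover have "has_weak_gradient \<Omega> (\<lambda>x. ?k * arctan (\<phi> x / ?k))
    (\<lambda>x. inverse (1 + (\<phi> x / ?k)\<^sup>2) *\<^sub>R weak_grad \<Omega> \<phi> x)"
    by (rule weak_gradient_chain[OF open_domain W(1) real_truncation(1)[OF k] real_truncation(2)[OF k] real_truncation(3)[OF k]])
  ultimately show ?thesis unfolding Y_def by (auto intro!: borel_measurable_const)
qed

text \<open>The truncations of \<open>\<phi>\<close> are admissible tests, and dominated convergence
  removes the truncation. The bound \<open>C\<close> compensates for \<open>\<phi>\<close> being
  merely integrable: it dominates the product with the residual.\<close>

lemma solves_test_W1var: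
  assumes g: "g \<in> borel_measurable M" "integrable M (\<lambda>x. (g x)\<^sup>2)"
    and u: "solves \<mu> g u G" and bd: "AE x in M. \<bar>\<mu> * u x - g x\<bar> \<le> C" and \<phi>: "\<phi> \<in> W1var \<Omega> p"
  shows "(LINT x|M. flux \<Psi> x (G x) \<bullet> weak_grad \<Omega> \<phi> x) = (LINT x|M. (g x - \<mu> * u x) * \<phi> x)"
proof -
  have Y: "Y u G" using u by (simp add: solves_def)
  note W = W1var_gradient[OF \<phi>]
  note [measurable] = W(2,4) YD(1)[OF Y] g(1) flux_measurable[OF YD(4,5)[OF Y]]
  have i\<phi>: "integrable M \<phi>" using \<phi> by (intro Lvar_integrable) (simp add: W1var_def)
  have i1: "integrable M (\<lambda>x. flux \<Psi> x (G x) \<bullet> weak_grad \<Omega> \<phi> x)"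
    by (rule flux_integrable[OF YD(4,5)[OF Y] W(2,3)])
  have i2: "integrable M (\<lambda>x. (\<mu> * u x - g x) * \<phi> x)"
  proof (rule Bochner_Integration.integrable_bound[of M "\<lambda>x. C * \<bar>\<phi> x\<bar>"])
    show "AE x in M. norm ((\<mu> * u x - g x) * \<phi> x) \<le> norm (C * \<bar>\<phi> x\<bar>)"
      using bd
    proof eventually_elim
      case (elim x)
      then show ?case using mult_right_mono[OF elim, of "\<bar>\<phi> x\<bar>"] by (simp add: abs_mult)
    qed
  qed (use i\<phi> in auto)
  let ?\<phi> = "\<lambda>n x. real (Suc n) * arctan (\<phi> x / real (Suc n))"
  let ?H = "\<lambda>n x. inverse (1 + (\<phi> x / real (Suc n))\<^sup>2) *\<^sub>R weak_grad \<Omega> \<phi> x"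
  let ?K = "\<lambda>n x. flux \<Psi> x (G x) \<bullet> ?H n x + (\<mu> * u x - g x) * ?\<phi> n x"
  have "(\<lambda>n. LINT x|M. ?K n x) \<longlonglongrightarrow> (LINT x|M. flux \<Psi> x (G x) \<bullet> weak_grad \<Omega> \<phi> x + (\<mu> * u x - g x) * \<phi> x)"
  proof (rule integral_dominated_convergence[where w = "\<lambda>x. \<bar>flux \<Psi> x (G x) \<bullet> weak_grad \<Omega> \<phi> x\<bar> + \<bar>(\<mu> * u x - g x) * \<phi> x\<bar>"])
    show "AE x in M. (\<lambda>n. ?K n x) \<longlonglongrightarrow> flux \<Psi> x (G x) \<bullet> weak_grad \<Omega> \<phi> x + (\<mu> * u x - g x) * \<phi> x"
    proof (rule AE_I2)
      fix x
      have "(\<lambda>n. ?K n x) \<longlonglongrightarrow> flux \<Psi> x (G x) \<bullet> (1 *\<^sub>R weak_grad \<Omega> \<phi> x) + (\<mu> * u x - g x) * \<phi> x"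
        by (intro tendsto_add tendsto_inner tendsto_scaleR tendsto_mult tendsto_const tendsto_truncation)
      then show "(\<lambda>n. ?K n x) \<longlonglongrightarrow> flux \<Psi> x (G x) \<bullet> weak_grad \<Omega> \<phi> x + (\<mu> * u x - g x) * \<phi> x"
        by (simp only: scaleR_one)
    qed
    show "AE x in M. norm (?K n x) \<le> \<bar>flux \<Psi> x (G x) \<bullet> weak_grad \<Omega> \<phi> x\<bar> + \<bar>(\<mu> * u x - g x) * \<phi> x\<bar>" for n
    proof (rule AE_I2)
      fix x
      let ?c = "inverse (1 + (\<phi> x / real (Suc n))\<^sup>2)"
      have k: "0 < real (Suc n)" by simp
      have "\<bar>flux \<Psi> x (G x) \<bullet> ?H n x\<bar> = \<bar>?c\<bar> * \<bar>flux \<Psi> x (G x) \<bullet> weak_grad \<Omega> \<phi> x\<bar>"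
        by (simp only: inner_scaleR_right abs_mult)
      also have "\<dots> \<le> 1 * \<bar>flux \<Psi> x (G x) \<bullet> weak_grad \<Omega> \<phi> x\<bar>"
        by (rule mult_right_mono[OF real_truncation(3)[OF k]]) simp
      finally have a: "\<bar>flux \<Psi> x (G x) \<bullet> ?H n x\<bar> \<le> \<bar>flux \<Psi> x (G x) \<bullet> weak_grad \<Omega> \<phi> x\<bar>" by simp
      have b: "\<bar>(\<mu> * u x - g x) * ?\<phi> n x\<bar> \<le> \<bar>(\<mu> * u x - g x) * \<phi> x\<bar>"
        unfolding abs_mult[of "\<mu> * u x - g x"] by (rule mult_left_mono[OF real_truncation(5)[OF k]]) simp
      show "norm (?K n x) \<le> \<bar>flux \<Psi> x (G x) \<bullet> weak_grad \<Omega> \<phi> x\<bar> + \<bar>(\<mu> * u x - g x) * \<phi> x\<bar>"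
        unfolding real_norm_def by (rule order_trans[OF abs_triangle_ineq add_mono[OF a b]])
    qed
  qed (use i1 i2 in \<open>measurable, auto\<close>)
  moreover have "(LINT x|M. ?K n x) = 0" for n
    using u W1var_truncation[OF \<phi>, of n] by (simp only: solves_def)
  ultimately have "(LINT x|M. flux \<Psi> x (G x) \<bullet> weak_grad \<Omega> \<phi> x + (\<mu> * u x - g x) * \<phi> x) = 0"
    by (simp only: LIMSEQ_const_iff)
  then have "(LINT x|M. flux \<Psi> x (G x) \<bullet> weak_grad \<Omega> \<phi> x) = - (LINT x|M. (\<mu> * u x - g x) * \<phi> x)"
    using i1 i2 by simp
  also have "\<dots> = (LINT x|M. - ((\<mu> * u x - g x) * \<phi> x))" by (rule integral_minus[symmetric])
  also have "\<dots> = (LINT x|M. (g x - \<mu> * u x) * \<phi> x)"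
    by (rule Bochner_Integration.integral_cong[OF refl]) (simp add: algebra_simps)
  finally show ?thesis .
qed

text \<open>The values of \<open>v\<close> are rounded down to a grid of width
  \<open>1 / (n + 1)\<close>. Each grid value contributes a measurable slice on a measurable set,
  and continuity in \<open>s\<close> gives the limit.\<close>

lemma Caratheodory_measurable:
  fixes f :: "'a \<Rightarrow> real \<Rightarrow> real"
  assumes fm: "\<And>s. s \<in> {0..1} \<Longrightarrow> (\<lambda>x. f x s) \<in> borel_measurable M"
    and cont: "AE x in M. continuous_on {0..1} (f x)"
    and v [measurable]: "v \<in> borel_measurable M" and v01: "AE x in M. 0 \<le> v x \<and> v x \<le> 1"
  shows "(\<lambda>x. f x (v x)) \<in> borel_measurable M"
proof (rule measurable_LIMSEQ_AE)
  \<comment> \<open>The index runs up to \<open>Suc n\<close> in order to include the value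
    \<open>v x = 1\<close>.\<close>
  let ?a = "\<lambda>n x. \<Sum>k\<le>Suc n. (if real k \<le> real (Suc n) * v x \<and> real (Suc n) * v x < real k + 1 then f x (real k / real (Suc n)) else 0)"
  show "?a n \<in> borel_measurable M" for n
  proof (intro borel_measurable_sum measurable_If borel_measurable_const fm)
    fix k assume "k \<in> {..Suc n}"
    then show "real k / real (Suc n) \<in> {0..1}" by (simp del: of_nat_Suc)
    show "{x \<in> space M. real k \<le> real (Suc n) * v x \<and> real (Suc n) * v x < real k + 1} \<in> sets M"
      by measurable
  qed
  show "AE x in M. (\<lambda>n. ?a n x) \<longlonglongrightarrow> f x (v x)"
    using cont v01
  proof eventually_elim
    case (elim x)
    let ?k = "\<lambda>n. nat \<lfloor>real (Suc n) * v x\<rfloor>"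
    have k0: "0 \<le> real (Suc n) * v x" and k1: "real (Suc n) * v x \<le> real (Suc n)" for n
      using elim(2) by (simp_all add: mult_left_le del: of_nat_Suc)
    have fl: "real (?k n) \<le> real (Suc n) * v x" "real (Suc n) * v x < real (?k n) + 1" for n
      using k0[of n] by linarith+
    have kle: "?k n \<le> Suc n" for n
    proof -
      have "real (?k n) \<le> real (Suc n)" using fl(1)[of n] k1[of n] by (rule order_trans)
      then show ?thesis by (simp only: of_nat_le_iff)
    qed
    have uniq: "real k \<le> real (Suc n) * v x \<and> real (Suc n) * v x < real k + 1 \<longleftrightarrow> k = ?k n" for k n
    proof
      assume "real k \<le> real (Suc n) * v x \<and> real (Suc n) * v x < real k + 1"
      then have "real k < real (?k n) + 1" "real (?k n) < real k + 1" using fl[of n] by linarith+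
      then show "k = ?k n" by linarith
    qed (use fl in blast)
    have a: "?a n x = f x (real (?k n) / real (Suc n))" for n
      unfolding uniq using kle[of n] by (simp add: sum.delta del: of_nat_Suc)
    have lim: "(\<lambda>n. real (?k n) / real (Suc n)) \<longlonglongrightarrow> v x"
    proof (rule tendsto_sandwich)
      show "(\<lambda>n. v x - inverse (real (Suc n))) \<longlonglongrightarrow> v x"
        using tendsto_diff[OF tendsto_const LIMSEQ_inverse_real_of_nat, of "v x"] by simp
      have "v x - inverse (real (Suc n)) \<le> real (?k n) / real (Suc n)" for n
      proof -
        have "v x = (real (Suc n) * v x) / real (Suc n)" by simp
        also have "\<dots> \<le> (real (?k n) + 1) / real (Suc n)"
          using fl(2)[of n] by (intro divide_right_mono) auto
        finally show ?thesis by (simp add: add_divide_distrib inverse_eq_divide)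
      qed
      then show "\<forall>\<^sub>F n in sequentially. v x - inverse (real (Suc n)) \<le> real (?k n) / real (Suc n)" by simp
      have "real (?k n) / real (Suc n) \<le> v x" for n
        using fl(1)[of n] by (simp add: divide_le_eq mult.commute del: of_nat_Suc)
      then show "\<forall>\<^sub>F n in sequentially. real (?k n) / real (Suc n) \<le> v x" by simp
    qed simp
    have "(\<lambda>n. f x (real (?k n) / real (Suc n))) \<longlonglongrightarrow> f x (v x)"
    proof (rule continuous_on_tendsto_compose[OF elim(1) lim])
      show "v x \<in> {0..1}" using elim(2) by simp
      show "\<forall>\<^sub>F n in sequentially. real (?k n) / real (Suc n) \<in> {0..1}"
        using kle by (intro always_eventually allI) (simp del: of_nat_Suc)
    qed
    then show ?case by (simp only: a)
  qed
qed

section \<open>Convergence of the iterates to a weak solution\<close>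

lemma weak_solution_exists:
  fixes f :: "'a \<Rightarrow> real \<Rightarrow> real"
  assumes mu: "\<mu> > 0"
    and fm: "\<And>s. s \<in> {0..1} \<Longrightarrow> (\<lambda>x. f x s) \<in> borel_measurable M"
    and cont: "AE x in M. continuous_on {0..1} (f x)"
    and mono: "AE x in M. mono_on {0..1} (\<lambda>s. f x s + \<mu> * s)"
    and f0: "AE x in M. 0 \<le> f x 0" and f1: "AE x in M. f x 1 \<le> 0"
  shows "\<exists>U. weak_solution \<Omega> p \<Psi> f U"
proof -
  define V where "V v \<longleftrightarrow> v \<in> borel_measurable M \<and> (AE x in M. 0 \<le> v x \<and> v x \<le> 1)" for v :: "'a \<Rightarrow> real"
  define g where "g v x = f x (v x) + \<mu> * v x" for v x
  have gm: "g v \<in> borel_measurable M" if "V v" for v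
  proof -
    have v: "v \<in> borel_measurable M" "AE x in M. 0 \<le> v x \<and> v x \<le> 1" using that unfolding V_def by blast+
    note [measurable] = v(1) Caratheodory_measurable[OF fm cont v]
    show ?thesis unfolding g_def by measurable
  qed
  have g01: "AE x in M. 0 \<le> g v x \<and> g v x \<le> \<mu>" if "V v" for v
  proof -
    have "AE x in M. 0 \<le> v x \<and> v x \<le> 1" using that by (simp add: V_def)
    then show ?thesis
      using mono f0 f1
    proof eventually_elim
      case (elim x)
      have "f x 0 + \<mu> * 0 \<le> f x (v x) + \<mu> * v x" "f x (v x) + \<mu> * v x \<le> f x 1 + \<mu> * 1"
        by (rule mono_onD[OF elim(2)]; use elim(1) in simp)+
      then show ?case using elim(3,4) by (simp add: g_def)
    qed
  qed
  have g2: "integrable M (\<lambda>x. (g v x)\<^sup>2)" if "V v" for v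
  proof (rule integrable_const_bound[of _ "\<mu>\<^sup>2"])
    show "AE x in M. norm ((g v x)\<^sup>2) \<le> \<mu>\<^sup>2"
      using g01[OF that] by eventually_elim (simp add: power_mono)
  qed (use gm[OF that] in simp)
  have gmono: "AE x in M. g v x \<le> g w x" if "V v" "V w" "AE x in M. v x \<le> w x" for v w
  proof -
    have "AE x in M. 0 \<le> v x \<and> v x \<le> 1" "AE x in M. 0 \<le> w x \<and> w x \<le> 1"
      using that by (auto simp: V_def)
    then show ?thesis
      using mono that(3)
    proof eventually_elim
      case (elim x)
      show ?case unfolding g_def
        by (rule mono_onD[OF elim(3)]) (use elim in auto)
    qed
  qed
  have Vsol: "V u" if "solves \<mu> (g v) u G" "V v" for u G v
  proof -
    have "AE x in M. 0 \<le> u x"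
      by (rule comparison[OF mu _ _ gm[OF that(2)] g2[OF that(2)] solves_zero that(1)])
        (use g01[OF that(2)] in \<open>auto elim: eventually_mono\<close>)
    moreover have "AE x in M. u x \<le> 1"
      by (rule comparison[OF mu gm[OF that(2)] g2[OF that(2)] _ _ that(1) solves_one])
        (use g01[OF that(2)] in \<open>auto elim: eventually_mono\<close>)
    moreover have "u \<in> borel_measurable M" using that(1) YD(1) by (auto simp: solves_def)
    ultimately show ?thesis by (auto simp: V_def)
  qed
  have V1: "V (\<lambda>x. 1)" by (simp add: V_def)
  \<comment> \<open>The clause for \<open>n = 0\<close> is carried in the invariant in order to fix
    the starting value of the dependent choice.\<close>
  have "\<exists>u. \<forall>n. (V (u n) \<and> (n = 0 \<longrightarrow> u n = (\<lambda>x. 1))) \<and> (\<exists>G. solves \<mu> (g (u n)) (u (Suc n)) G)"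
  proof (rule dependent_nat_choice)
    show "\<exists>u. V u \<and> (0 = (0::nat) \<longrightarrow> u = (\<lambda>x. 1))" using V1 by blast
    fix v and n :: nat assume "V v \<and> (n = 0 \<longrightarrow> v = (\<lambda>x. 1))"
    then have v: "V v" by simp
    obtain u G where "solves \<mu> (g v) u G" using solution_exists[OF mu gm[OF v] g2[OF v]] by blast
    with Vsol[OF this v] show "\<exists>u. (V u \<and> (Suc n = 0 \<longrightarrow> u = (\<lambda>x. 1))) \<and> (\<exists>G. solves \<mu> (g v) u G)"
      by blast
  qed
  then obtain u where Vu: "\<And>n. V (u n)" and u0: "u 0 = (\<lambda>x. 1)"
    and sol: "\<And>n. \<exists>G. solves \<mu> (g (u n)) (u (Suc n)) G" by blast
  have dec: "AE x in M. u (Suc n) x \<le> u n x" for n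
  proof (induction n)
    case 0
    show ?case using Vu[of "Suc 0"] by (auto simp: u0 V_def elim: eventually_mono)
  next
    case (Suc n)
    obtain G G' where s: "solves \<mu> (g (u (Suc n))) (u (Suc (Suc n))) G" "solves \<mu> (g (u n)) (u (Suc n)) G'"
      using sol by blast
    show ?case
      by (rule comparison[OF mu gm[OF Vu] g2[OF Vu] gm[OF Vu] g2[OF Vu] s gmono[OF Vu Vu Suc]])
  qed
  define w where "w x = lim (\<lambda>n. u n x)" for x
  have "AE x in M. \<forall>n. u (Suc n) x \<le> u n x \<and> 0 \<le> u n x \<and> u n x \<le> 1"
    using dec Vu by (simp add: AE_all_countable V_def)
  then have conv: "AE x in M. (\<forall>n. 0 \<le> u n x \<and> u n x \<le> 1) \<and> (\<lambda>n. u n x) \<longlonglongrightarrow> w x"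
  proof eventually_elim
    case (elim x)
    then have "decseq (\<lambda>n. u n x)" by (intro decseq_SucI) simp
    then obtain l where "(\<lambda>n. u n x) \<longlonglongrightarrow> l"
      using decseq_convergent[of "\<lambda>n. u n x" 0] elim by blast
    then show ?case using elim by (simp add: w_def limI)
  qed
  have Vw: "V w"
    unfolding V_def
  proof
    show "w \<in> borel_measurable M"
      unfolding w_def using Vu by (intro borel_measurable_lim_metric) (simp add: V_def)
    show "AE x in M. 0 \<le> w x \<and> w x \<le> 1"
      using conv by eventually_elim (auto intro: LIMSEQ_le_const LIMSEQ_le_const2)
  qed
  \<comment> \<open>\<open>U\<close> solves the equation with the data of the limit
    \<open>w\<close>. Comparing it with \<open>u (Suc n)\<close> through the stability estimate will
    show \<open>U = w\<close> almost everywhere.\<close>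
  obtain U G where U: "solves \<mu> (g w) U G" using solution_exists[OF mu gm[OF Vw] g2[OF Vw]] by blast
  have VU: "V U" by (rule Vsol[OF U Vw])
  note [measurable] = gm[OF Vu] gm[OF Vw]
  have um [measurable]: "u n \<in> borel_measurable M" for n using Vu[of n] by (simp add: V_def)
  have wm [measurable]: "w \<in> borel_measurable M" and Um [measurable]: "U \<in> borel_measurable M"
    using Vw VU by (simp_all add: V_def)
  have w01: "AE x in M. 0 \<le> w x \<and> w x \<le> 1" using Vw by (simp add: V_def)
  have U01: "AE x in M. 0 \<le> U x \<and> U x \<le> 1" using VU by (simp add: V_def)
  \<comment> \<open>The right-hand side of the stability estimate. The data converge pointwise, and
    the integrands are bounded by \<open>2 * \<mu>\<close>.\<close>
  have l1: "(\<lambda>n. LINT x|M. (g (u n) x - g w x) * (u (Suc n) x - U x)) \<longlonglongrightarrow> (LINT x|M. 0)"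
  proof (rule integral_dominated_convergence[where w = "\<lambda>x. 2 * \<mu>"])
    show "AE x in M. (\<lambda>n. (g (u n) x - g w x) * (u (Suc n) x - U x)) \<longlonglongrightarrow> 0"
      using conv cont w01
    proof eventually_elim
      case (elim x)
      have "(\<lambda>n. f x (u n x)) \<longlonglongrightarrow> f x (w x)"
        by (rule continuous_on_tendsto_compose[OF elim(2)]) (use elim in auto)
      then have "(\<lambda>n. g (u n) x) \<longlonglongrightarrow> g w x"
        unfolding g_def using elim(1) by (intro tendsto_intros) auto
      then have a: "(\<lambda>n. g (u n) x - g w x) \<longlonglongrightarrow> 0" by (rule LIM_zero)
      have b: "(\<lambda>n. u (Suc n) x - U x) \<longlonglongrightarrow> w x - U x"
        using elim(1) by (intro tendsto_intros LIMSEQ_Suc) auto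
      show ?case using tendsto_mult[OF a b] by simp
    qed
    show "AE x in M. norm ((g (u n) x - g w x) * (u (Suc n) x - U x)) \<le> 2 * \<mu>" for n
      using g01[OF Vu[of n]] g01[OF Vw] conv U01
    proof eventually_elim
      case (elim x)
      have u: "0 \<le> u (Suc n) x" "u (Suc n) x \<le> 1" using elim(3) by auto
      have "\<bar>g (u n) x - g w x\<bar> * \<bar>u (Suc n) x - U x\<bar> \<le> (2 * \<mu>) * 1"
        using elim(1,2,4) u by (intro mult_mono) auto
      then show ?case by (simp add: abs_mult)
    qed
  qed measurable
  have le: "\<mu> * (LINT x|M. (u (Suc n) x - U x)\<^sup>2) \<le> (LINT x|M. (g (u n) x - g w x) * (u (Suc n) x - U x))" for n
  proof -
    obtain G' where s: "solves \<mu> (g (u n)) (u (Suc n)) G'" using sol by blast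
    show ?thesis by (rule stability[OF mu gm[OF Vu] g2[OF Vu] gm[OF Vw] g2[OF Vw] s U])
  qed
  have sqb: "AE x in M. \<bar>(w x - U x)\<^sup>2\<bar> \<le> 1"
    using w01 U01
  proof eventually_elim
    case (elim x)
    then have "\<bar>w x - U x\<bar> \<le> 1" by (simp add: abs_le_iff)
    then show ?case by (simp add: abs_square_le_1)
  qed
  have l2: "(\<lambda>n. LINT x|M. (u (Suc n) x - U x)\<^sup>2) \<longlonglongrightarrow> (LINT x|M. (w x - U x)\<^sup>2)"
  proof (rule integral_dominated_convergence[where w = "\<lambda>x. 1"])
    show "AE x in M. (\<lambda>n. (u (Suc n) x - U x)\<^sup>2) \<longlonglongrightarrow> (w x - U x)\<^sup>2"
      using conv by eventually_elim (intro tendsto_intros LIMSEQ_Suc, auto)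
    show "AE x in M. norm ((u (Suc n) x - U x)\<^sup>2) \<le> 1" for n
      using conv U01
    proof eventually_elim
      case (elim x)
      have "0 \<le> u (Suc n) x" "u (Suc n) x \<le> 1" using elim(1) by auto
      with elim(2) have "\<bar>u (Suc n) x - U x\<bar> \<le> 1" by (simp add: abs_le_iff)
      then show ?case by (simp add: abs_square_le_1)
    qed
  qed measurable
  have "\<mu> * (LINT x|M. (w x - U x)\<^sup>2) \<le> (LINT x|M. 0)"
    by (rule LIMSEQ_le[OF tendsto_mult_left[OF l2] l1]) (use le in blast)
  then have "(LINT x|M. (w x - U x)\<^sup>2) \<le> 0" using mu by (simp add: mult_le_0_iff)
  then have z: "(LINT x|M. (w x - U x)\<^sup>2) = 0"
    by (intro antisym integral_nonneg_AE) auto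
  have isq: "integrable M (\<lambda>x. (w x - U x)\<^sup>2)"
    by (rule integrable_const_bound[of _ 1]) (use sqb in auto)
  have "AE x in M. (w x - U x)\<^sup>2 = 0"
    using integral_nonneg_eq_0_iff_AE[OF isq] z by simp
  then have wU: "AE x in M. w x = U x" by eventually_elim simp
  have YU: "Y U G" using U by (simp add: solves_def)
  have UL: "U \<in> Lvar \<Omega> p"
    by (rule Lvar_bounded[OF Um, of 1]) (use U01 in \<open>eventually_elim, auto\<close>)
  note UW = Y_imp_W1var[OF YU UL]
  have "(LINT x|M. flux \<Psi> x (weak_grad \<Omega> U x) \<bullet> weak_grad \<Omega> \<phi> x) = (LINT x|M. f x (U x) * \<phi> x)"
    if \<phi>: "\<phi> \<in> W1var \<Omega> p" for \<phi>
  proof -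
    note W = W1var_gradient[OF \<phi>] and WU = W1var_gradient[OF UW(1)]
    have "(LINT x|M. flux \<Psi> x (weak_grad \<Omega> U x) \<bullet> weak_grad \<Omega> \<phi> x) = (LINT x|M. flux \<Psi> x (G x) \<bullet> weak_grad \<Omega> \<phi> x)"
    proof (rule integral_cong_AE)
      show "AE x in M. flux \<Psi> x (weak_grad \<Omega> U x) \<bullet> weak_grad \<Omega> \<phi> x = flux \<Psi> x (G x) \<bullet> weak_grad \<Omega> \<phi> x"
        using UW(2) by eventually_elim simp
    qed (use flux_integrable[OF WU(2,3) W(2,3)] flux_integrable[OF YD(4,5)[OF YU] W(2,3)] in auto)
    also have "\<dots> = (LINT x|M. (g w x - \<mu> * U x) * \<phi> x)"
    proof (rule solves_test_W1var[OF gm[OF Vw] g2[OF Vw] U _ \<phi>])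
      show "AE x in M. \<bar>\<mu> * U x - g w x\<bar> \<le> 2 * \<mu>"
        using g01[OF Vw] U01
      proof eventually_elim
        case (elim x)
        have "0 \<le> \<mu> * U x" "\<mu> * U x \<le> \<mu>" using elim(2) mu by (simp_all add: mult_left_le)
        then show ?case using elim(1) by linarith
      qed
    qed
    \<comment> \<open>As \<open>w = U\<close> almost everywhere, the term \<open>\<mu> * w\<close>
      inside \<open>g w\<close> cancels \<open>\<mu> * U\<close>.\<close>
    also have "\<dots> = (LINT x|M. f x (U x) * \<phi> x)"
    proof (rule integral_cong_AE)
      show "AE x in M. (g w x - \<mu> * U x) * \<phi> x = f x (U x) * \<phi> x"
        using wU by eventually_elim (simp add: g_def)
      show "(\<lambda>x. (g w x - \<mu> * U x) * \<phi> x) \<in> borel_measurable M" using W(4) by measurable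
      have "(\<lambda>x. f x (U x)) \<in> borel_measurable M"
        by (rule Caratheodory_measurable[OF fm cont Um U01])
      then show "(\<lambda>x. f x (U x) * \<phi> x) \<in> borel_measurable M" using W(4) by measurable
    qed
    finally show ?thesis .
  qed
  then have "weak_solution \<Omega> p \<Psi> f U"
    using UW(1) U01 by (simp add: weak_solution_def)
  then show ?thesis by blast
qed

end

subsection \<open>The hypotheses of the theorem\<close>

text \<open>The radius \<open>exp (- (C / e))\<close> solves \<open>C / (- ln r) = e\<close>; the
  bound 1/2 is the range of the hypothesis.\<close>

lemma log_Hoelder_imp_continuous_on:
  fixes p :: "'a::euclidean_space \<Rightarrow> real"
  assumes "log_Hoelder_on S p"
  shows "continuous_on S p"
proof -
  obtain C where C: "C > 0" and H: "\<And>x y. x \<in> S \<Longrightarrow> y \<in> S \<Longrightarrow> 0 < norm (x - y) \<Longrightarrow> norm (x - y) < 1/2 \<Longrightarrow>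
      \<bar>p x - p y\<bar> \<le> C / (- ln (norm (x - y)))"
    using assms by (auto simp: log_Hoelder_on_def)
  show ?thesis
    unfolding continuous_on_iff
  proof (intro ballI allI impI)
    fix x e assume x: "x \<in> S" and e: "(0::real) < e"
    let ?d = "min (1/2) (exp (- (C / e)))"
    have "dist (p y) (p x) < e" if y: "y \<in> S" "dist y x < ?d" for y
    proof (cases "y = x")
      case False
      let ?r = "norm (y - x)"
      have r: "0 < ?r" "?r < 1/2" "?r < exp (- (C / e))" using False y by (auto simp: dist_norm)
      have "ln ?r < ln (exp (- (C / e)))" using r by (subst ln_less_cancel_iff) auto
      then have l: "C / e < - ln ?r" by simp
      then have "0 < - ln ?r" using C e by (meson divide_pos_pos less_trans)
      moreover have "C < - ln ?r * e" using l e by (simp only: pos_divide_less_eq)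
      ultimately have "C / (- ln ?r) < e" by (simp only: pos_divide_less_eq mult.commute)
      with H[OF y(1) x r(1,2)] show ?thesis by (simp add: dist_real_def)
    qed (use e in simp)
    then show "\<exists>d>0. \<forall>y\<in>S. dist y x < d \<longrightarrow> dist (p y) (p x) < e"
      by (intro exI[of _ ?d]) auto
  qed
qed

text \<open>The definition with a single interval, whose end points are the two given points in
  increasing order.\<close>

lemma abs_continuous_on_imp_continuous_on:
  assumes "abs_continuous_on {c..d} h"
  shows "continuous_on {c..d} h"
  unfolding continuous_on_iff
proof (intro ballI allI impI)
  fix x e assume x: "x \<in> {c..d}" and "(0::real) < e"
  then obtain \<delta> where \<delta>: "\<delta> > 0" and D: "\<And>(n::nat) a b.
        (\<forall>i<n. a i \<le> b i \<and> {a i..b i} \<subseteq> {c..d}) \<and>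
        disjoint_family_on (\<lambda>i. {a i<..<b i}) {..<n} \<and>
        (\<Sum>i<n. b i - a i) < \<delta> \<Longrightarrow> (\<Sum>i<n. \<bar>h (b i) - h (a i)\<bar>) < e"
    using assms unfolding abs_continuous_on_def by blast
  have "dist (h y) (h x) < e" if y: "y \<in> {c..d}" "dist y x < \<delta>" for y
  proof (cases "x \<le> y")
    case True
    then show ?thesis
      using D[of 1 "\<lambda>_. x" "\<lambda>_. y"] x y by (auto simp: dist_real_def disjoint_family_on_def)
  next
    case False
    then show ?thesis
      using D[of 1 "\<lambda>_. y" "\<lambda>_. x"] x y by (auto simp: dist_real_def disjoint_family_on_def abs_minus_commute)
  qed
  with \<delta> show "\<exists>d'>0. \<forall>y\<in>{c..d}. dist y x < d' \<longrightarrow> dist (h y) (h x) < e" by blast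
qed

text \<open>Local absolute continuity gives continuity away from 0. At 0, where the modulus is set
  to 0, continuity is the limit hypothesis, and positivity of \<open>\<Psi>\<close> extends
  monotonicity to this point.\<close>

lemma regular_fluxI:
  assumes ac: "locally_abs_continuous_on {0<..} (\<Psi> x)" and lim: "((\<lambda>s. \<Psi> x s * s) \<longlongrightarrow> 0) (at_right 0)"
    and mono: "strict_mono_on {0<..} (\<lambda>s. \<Psi> x s * s)" and pos: "\<And>s. s > 0 \<Longrightarrow> \<Psi> x s > 0"
  shows "regular_flux \<Psi> x"
  unfolding regular_flux_def
proof
  show "mono_on {0..} (flux_modulus \<Psi> x)"
  proof (rule mono_onI)
    fix r s :: real assume rs: "r \<in> {0..}" "s \<in> {0..}" "r \<le> s"
    show "flux_modulus \<Psi> x r \<le> flux_modulus \<Psi> x s"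
    proof (cases "r = 0")
      case True
      have "0 \<le> \<Psi> x s * s" if "0 < s" using pos[OF that] that by simp
      then show ?thesis using True rs by (cases "s = 0") (auto simp: flux_modulus_def)
    next
      case False
      then have "\<Psi> x r * r \<le> \<Psi> x s * s"
        using rs strict_mono_onD[OF mono, of r s] by (cases "r = s") auto
      then show ?thesis using False rs by (auto simp: flux_modulus_def)
    qed
  qed
  show "continuous_on {0..} (flux_modulus \<Psi> x)"
    unfolding continuous_on_def
  proof
    fix s :: real assume "s \<in> {0..}"
    then consider "s = 0" | "0 < s" by fastforce
    then show "(flux_modulus \<Psi> x \<longlongrightarrow> flux_modulus \<Psi> x s) (at s within {0..})"
    proof cases
      case 1
      have "(flux_modulus \<Psi> x \<longlongrightarrow> 0) (at_right 0)"
      proof (rule Lim_transform_eventually[OF lim])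
        show "\<forall>\<^sub>F s in at_right 0. \<Psi> x s * s = flux_modulus \<Psi> x s"
          by (rule eventually_mono[OF eventually_at_right_less]) (simp add: flux_modulus_def)
      qed
      then have "(flux_modulus \<Psi> x \<longlongrightarrow> 0) (at 0 within {0..})"
        by (simp add: at_within_Ici_at_right)
      then show ?thesis using 1 by (simp add: flux_modulus_def)
    next
      case 2
      have "{s / 2 .. 2 * s} \<subseteq> {0<..}" using 2 by auto
      then have "continuous_on {s / 2 .. 2 * s} (\<Psi> x)"
        using ac by (auto simp: locally_abs_continuous_on_def intro: abs_continuous_on_imp_continuous_on)
      then have "isCont (\<Psi> x) s"
        by (rule continuous_on_interior) (use 2 in \<open>simp add: interior_atLeastAtMost_real\<close>)
      then have "((\<lambda>s. \<Psi> x s * s) \<longlongrightarrow> \<Psi> x s * s) (at s)"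
        by (intro tendsto_intros) (simp_all add: isCont_def)
      moreover have "\<forall>\<^sub>F t in at s. \<Psi> x t * t = flux_modulus \<Psi> x t"
      proof -
        have "\<forall>\<^sub>F t in at s. t \<in> {0<..}" by (rule eventually_at_in_open') (use 2 in auto)
        then show ?thesis by eventually_elim (simp add: flux_modulus_def)
      qed
      ultimately have "(flux_modulus \<Psi> x \<longlongrightarrow> \<Psi> x s * s) (at s)" by (rule Lim_transform_eventually)
      then have "(flux_modulus \<Psi> x \<longlongrightarrow> flux_modulus \<Psi> x s) (at s)" using 2 by (simp add: flux_modulus_def)
      then show ?thesis by (rule tendsto_within_subset) simp
    qed
  qed
qed

text \<open>Joint Lebesgue measurability gives measurable slices for almost every \<open>s\<close> only; continuity in \<open>s\<close>
  extends this to all \<open>s\<close>.\<close>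

lemma measurable_slices:
  fixes f :: "'a::euclidean_space \<Rightarrow> real \<Rightarrow> real"
  assumes f: "(\<lambda>(x, s). f x s) \<in> borel_measurable (lebesgue_on (S \<times> {0..1}))"
    and S: "closed S" and \<Omega>: "\<Omega> \<subseteq> S" "\<Omega> \<in> sets lebesgue"
    and cont: "AE x in lebesgue_on \<Omega>. continuous_on {0..1} (f x)" and s: "s \<in> {0..1}"
  shows "(\<lambda>x. f x s) \<in> borel_measurable (lebesgue_on \<Omega>)"
proof -
  let ?D = "S \<times> {0..1::real}"
  have D: "?D \<in> sets lebesgue" using closed_Times[OF S closed_atLeastAtMost[of 0 "1::real"]] by simp
  have "(\<lambda>z. if z \<in> ?D then (case z of (x, s) \<Rightarrow> f x s) else 0) \<in> borel_measurable lebesgue"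
    using borel_measurable_if_I[OF f D] .
  \<comment> \<open>A Borel function \<open>k\<close> agrees with the extension of \<open>f\<close>
    by 0 off a null set \<open>N\<close> of the product. By Fubini, the slices of \<open>N\<close>
    at almost all parameters are null.\<close>
  from completion_ex_borel_measurable_real[OF this] obtain k
    where k: "k \<in> borel_measurable lborel" and ae: "AE z in lborel. (if z \<in> ?D then (case z of (x, s) \<Rightarrow> f x s) else 0) = k z"
    by blast
  from ae obtain N where N: "N \<in> null_sets lborel"
    "\<And>z. z \<in> space lborel - N \<Longrightarrow> (if z \<in> ?D then (case z of (x, s) \<Rightarrow> f x s) else 0) = k z"
    by (rule AE_E3) blast
  have Nm [measurable]: "N \<in> sets (borel \<Otimes>\<^sub>M borel)" using null_setsD2[OF N(1)] by (simp only: borel_prod sets_lborel)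
  have "AE z in lborel \<Otimes>\<^sub>M lborel. z \<notin> N" unfolding lborel_prod by (rule AE_not_in[OF N(1)])
  then have "AE x in lborel. AE s in lborel. (x, s) \<notin> N" by (rule lborel_pair.AE_pair)
  then have good: "AE s in lborel. AE x in lborel. (x, s) \<notin> N"
    by (subst (asm) lborel_pair.AE_commute) measurable
  have meas: "(\<lambda>x. f x s) \<in> borel_measurable (lebesgue_on \<Omega>)"
    if s: "s \<in> {0..1}" and g: "AE x in lborel. (x, s) \<notin> N" for s
  proof (rule borel_measurable_AE_lebesgue_on[OF _ _ \<Omega>(2)])
    have [measurable]: "k \<in> borel_measurable (borel \<Otimes>\<^sub>M borel)" using k by (simp add: borel_prod)
    have "(\<lambda>x. k (x, s)) \<in> borel_measurable borel" by measurable
    then show "(\<lambda>x. k (x, s)) \<in> borel_measurable (lebesgue_on \<Omega>)"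
      by (simp add: measurable_restrict_space1 measurable_completion)
    have "AE x in lebesgue. (x, s) \<notin> N" using g by (rule AE_completion)
    then have "AE x in lebesgue. x \<in> \<Omega> \<longrightarrow> k (x, s) = f x s"
    proof eventually_elim
      case (elim x)
      show ?case using N(2)[of "(x, s)"] elim s \<Omega>(1) by auto
    qed
    then show "AE x in lebesgue_on \<Omega>. k (x, s) = f x s" using \<Omega>(2) by (simp add: AE_restrict_space_iff)
  qed
  \<comment> \<open>Good parameters accumulate at \<open>s\<close>: otherwise a nondegenerate
    interval inside the unit interval would consist of bad ones.\<close>
  have "\<exists>t. t \<in> {0..1} \<and> \<bar>t - s\<bar> < inverse (Suc n) \<and> (AE x in lborel. (x, t) \<notin> N)" for n
  proof (rule ccontr)
    let ?e = "inverse (real (Suc n))"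
    assume "\<not> ?thesis"
    then have no: "\<And>t. t \<in> {0..1} \<Longrightarrow> \<bar>t - s\<bar> < ?e \<Longrightarrow> \<not> (AE x in lborel. (x, t) \<notin> N)" by blast
    define a b where "a = max 0 (s - ?e)" and "b = min 1 (s + ?e)"
    have e: "0 < ?e" by simp
    have ab: "a < b" using s e unfolding a_def b_def atLeastAtMost_iff by linarith
    have "AE t in lborel. t \<notin> {a<..<b}"
      using good
    proof eventually_elim
      case (elim t)
      show ?case
      proof
        assume "t \<in> {a<..<b}"
        then have "t \<in> {0..1}" "\<bar>t - s\<bar> < ?e" by (auto simp: a_def b_def simp del: of_nat_Suc)
        with no elim show False by blast
      qed
    qed
    then have "emeasure lborel {a<..<b} = 0"
      by (subst (asm) AE_iff_null_sets[symmetric]) (simp, rule null_setsD1)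
    then show False using ab by simp
  qed
  then have "\<exists>t. \<forall>n. t n \<in> {0..1} \<and> \<bar>t n - s\<bar> < inverse (Suc n) \<and> (AE x in lborel. (x, t n) \<notin> N)"
    by (intro choice allI)
  then obtain t where t: "\<And>n. t n \<in> {0..1}" "\<And>n. \<bar>t n - s\<bar> < inverse (real (Suc n))" "\<And>n. AE x in lborel. (x, t n) \<notin> N"
    by blast
  have "(\<lambda>n. t n - s) \<longlonglongrightarrow> 0"
    by (rule Lim_null_comparison[OF _ LIMSEQ_inverse_real_of_nat]) (use t(2) in \<open>auto intro!: always_eventually less_imp_le\<close>)
  then have lim: "t \<longlonglongrightarrow> s" by (rule LIM_zero_cancel)
  show ?thesis
  proof (rule borel_measurable_LIMSEQ_AE_lebesgue_on[OF meas[OF t(1,3)] _ \<Omega>(2)])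
    show "AE x in lebesgue_on \<Omega>. (\<lambda>n. f x (t n)) \<longlonglongrightarrow> f x s"
      using cont by eventually_elim (rule continuous_on_tendsto_compose[OF _ lim s], use t(1) in auto)
  qed
qed

theorem theorem7p1:
  fixes \<Omega> :: "(real ^ 'n) set"
    and p :: "real ^ 'n \<Rightarrow> real"
    and \<Psi> f :: "real ^ 'n \<Rightarrow> real \<Rightarrow> real"
    and \<delta> \<delta>' \<mu> \<gamma> :: real
  assumes dim: "CARD('n) \<ge> 2"
    and domain: "bounded_lipschitz_domain \<Omega>"
    and p_gt_1: "\<And>x. x \<in> closure \<Omega> \<Longrightarrow> p x > 1"
    and p_cases:
      "(log_Hoelder_on (closure \<Omega>) p \<and>
          (INF x\<in>closure \<Omega>. p x) \<ge> 2 * real CARD('n) / (real CARD('n) + 2)) \<or>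
       (continuous_on (closure \<Omega>) p \<and>
          (INF x\<in>closure \<Omega>. p x) > 2 * real CARD('n) / (real CARD('n) + 2))"
    and Psi_pos: "\<And>x s. x \<in> closure \<Omega> \<Longrightarrow> s > 0 \<Longrightarrow> \<Psi> x s > 0"
    and Psi_measurable: "\<And>s. s > 0 \<Longrightarrow> (\<lambda>x. \<Psi> x s) \<in> borel_measurable (lebesgue_on (closure \<Omega>))"
    and Psi_abs_continuous: "AE x in lebesgue_on \<Omega>. locally_abs_continuous_on {0<..} (\<Psi> x)"
    and Psi_limit: "\<And>x. x \<in> \<Omega> \<Longrightarrow> ((\<lambda>s. \<Psi> x s * s) \<longlongrightarrow> 0) (at_right 0)"
    and Psi_strict_mono: "AE x in lebesgue_on \<Omega>. strict_mono_on {0<..} (\<lambda>s. \<Psi> x s * s)"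
    and Phi_growth: "\<And>v. v \<in> Lvar \<Omega> p \<Longrightarrow>
      (\<lambda>x. flux_modulus \<Psi> x (v x)) \<in> Lvar \<Omega> (conj_exponent p)"
    and delta_pos: "\<delta> > 0" and delta'_nonneg: "\<delta>' \<ge> 0"
    and coercive: "\<And>v. v \<in> W1var \<Omega> p \<Longrightarrow>
      (LINT x|lebesgue_on \<Omega>. flux_potential \<Psi> x (weak_grad \<Omega> v x))
        \<ge> \<delta> * (LINT x|lebesgue_on \<Omega>. norm (weak_grad \<Omega> v x) powr p x) - \<delta>'"
    and f_measurable:
      "(\<lambda>(x, s). f x s) \<in> borel_measurable (lebesgue_on (closure \<Omega> \<times> {0..1}))"
    and f_0_bounded: "(\<lambda>x. f x 0) \<in> Linfty \<Omega>"
    and f_0_nonneg: "AE x in lebesgue_on \<Omega>. f x 0 \<ge> 0"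
    and f_1_nonpos: "AE x in lebesgue_on \<Omega>. f x 1 \<le> 0"
    and lambda_pos: "\<mu> > 0" and gamma_pos: "\<gamma> > 0"
    and f_strict_mono: "AE x in lebesgue_on \<Omega>. strict_mono_on {0..1} (\<lambda>s. f x s + \<mu> * s)"
    and f_lipschitz: "AE x in lebesgue_on \<Omega>. \<gamma>-lipschitz_on {0..1} (f x)"
  shows "\<exists>U\<^sub>1 U\<^sub>2. weak_solution \<Omega> p \<Psi> f U\<^sub>1 \<and> weak_solution \<Omega> p \<Psi> f U\<^sub>2 \<and>
    ((AE x in lebesgue_on \<Omega>. U\<^sub>1 x = U\<^sub>2 x) \<longrightarrow>
      (\<forall>V. weak_solution \<Omega> p \<Psi> f V \<longrightarrow> (AE x in lebesgue_on \<Omega>. V x = U\<^sub>1 x)))"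
proof -
  have \<Omega>: "open \<Omega>" "bounded \<Omega>" "\<Omega> \<noteq> {}"
    using domain by (auto simp: bounded_lipschitz_domain_def)
  have sub: "\<Omega> \<subseteq> closure \<Omega>" by (rule closure_subset)
  have cl: "compact (closure \<Omega>)" "closure \<Omega> \<noteq> {}" using \<Omega> by (auto simp: compact_closure)
  have pc: "continuous_on (closure \<Omega>) p"
    using p_cases log_Hoelder_imp_continuous_on by blast
  \<comment> \<open>The extreme values \<open>p y\<close> and \<open>p z\<close> on the compact
    closure serve as \<open>q\<close> and \<open>P\<close>; \<open>p y > 1\<close> because the
    minimum is attained.\<close>
  obtain y where y: "y \<in> closure \<Omega>" "\<And>x. x \<in> closure \<Omega> \<Longrightarrow> p y \<le> p x"
    using continuous_attains_inf[OF cl pc] by blast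
  obtain z where z: "\<And>x. x \<in> closure \<Omega> \<Longrightarrow> p x \<le> p z"
    using continuous_attains_sup[OF cl pc] by blast
  have reg: "AE x in lebesgue_on \<Omega>. regular_flux \<Psi> x"
    using Psi_abs_continuous Psi_strict_mono AE_space
  proof eventually_elim
    case (elim x)
    then have "x \<in> \<Omega>" by simp
    then show ?case using elim sub by (intro regular_fluxI Psi_limit Psi_pos) auto
  qed
  have fc: "AE x in lebesgue_on \<Omega>. continuous_on {0..1} (f x)"
    using f_lipschitz by eventually_elim (rule lipschitz_on_continuous_on)
  have fm: "(\<lambda>x. f x s) \<in> borel_measurable (lebesgue_on \<Omega>)" if "s \<in> {0..1}" for s
    by (rule measurable_slices[OF f_measurable closed_closure sub _ fc that]) (use \<Omega> in simp)
  have fmono: "AE x in lebesgue_on \<Omega>. mono_on {0..1} (\<lambda>s. f x s + \<mu> * s)"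
    using f_strict_mono by eventually_elim (rule strict_mono_on_imp_mono_on)
  interpret flux_setting \<Omega> p \<Psi> "p y" "p z" \<delta> \<delta>'
  proof
    show "p \<in> borel_measurable (lebesgue_on \<Omega>)"
      by (rule continuous_imp_measurable_on_sets_lebesgue[OF continuous_on_subset[OF pc sub]]) (use \<Omega> in simp)
  qed (use \<Omega> y z p_gt_1 sub reg Phi_growth delta_pos coercive in auto)
  obtain U where U: "weak_solution \<Omega> p \<Psi> f U"
    using weak_solution_exists[OF lambda_pos fm fc fmono f_0_nonneg f_1_nonpos] by blast
  show ?thesis
  proof (cases "\<forall>V. weak_solution \<Omega> p \<Psi> f V \<longrightarrow> (AE x in lebesgue_on \<Omega>. V x = U x)")
    case True
    with U show ?thesis by blast
  next
    case False
    then obtain V where V: "weak_solution \<Omega> p \<Psi> f V" "\<not> (AE x in lebesgue_on \<Omega>. V x = U x)" by blast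
    \<comment> \<open>For the pair \<open>U\<close>, \<open>V\<close> the premise of the implication
      fails.\<close>
    with U show ?thesis by blast
  qed
qed

end
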